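(* Let $d\in\{2,3\}$, let $\kappa_0>0$ be given, with $\kappa_0\ge 1$ if $d=2$, and assume $\kappa\ge\kappa_0$ and $R\ge R_0$. Let $V_h\subset V$ be one of the finite element spaces described in the context, and suppose that there is $N_0\in\mathbb{N}$ such that for all $N\ge N_0$ the adjoint problem is uniquely solvable and $$\eta_N(V_h,L_2(B_R)):=\sup_{f\in L_2(B_R)\setminus\{0\}}\ \inf_{v_h\in V_h}\frac{\|(\mathcal{A}_N^* )^{-1}f-v_h\|_V}{\|f\|_{0,2,B_R}}\le\frac{C_-}{2\kappa C_{\mathrm b}}.$$ Then for any antilinear continuous functional $\ell:V\to\mathbb{C}$ there exists a constant $N^\ast>0$ such that for all $N\ge N^\ast$ the problem: find $u_h\in V_h$ such that $$a_N(u_h,v_h)=\ell(v_h)\quad\text{for all }v_h\in V_h,$$ is uniquely solvable.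
   Context: Setting. $\Omega\subset\mathbb{R}^d$ is a bounded Lipschitz domain, $R_0:=\sup_{x\in\Omega}|x|>0$, $B_R\subset\mathbb{R}^d$ is the open ball of radius $R$ centred at $0$, $S_R:=\partial B_R$. All functions are complex-valued. $V:=H^1(B_R)$ with norm $\|v\|_V:=(\|\nabla v\|_{0,2,B_R}^2+\|v\|_{0,2,B_R}^2)^{1/2}$, where $\|\cdot\|_{k,2,M}$ is the $H^k(M)$-norm ($k=0$: $L_2(M)$-norm) and $|\cdot|_{k,2,M}$ the corresponding seminorm of highest order. $(w,v)_M:=\int_M w\overline v$, also for $M=S_R$ (traces) and for gradients. $C_-:=\min\{1,\kappa\}$. Truncated DtN operators. For $N\in\mathbb{N}_0$ and $x=R\hat x\in S_R$, $|\hat x|=1$: for $d=2$, $T_{\kappa,N}u(x):=\frac1R\sum_{|n|\le N}Z_n(\kappa R)u_n(R)Y_n(\hat x)$ with $Z_n(\xi):=\xi H_n^{(1)\prime}(\xi)/H_n^{(1)}(\xi)$, $H_n^{(1)}$ the cylindrical Hankel functions of the first kind, $Y_n(\varphi)=(2\pi)^{-1/2}e^{in\varphi}$ ($\varphi$ the polar angle of $\hat x$), $u_n(R):=\int_{S_1}u(R\hat x)\overline{Y_n(\hat x)}\,ds(\hat x)$; for $d=3$, $T_{\kappa,N}u(x):=\frac1R\sum_{n=0}^N\sum_{|m|\le n}z_n(\kappa R)u_n^m(R)Y_n^m(\hat x)$ with $z_n(\xi):=\xi h_n^{(1)\prime}(\xi)/h_n^{(1)}(\xi)$, $h_n^{(1)}$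 the spherical Hankel functions of the first kind, $Y_n^m(\varphi,\theta)=\sqrt{\frac{2n+1}{4\pi}\frac{(n-|m|)!}{(n+|m|)!}}P_n^{|m|}(\cos\theta)e^{im\varphi}$ the ($L_2(S_1)$-orthonormal) spherical harmonics, $u_n^m(R):=\int_{S_1}u(R\hat x)\overline{Y_n^m(\hat x)}\,ds(\hat x)$. Sesquilinear form. $a_N(w,v):=(\nabla w,\nabla v)_{B_R}-\kappa^2(w,v)_{B_R}-(T_{\kappa,N}w,v)_{S_R}$ for $w,v\in V$. $C_{\mathrm b}>0$ denotes a continuity constant, independent of $N$: $|a_N(w,v)|\le C_{\mathrm b}\|w\|_V\|v\|_V$ for all $w,v\in V$ and all $N$. Adjoint problem. Given $f\in L_2(B_R)$, find $w_N\in V$ with $a_N(v,w_N)=(v,f)_{B_R}$ for all $v\in V$. Its solution operator is $(\mathcal{A}_N^* )^{-1}:L_2(B_R)\to V$, $f\mapsto w_N$. Finite element spaces. $(V_h)_{h}$ is a collection of finite-dimensional subspaces $V_h\subset V$ such that: (1) $h$ is an element of a sequence of positive real numbers with accumulation point zero; (2) the dimension of $V_h$ increases without bound if $h$ tends to zero; (3) there exist interpolation operators $I_h:H^2(B_R)\to V_h$ with $\|v-I_hv\|_{r,2,B_R}\le C_{\mathrm{ip}}h^{2-r}|v|_{2,2,B_R}$ for all $v\in H^2(B_R)$, $r\in\{0,1,2\}$, with $C_{\mathrm{ip}}>0$ independent of $h,r,v$ (for $r=2$ the norm is understood piecewise with respect to the partition of $B_R$ underlying $V_h$). *)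

theory Defs
  imports "HOL-Analysis.Analysis" "HOL-Computational_Algebra.Polynomial"
begin

section \<open>Lebesgue and Sobolev spaces\<close>

text \<open>
  Elements of function spaces are represented by functions on the whole space, and equality in the
  space is equality almost everywhere on the domain.
\<close>

definition L2 :: "'a measure \<Rightarrow> ('a \<Rightarrow> complex) set" where
  "L2 M = {f \<in> borel_measurable M. integrable M (\<lambda>x. (cmod (f x))\<^sup>2)}"

definition L2nrm :: "'a measure \<Rightarrow> ('a \<Rightarrow> complex) \<Rightarrow> real" where
  "L2nrm M f = sqrt (LINT x|M. (cmod (f x))\<^sup>2)"

definition ip :: "'a measure \<Rightarrow> ('a \<Rightarrow> complex) \<Rightarrow> ('a \<Rightarrow> complex) \<Rightarrow> complex" where
  "ip M w v = (LINT x|M. w x * cnj (v x))"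

definition ae_eq :: "(real^'n) set \<Rightarrow> (real^'n \<Rightarrow> complex) \<Rightarrow> (real^'n \<Rightarrow> complex) \<Rightarrow> bool" where
  "ae_eq \<Omega> u v \<longleftrightarrow> (AE x in lebesgue_on \<Omega>. u x = v x)"

definition ex1_ae :: "(real^'n) set \<Rightarrow> ((real^'n \<Rightarrow> complex) \<Rightarrow> bool) \<Rightarrow> bool" where
  "ex1_ae \<Omega> P \<longleftrightarrow> (\<exists>u. P u) \<and> (\<forall>u v. P u \<longrightarrow> P v \<longrightarrow> ae_eq \<Omega> u v)"

definition partial_deriv :: "'n \<Rightarrow> (real^'n \<Rightarrow> 'b::real_normed_vector) \<Rightarrow> real^'n \<Rightarrow> 'b" where
  "partial_deriv i f x = frechet_derivative f (at x) (axis i 1)"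

primrec C_k :: "nat \<Rightarrow> (real^'n \<Rightarrow> 'b::real_normed_vector) \<Rightarrow> bool" where
  "C_k 0 f \<longleftrightarrow> continuous_on UNIV f"
| "C_k (Suc k) f \<longleftrightarrow> (\<forall>x. f differentiable (at x)) \<and> (\<forall>i. C_k k (partial_deriv i f))"

definition test_functions :: "(real^'n) set \<Rightarrow> (real^'n \<Rightarrow> real) set" where
  "test_functions \<Omega> =
     {\<phi>. (\<forall>k. C_k k \<phi>) \<and> (\<exists>K. compact K \<and> K \<subseteq> \<Omega> \<and> (\<forall>x. x \<notin> K \<longrightarrow> \<phi> x = 0))}"

definition weak_partial ::
    "(real^'n) set \<Rightarrow> 'n \<Rightarrow> (real^'n \<Rightarrow> complex) \<Rightarrow> (real^'n \<Rightarrow> complex) \<Rightarrow> bool" where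
  "weak_partial \<Omega> i u g \<longleftrightarrow>
     u \<in> L2 (lebesgue_on \<Omega>) \<and> g \<in> L2 (lebesgue_on \<Omega>) \<and>
     (\<forall>\<phi>\<in>test_functions \<Omega>.
        (LINT x|lebesgue_on \<Omega>. u x * of_real (partial_deriv i \<phi> x)) =
        - (LINT x|lebesgue_on \<Omega>. g x * of_real (\<phi> x)))"

definition wd :: "(real^'n) set \<Rightarrow> 'n \<Rightarrow> (real^'n \<Rightarrow> complex) \<Rightarrow> real^'n \<Rightarrow> complex" where
  "wd \<Omega> i u = (SOME g. weak_partial \<Omega> i u g)"

definition H1 :: "(real^'n) set \<Rightarrow> (real^'n \<Rightarrow> complex) set" where
  "H1 \<Omega> = {u \<in> L2 (lebesgue_on \<Omega>). \<forall>i. \<exists>g. weak_partial \<Omega> i u g}"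

definition H2 :: "(real^'n) set \<Rightarrow> (real^'n \<Rightarrow> complex) set" where
  "H2 \<Omega> = {u \<in> H1 \<Omega>. \<forall>i. wd \<Omega> i u \<in> H1 \<Omega>}"

definition H1nrm :: "(real^'n) set \<Rightarrow> (real^'n \<Rightarrow> complex) \<Rightarrow> real" where
  "H1nrm \<Omega> u = sqrt ((\<Sum>i\<in>UNIV. (L2nrm (lebesgue_on \<Omega>) (wd \<Omega> i u))\<^sup>2)
                      + (L2nrm (lebesgue_on \<Omega>) u)\<^sup>2)"

definition H2seminrm :: "(real^'n) set \<Rightarrow> (real^'n \<Rightarrow> complex) \<Rightarrow> real" where
  "H2seminrm \<Omega> u =
     sqrt (\<Sum>i\<in>UNIV. \<Sum>j\<in>UNIV. (L2nrm (lebesgue_on \<Omega>) (wd \<Omega> j (wd \<Omega> i u)))\<^sup>2)"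

definition H2nrm :: "(real^'n) set \<Rightarrow> (real^'n \<Rightarrow> complex) \<Rightarrow> real" where
  "H2nrm \<Omega> u = sqrt ((H1nrm \<Omega> u)\<^sup>2 + (H2seminrm \<Omega> u)\<^sup>2)"

text \<open>Nonempty, open, connected, and locally on one side of the graph of a Lipschitz function
  defined on a hyperplane with unit normal \<open>\<nu>\<close>.\<close>

definition lipschitz_domain :: "(real^'n) set \<Rightarrow> bool" where
  "lipschitz_domain \<Omega> \<longleftrightarrow> open \<Omega> \<and> connected \<Omega> \<and> \<Omega> \<noteq> {} \<and>
     (\<forall>p\<in>frontier \<Omega>. \<exists>\<nu> \<gamma> L r. norm \<nu> = 1 \<and> r > 0 \<and> L-lipschitz_on {y. y \<bullet> \<nu> = 0} \<gamma> \<and>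
        \<Omega> \<inter> ball p r = {y \<in> ball p r. \<gamma> (y - (y \<bullet> \<nu>) *\<^sub>R \<nu>) < y \<bullet> \<nu>})"


section \<open>Surface measure and trace on the sphere of radius \<open>R\<close>\<close>

text \<open>
  Surface measure as in integration in polar coordinates: on the unit sphere the measure of \<open>A\<close> is
  \<open>d\<close> times the volume of the cone \<open>{t x | 0 < t < 1, x \<in> A}\<close>, and it scales with \<open>R\<^bsup>d - 1\<^esup>\<close>.
  It is a Borel measure on the whole space, concentrated on the sphere.
\<close>

definition sphere_measure :: "real \<Rightarrow> (real^'n) measure" where
  "sphere_measure R =
     scale_measure (ennreal (real CARD('n) * R ^ (CARD('n) - 1)))
       (distr (restrict_space lborel (ball 0 1)) borel (\<lambda>x. (R / norm x) *\<^sub>R x))"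

text \<open>The continuous extension to \<open>H1\<close> of the restriction of \<open>C\<^sup>1\<close> functions to the sphere.\<close>

definition is_trace :: "real \<Rightarrow> (real^'n \<Rightarrow> complex) \<Rightarrow> (real^'n \<Rightarrow> complex) \<Rightarrow> bool" where
  "is_trace R u g \<longleftrightarrow> g \<in> L2 (sphere_measure R) \<and>
     (\<exists>\<phi>. (\<forall>k::nat. C_k 1 (\<phi> k)) \<and>
        (\<lambda>k. H1nrm (ball 0 R) (\<lambda>x. \<phi> k x - u x)) \<longlonglongrightarrow> 0 \<and>
        (\<lambda>k. L2nrm (sphere_measure R) (\<lambda>x. \<phi> k x - g x)) \<longlonglongrightarrow> 0)"

definition sphere_trace :: "real \<Rightarrow> (real^'n \<Rightarrow> complex) \<Rightarrow> real^'n \<Rightarrow> complex" where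
  "sphere_trace R u = (SOME g. is_trace R u g)"


section \<open>Hankel functions on the positive half-line\<close>

definition bessel_J :: "real \<Rightarrow> real \<Rightarrow> real" where
  "bessel_J \<nu> x =
     (\<Sum>k. (-1) ^ k * rGamma (\<nu> + real k + 1) / fact k * (x / 2) powr (\<nu> + 2 * real k))"

text \<open>
  For integer order the Neumann function is the limit as \<open>\<nu> \<rightarrow> n\<close> of
  \<open>(J\<^sub>\<nu> cos \<nu>\<pi> - J\<^sub>-\<^sub>\<nu>) / sin \<nu>\<pi>\<close>; this is its classical expansion (DLMF 10.8.1).
\<close>

definition bessel_Y :: "nat \<Rightarrow> real \<Rightarrow> real" where
  "bessel_Y n x =
     2 / pi * ln (x / 2) * bessel_J (real n) x
     - (\<Sum>k<n. fact (n - k - 1) / fact k * (x / 2) powr (2 * real k - real n)) / pi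
     - (\<Sum>k. (-1) ^ k * (Digamma (real k + 1) + Digamma (real n + real k + 1))
              / (fact k * fact (n + k)) * (x / 2) ^ (2 * k + n)) / pi"

text \<open>Negative orders by the reflection \<open>H\<^sub>-\<^sub>n = (-1)\<^sup>n H\<^sub>n\<close>.\<close>

definition hankel1 :: "int \<Rightarrow> real \<Rightarrow> complex" where
  "hankel1 n x = (if n < 0 then (-1) ^ nat \<bar>n\<bar> else 1) *
     Complex (bessel_J (real (nat \<bar>n\<bar>)) x) (bessel_Y (nat \<bar>n\<bar>) x)"

text \<open>Here \<open>Y\<^sub>n\<^sub>+\<^sub>1\<^sub>/\<^sub>2 = (-1)\<^sup>n\<^sup>+\<^sup>1 J\<^sub>-\<^sub>n\<^sub>-\<^sub>1\<^sub>/\<^sub>2\<close>.\<close>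

definition sph_hankel1 :: "nat \<Rightarrow> real \<Rightarrow> complex" where
  "sph_hankel1 n x = of_real (sqrt (pi / (2 * x))) *
     Complex (bessel_J (real n + 1/2) x) ((-1) ^ (n + 1) * bessel_J (- real n - 1/2) x)"

definition Z_coeff :: "int \<Rightarrow> real \<Rightarrow> complex" where
  "Z_coeff n \<xi> = of_real \<xi> * vector_derivative (hankel1 n) (at \<xi>) / hankel1 n \<xi>"

definition z_coeff :: "nat \<Rightarrow> real \<Rightarrow> complex" where
  "z_coeff n \<xi> = of_real \<xi> * vector_derivative (sph_hankel1 n) (at \<xi>) / sph_hankel1 n \<xi>"


section \<open>Circular and spherical harmonics\<close>

text \<open>
  Throughout, \<open>c\<close> enumerates the coordinate indices, i.e. \<open>x $ c 1, \<dots>, x $ c d\<close> are the first to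
  the \<open>d\<close>-th Cartesian coordinate of \<open>x\<close>.
\<close>

definition circ_harmonic :: "(nat \<Rightarrow> 'n) \<Rightarrow> int \<Rightarrow> real^'n \<Rightarrow> complex" where
  "circ_harmonic c n x = cis (of_int n * Arg (Complex (x $ c 1) (x $ c 2))) / of_real (sqrt (2 * pi))"

definition legendre :: "nat \<Rightarrow> real poly" where
  "legendre n = smult (1 / (2 ^ n * fact n)) ((pderiv ^^ n) ([:-1, 0, 1:] ^ n))"

text \<open>No Condon--Shortley sign; it would cancel in the DtN operator.\<close>

definition assoc_legendre :: "nat \<Rightarrow> nat \<Rightarrow> real \<Rightarrow> real" where
  "assoc_legendre n m t = sqrt (1 - t\<^sup>2) ^ m * poly ((pderiv ^^ m) (legendre n)) t"

text \<open>On the unit sphere \<open>cos \<theta> = x\<^sub>3\<close>, and \<open>\<phi>\<close> is the polar angle of \<open>(x\<^sub>1, x\<^sub>2)\<close>.\<close>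

definition sph_harmonic :: "(nat \<Rightarrow> 'n) \<Rightarrow> nat \<Rightarrow> int \<Rightarrow> real^'n \<Rightarrow> complex" where
  "sph_harmonic c n m x = (let k = nat \<bar>m\<bar> in
     of_real (sqrt ((2 * real n + 1) / (4 * pi) * fact (n - k) / fact (n + k))
              * assoc_legendre n k (x $ c 3))
     * cis (of_int m * Arg (Complex (x $ c 1) (x $ c 2))))"


section \<open>Truncated DtN operator and sesquilinear form\<close>

definition fourier_coeff ::
    "real \<Rightarrow> (real^'n \<Rightarrow> complex) \<Rightarrow> (real^'n \<Rightarrow> complex) \<Rightarrow> complex" where
  "fourier_coeff R u Y = ip (sphere_measure 1) (\<lambda>x. u (R *\<^sub>R x)) Y"

definition dtn ::
    "(nat \<Rightarrow> 'n) \<Rightarrow> real \<Rightarrow> real \<Rightarrow> nat \<Rightarrow> (real^'n \<Rightarrow> complex) \<Rightarrow> real^'n \<Rightarrow> complex" where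
  "dtn c \<kappa> R N u x = of_real (1 / R) *
     (if CARD('n) = 2 then
        (\<Sum>n\<in>{- int N..int N}. Z_coeff n (\<kappa> * R) * fourier_coeff R u (circ_harmonic c n)
           * circ_harmonic c n (x /\<^sub>R R))
      else
        (\<Sum>n\<le>N. \<Sum>m\<in>{- int n..int n}. z_coeff n (\<kappa> * R) * fourier_coeff R u (sph_harmonic c n m)
           * sph_harmonic c n m (x /\<^sub>R R)))"

definition a_form ::
    "(nat \<Rightarrow> 'n) \<Rightarrow> real \<Rightarrow> real \<Rightarrow> nat \<Rightarrow> (real^'n \<Rightarrow> complex) \<Rightarrow> (real^'n \<Rightarrow> complex) \<Rightarrow> complex" where
  "a_form c \<kappa> R N w v =
     (\<Sum>i\<in>UNIV. ip (lebesgue_on (ball 0 R)) (wd (ball 0 R) i w) (wd (ball 0 R) i v))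
     - of_real (\<kappa>\<^sup>2) * ip (lebesgue_on (ball 0 R)) w v
     - ip (sphere_measure R) (dtn c \<kappa> R N (sphere_trace R w)) (sphere_trace R v)"

definition adjoint_solution ::
    "(nat \<Rightarrow> 'n) \<Rightarrow> real \<Rightarrow> real \<Rightarrow> nat \<Rightarrow> (real^'n \<Rightarrow> complex) \<Rightarrow> (real^'n \<Rightarrow> complex) \<Rightarrow> bool" where
  "adjoint_solution c \<kappa> R N f w \<longleftrightarrow> w \<in> H1 (ball 0 R) \<and>
     (\<forall>v\<in>H1 (ball 0 R). a_form c \<kappa> R N v w = ip (lebesgue_on (ball 0 R)) v f)"

definition adjoint_inverse ::
    "(nat \<Rightarrow> 'n) \<Rightarrow> real \<Rightarrow> real \<Rightarrow> nat \<Rightarrow> (real^'n \<Rightarrow> complex) \<Rightarrow> real^'n \<Rightarrow> complex" where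
  "adjoint_inverse c \<kappa> R N f = (SOME w. adjoint_solution c \<kappa> R N f w)"

text \<open>Extended real valued, since the supremum may be infinite.\<close>

definition eta ::
    "(nat \<Rightarrow> 'n) \<Rightarrow> real \<Rightarrow> real \<Rightarrow> nat \<Rightarrow> (real^'n \<Rightarrow> complex) set \<Rightarrow> ereal" where
  "eta c \<kappa> R N Vh =
     (SUP f\<in>{f \<in> L2 (lebesgue_on (ball 0 R)). \<not> ae_eq (ball 0 R) f (\<lambda>x. 0)}. INF v\<in>Vh.
        ereal (H1nrm (ball 0 R) (\<lambda>x. adjoint_inverse c \<kappa> R N f x - v x)
               / L2nrm (lebesgue_on (ball 0 R)) f))"

text \<open>For functionals that are homogeneous and additive, boundedness is continuity.\<close>

definition continuous_antilinear ::
    "(real^'n) set \<Rightarrow> ((real^'n \<Rightarrow> complex) \<Rightarrow> complex) \<Rightarrow> bool" where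
  "continuous_antilinear \<Omega> l \<longleftrightarrow>
     (\<forall>u\<in>H1 \<Omega>. \<forall>v\<in>H1 \<Omega>. l (\<lambda>x. u x + v x) = l u + l v) \<and>
     (\<forall>a. \<forall>v\<in>H1 \<Omega>. l (\<lambda>x. a * v x) = cnj a * l v) \<and>
     (\<exists>C. \<forall>v\<in>H1 \<Omega>. cmod (l v) \<le> C * H1nrm \<Omega> v)"


section \<open>Finite element spaces\<close>

definition H1_subspace :: "(real^'n) set \<Rightarrow> (real^'n \<Rightarrow> complex) set \<Rightarrow> bool" where
  "H1_subspace \<Omega> S \<longleftrightarrow> S \<subseteq> H1 \<Omega> \<and> (\<lambda>x. 0) \<in> S \<and>
     (\<forall>u\<in>S. \<forall>v\<in>S. (\<lambda>x. u x + v x) \<in> S) \<and> (\<forall>a. \<forall>v\<in>S. (\<lambda>x. a * v x) \<in> S)"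

text \<open>The complex dimension modulo equality almost everywhere is \<open>m\<close>.\<close>

definition has_dim :: "(real^'n) set \<Rightarrow> (real^'n \<Rightarrow> complex) set \<Rightarrow> nat \<Rightarrow> bool" where
  "has_dim \<Omega> S m \<longleftrightarrow>
     (\<exists>b. (\<forall>i<m. b i \<in> S) \<and>
        (\<forall>a. ae_eq \<Omega> (\<lambda>x. \<Sum>i<m. a i * b i x) (\<lambda>x. 0) \<longrightarrow> (\<forall>i<m. a i = 0)) \<and>
        (\<forall>v\<in>S. \<exists>a. ae_eq \<Omega> v (\<lambda>x. \<Sum>i<m. a i * b i x)))"

definition dim_ae :: "(real^'n) set \<Rightarrow> (real^'n \<Rightarrow> complex) set \<Rightarrow> nat" where
  "dim_ae \<Omega> S = (THE m. has_dim \<Omega> S m)"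

definition is_partition :: "(real^'n) set \<Rightarrow> (real^'n) set set \<Rightarrow> bool" where
  "is_partition \<Omega> \<T> \<longleftrightarrow> finite \<T> \<and> disjoint \<T> \<and>
     (\<forall>K\<in>\<T>. open K \<and> K \<noteq> {} \<and> K \<subseteq> \<Omega>) \<and> negligible (\<Omega> - \<Union>\<T>)"

text \<open>\<open>s\<close> is the sequence of the mesh parameters \<open>h\<close>, \<open>V h\<close> the space and \<open>\<T> h\<close> the underlying
  partition of the domain.\<close>

definition fe_family ::
    "(real^'n) set \<Rightarrow> (nat \<Rightarrow> real) \<Rightarrow> (real \<Rightarrow> (real^'n \<Rightarrow> complex) set) \<Rightarrow>
     (real \<Rightarrow> (real^'n) set set) \<Rightarrow> bool" where
  "fe_family \<Omega> s V \<T> \<longleftrightarrow>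
     (\<forall>k. s k > 0) \<and> 0 islimpt range s \<and>
     (\<forall>h\<in>range s. H1_subspace \<Omega> (V h) \<and> (\<exists>m. has_dim \<Omega> (V h) m) \<and> is_partition \<Omega> (\<T> h)) \<and>
     filterlim (\<lambda>h. dim_ae \<Omega> (V h)) at_top (at 0 within range s) \<and>
     (\<exists>I C_ip. C_ip > 0 \<and> (\<forall>h\<in>range s. \<forall>v\<in>H2 \<Omega>.
        I h v \<in> V h \<and>
        L2nrm (lebesgue_on \<Omega>) (\<lambda>x. v x - I h v x) \<le> C_ip * h\<^sup>2 * H2seminrm \<Omega> v \<and>
        H1nrm \<Omega> (\<lambda>x. v x - I h v x) \<le> C_ip * h * H2seminrm \<Omega> v \<and>
        (\<forall>K\<in>\<T> h. (\<lambda>x. v x - I h v x) \<in> H2 K) \<and>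
        sqrt (\<Sum>K\<in>\<T> h. (H2nrm K (\<lambda>x. v x - I h v x))\<^sup>2) \<le> C_ip * H2seminrm \<Omega> v))"

end

theory Submission
  imports Defs
begin

text \<open>Since \<open>V h\<close> is finite dimensional, it suffices that \<open>u = 0\<close> whenever \<open>u \<in> V h\<close> and \<open>a\<^sub>N(u, v) = 0\<close> for
all \<open>v \<in> V h\<close> (\<open>galerkin_unique_solvable\<close>). Two identities force this.

Energy: the trace of \<open>u\<close> expands into finitely many Fourier modes \<open>m\<^sub>k(u)\<close>, and up to a positive
factor the boundary term of \<open>a\<^sub>N(u, u)\<close> is \<open>\<Sum>\<^sub>k \<zeta>\<^sub>k |m\<^sub>k(u)|\<^sup>2\<close> with
\<open>\<zeta>\<^sub>k = \<xi> H'(\<xi>) / H(\<xi>)\<close>, \<open>\<xi> = \<kappa> R\<close>. The rest of \<open>a\<^sub>N(u, u)\<close> is real. Writing \<open>H = J + i Y\<close>,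
\<open>Im \<zeta>\<^sub>k = \<xi> (J Y' - J' Y) / |H|\<^sup>2\<close> is a Wronskian over a square, hence positive. So \<open>a\<^sub>N(u, u) = 0\<close>
annihilates all modes, with them the entire boundary term, and leaves \<open>\<parallel>\<nabla>u\<parallel>\<^sup>2 = \<kappa>\<^sup>2 \<parallel>u\<parallel>\<^sup>2\<close>
(\<open>a_form_self_eq_0_imp\<close>).

Duality: if \<open>w\<close> solves the adjoint problem with right-hand side \<open>u\<close>, then
\<open>\<parallel>u\<parallel>\<^sup>2 = a\<^sub>N(u, w) = a\<^sub>N(u, w - v) \<le> C\<^sub>b \<parallel>u\<parallel>\<^sub>V \<parallel>w - v\<parallel>\<^sub>V\<close> for all \<open>v \<in> V h\<close>, so the bound on \<open>\<eta>\<^sub>N\<close> gives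
\<open>\<kappa> \<parallel>u\<parallel> \<le> min 1 \<kappa> / 2 * \<parallel>u\<parallel>\<^sub>V\<close> (\<open>L2nrm_le_eta\<close>). Together with \<open>\<parallel>u\<parallel>\<^sub>V\<^sup>2 = (1 + \<kappa>\<^sup>2) \<parallel>u\<parallel>\<^sup>2\<close> this leaves only
\<open>u = 0\<close>. Both arguments work for each \<open>N \<ge> N\<^sub>0\<close>, so any positive \<open>Nstar \<ge> N\<^sub>0\<close> will do.

The analysis behind this is the sesquilinearity of \<open>a\<^sub>N\<close>. Weak derivatives and traces are picked by
a choice operator, so they are linear only up to null sets, and only once they are known to be
unique. For weak derivatives this is the fundamental lemma of the calculus of variations; for traces
it is the trace inequality for \<open>C\<^sup>1\<close> functions, proved by integrating along rays. That every function
in \<open>H1\<close> has a trace is extracted from the continuity of \<open>a\<^sub>N\<close> and the solvability of the adjoint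
problem (\<open>trace_exists\<close>): a function without trace would make the boundary term drop out of the
adjoint problem altogether, which the constant function \<open>1\<close>, having a nonzero mode, contradicts.\<close>

section \<open>Wronskians of Hankel functions\<close>

abbreviation (input) power_series :: "(nat \<Rightarrow> real) \<Rightarrow> real \<Rightarrow> real" where
  "power_series c t \<equiv> (\<Sum>k. c k * t ^ k)"

abbreviation (input) entire :: "(nat \<Rightarrow> real) \<Rightarrow> bool" where
  "entire c \<equiv> (\<forall>t. summable (\<lambda>k. c k * t ^ k))"

lemma entire_diffs: "entire c \<Longrightarrow> entire (diffs c)"
  by (metis termdiff_converges_all)

lemma power_series_deriv:
  "entire c \<Longrightarrow> (power_series c has_real_derivative power_series (diffs c) t) (at t)"
  by (rule termdiffs_strong_converges_everywhere) auto

text \<open>In the variable \<open>t = (x / 2)\<^sup>2\<close> the Bessel equation for \<open>t\<^bsup>\<nu>/2\<^esup> f(t)\<close> becomes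
\<open>t f'' + \<alpha> f' + f = 0\<close> with \<open>\<alpha> = \<nu> + 1\<close>, which is a two-term recursion for the coefficients. The factor
\<open>t\<close> is multiplied through so that an inhomogeneity \<open>e\<close> can be indexed like \<open>c\<close>.\<close>

lemma power_series_ode:
  assumes "entire c"
    and e: "e 0 = 0" "\<And>k. e (Suc k) = (real k + 1) * (real k + \<alpha>) * c (Suc k) + c k"
  shows "(\<lambda>k. e k * t ^ k) sums
    (t * (t * power_series (diffs (diffs c)) t + \<alpha> * power_series (diffs c) t + power_series c t))"
proof -
  let ?d = "diffs c" and ?dd = "diffs (diffs c)"
  have "entire ?d" "entire ?dd" using assms(1) entire_diffs by blast+
  then have s: "(\<lambda>k. c k * t ^ k) sums power_series c t" "(\<lambda>k. ?d k * t ^ k) sums power_series ?d t"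
    "(\<lambda>k. ?dd k * t ^ k) sums power_series ?dd t"
    using assms(1) by (auto intro: summable_sums)
  have "(\<lambda>k. t * (?dd k * t ^ k)) sums (t * power_series ?dd t)"
    by (intro sums_mult s)
  then have "(\<lambda>k. (if k = 0 then 0 else ?dd (k - 1) * t ^ k)) sums (t * power_series ?dd t)"
    using sums_Suc[of "\<lambda>k. (if k = 0 then 0 else ?dd (k - 1) * t ^ k)"] by (simp add: mult_ac)
  then have "(\<lambda>k. (if k = 0 then 0 else ?dd (k - 1) * t ^ k) + \<alpha> * (?d k * t ^ k) + c k * t ^ k)
     sums (t * power_series ?dd t + \<alpha> * power_series ?d t + power_series c t)"
    by (intro sums_add sums_mult s)
  moreover have "(if k = 0 then 0 else ?dd (k - 1) * t ^ k) + \<alpha> * (?d k * t ^ k) + c k * t ^ k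
    = e (Suc k) * t ^ k" for k
    by (cases k) (auto simp: e diffs_def algebra_simps)
  ultimately have "(\<lambda>k. e (Suc k) * t ^ k) sums
      (t * power_series ?dd t + \<alpha> * power_series ?d t + power_series c t)" by simp
  from sums_mult[OF this, of t] show ?thesis
    using e(1) sums_Suc[of "\<lambda>k. e k * t ^ k"] by (simp add: mult_ac)
qed

lemma power_series_0: "entire c \<Longrightarrow> power_series c 0 = c 0"
  using powser_zero[of c] by simp

text \<open>\<open>J\<^sub>\<nu>(x) = (x / 2)\<^sup>\<nu> P((x / 2)\<^sup>2)\<close>, where \<open>P\<close> is the entire function with these coefficients.\<close>

definition bessel_coeff :: "real \<Rightarrow> nat \<Rightarrow> real" where
  "bessel_coeff \<nu> k = (-1) ^ k * rGamma (\<nu> + real k + 1) / fact k"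

lemma bessel_coeff_rec:
  "(real k + 1) * (real k + (\<nu> + 1)) * bessel_coeff \<nu> (Suc k) + bessel_coeff \<nu> k = 0"
proof -
  have "(\<nu> + real k + 1) * rGamma (\<nu> + real k + 1 + 1) = rGamma (\<nu> + real k + 1)"
    by (rule rGamma_plus1)
  then have G: "rGamma (\<nu> + real k + 1) = (\<nu> + real k + 1) * rGamma (\<nu> + real (Suc k) + 1)"
    by (simp add: add_ac)
  have "(real k + 1) * (real k + (\<nu> + 1)) * ((-1) ^ Suc k * r / ((real k + 1) * fact k))
      = - ((-1) ^ k * ((\<nu> + real k + 1) * r) / fact k)" for r
    by (simp add: divide_simps)
  then show ?thesis unfolding bessel_coeff_def G by (simp add: add_ac)
qed

lemma entire_bessel_coeff: "entire (bessel_coeff \<nu>)"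
proof
  fix t :: real
  \<comment> \<open>from the index \<open>K\<close> on, consecutive terms at least halve\<close>
  obtain K :: nat where K: "real K \<ge> 2 * \<bar>t\<bar> + \<bar>\<nu>\<bar>" using real_arch_simple by blast
  show "summable (\<lambda>k. bessel_coeff \<nu> k * t ^ k)"
  proof (rule summable_ratio_test[of "1/2" K])
    fix k assume "k \<ge> K"
    then have k: "real k \<ge> 2 * \<bar>t\<bar> + \<bar>\<nu>\<bar>" using K by linarith
    let ?a = "(real k + 1) * (real k + (\<nu> + 1))"
    have "1 * (2 * \<bar>t\<bar>) \<le> ?a" using k by (intro mult_mono) auto
    moreover have a: "?a > 0" using k by (intro mult_pos_pos) linarith+
    moreover have "\<bar>?a * bessel_coeff \<nu> (Suc k)\<bar> = \<bar>bessel_coeff \<nu> k\<bar>"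
      using bessel_coeff_rec[of k \<nu>] by linarith
    then have "?a * \<bar>bessel_coeff \<nu> (Suc k)\<bar> = \<bar>bessel_coeff \<nu> k\<bar>"
      using abs_mult[of ?a "bessel_coeff \<nu> (Suc k)"] a by linarith
    ultimately have "2 * \<bar>t\<bar> * \<bar>bessel_coeff \<nu> (Suc k)\<bar> \<le> \<bar>bessel_coeff \<nu> k\<bar>"
      by (metis abs_ge_zero mult_1 mult_right_mono)
    then have "(2 * \<bar>t\<bar> * \<bar>bessel_coeff \<nu> (Suc k)\<bar>) * \<bar>t\<bar> ^ k \<le> \<bar>bessel_coeff \<nu> k\<bar> * \<bar>t\<bar> ^ k"
      by (intro mult_right_mono) auto
    then show "norm (bessel_coeff \<nu> (Suc k) * t ^ Suc k) \<le> 1/2 * norm (bessel_coeff \<nu> k * t ^ k)"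
      by (simp add: abs_mult power_abs mult_ac)
  qed simp
qed

lemma bessel_J_power_series:
  assumes "x > 0"
  shows "bessel_J \<nu> x = (x / 2) powr \<nu> * power_series (bessel_coeff \<nu>) ((x / 2)\<^sup>2)"
proof -
  have "bessel_J \<nu> x = (\<Sum>k. (x / 2) powr \<nu> * (bessel_coeff \<nu> k * ((x / 2)\<^sup>2) ^ k))"
    unfolding bessel_J_def
  proof (rule suminf_cong)
    fix k
    have "(x / 2) powr (2 * real k) = ((x / 2)\<^sup>2) ^ k"
      using assms powr_realpow[of "x / 2" "2 * k"] by (simp add: power_mult)
    then have "(x / 2) powr (\<nu> + 2 * real k) = (x / 2) powr \<nu> * ((x / 2)\<^sup>2) ^ k"
      using assms by (simp add: powr_add)
    then show "(-1) ^ k * rGamma (\<nu> + real k + 1) / fact k * (x / 2) powr (\<nu> + 2 * real k)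
      = (x / 2) powr \<nu> * (bessel_coeff \<nu> k * ((x / 2)\<^sup>2) ^ k)"
      by (simp add: bessel_coeff_def)
  qed
  also have "\<dots> = (x / 2) powr \<nu> * power_series (bessel_coeff \<nu>) ((x / 2)\<^sup>2)"
    using entire_bessel_coeff by (intro suminf_mult) auto
  finally show ?thesis .
qed

lemma powr_times_power_series_deriv:
  assumes "x > 0" "entire c"
  shows "((\<lambda>x. (x / 2) powr \<nu> * power_series c ((x / 2)\<^sup>2)) has_real_derivative
    (x / 2) powr \<nu> * (\<nu> * power_series c ((x / 2)\<^sup>2)
       + 2 * (x / 2)\<^sup>2 * power_series (diffs c) ((x / 2)\<^sup>2)) / x) (at x)"
proof -
  have "((\<lambda>x. power_series c ((x / 2)\<^sup>2)) has_real_derivative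
      power_series (diffs c) ((x / 2)\<^sup>2) * (x / 2)) (at x)"
    by (rule DERIV_chain2[OF power_series_deriv[OF assms(2)]])
       (auto intro!: derivative_eq_intros)
  moreover have "((\<lambda>x. (x / 2) powr \<nu>) has_real_derivative (x / 2) powr \<nu> * (\<nu> / x)) (at x)"
    using assms(1)
    by (auto intro!: derivative_eq_intros simp: powr_diff field_simps)
  ultimately show ?thesis
    using assms(1)
    by - (drule (1) DERIV_mult, auto simp: field_simps power2_eq_square elim!: DERIV_cong)
qed

lemma bessel_J_deriv:
  assumes "x > 0"
  shows "(bessel_J \<nu> has_real_derivative
    (x / 2) powr \<nu> * (\<nu> * power_series (bessel_coeff \<nu>) ((x / 2)\<^sup>2)
       + 2 * (x / 2)\<^sup>2 * power_series (diffs (bessel_coeff \<nu>)) ((x / 2)\<^sup>2)) / x) (at x)"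
  by (rule has_field_derivative_transform_within_open
      [OF powr_times_power_series_deriv[OF assms entire_bessel_coeff], of "{0<..}"])
     (use assms bessel_J_power_series in auto)

lemma bessel_ode:
  assumes "t \<noteq> 0"
  shows "t * power_series (diffs (diffs (bessel_coeff \<nu>))) t =
    - (\<nu> + 1) * power_series (diffs (bessel_coeff \<nu>)) t - power_series (bessel_coeff \<nu>) t"
proof -
  let ?e = "\<lambda>k::nat. 0::real"
  have "(\<lambda>k. ?e k * t ^ k) sums
    (t * (t * power_series (diffs (diffs (bessel_coeff \<nu>))) t
       + (\<nu> + 1) * power_series (diffs (bessel_coeff \<nu>)) t + power_series (bessel_coeff \<nu>) t))"
    by (rule power_series_ode[OF entire_bessel_coeff]) (use bessel_coeff_rec in auto)
  then have "t * power_series (diffs (diffs (bessel_coeff \<nu>))) t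
       + (\<nu> + 1) * power_series (diffs (bessel_coeff \<nu>)) t + power_series (bessel_coeff \<nu>) t = 0"
    using assms by (auto simp: sums_iff)
  then show ?thesis by linarith
qed

text \<open>The Wronskians below extend continuously to \<open>t = 0\<close>, where they can be read off from the
leading coefficients, while the differential equations give a zero derivative only for \<open>t > 0\<close>.\<close>

lemma eq_value_at_0_if_deriv_0:
  fixes f :: "real \<Rightarrow> real"
  assumes "\<And>t. (f has_real_derivative f' t) (at t)" "\<And>t. t > 0 \<Longrightarrow> f' t = 0" "t > 0"
  shows "f t = f 0"
  using assms
  by (intro DERIV_isconst_end) (auto intro!: DERIV_atLeastAtMost_imp_continuous_on,metis)

text \<open>With \<open>u = t\<^bsup>\<nu>/2\<^esup> P\<close> and \<open>v = t\<^bsup>-\<nu>/2\<^esup> M\<close> the left-hand side is \<open>t (u v' - u' v)\<close>: the fractional powers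
cancel, so the Wronskian is itself an entire function of \<open>t\<close>, and it is constant by the Bessel
equations.\<close>

lemma bessel_wronskian_noninteger:
  fixes \<nu> t :: real
  assumes "t > 0"
  defines "P \<equiv> bessel_coeff \<nu>" and "M \<equiv> bessel_coeff (- \<nu>)"
  shows "- \<nu> * power_series P t * power_series M t
      + t * (power_series P t * power_series (diffs M) t - power_series M t * power_series (diffs P) t)
    = - \<nu> * rGamma (\<nu> + 1) * rGamma (1 - \<nu>)"
proof -
  let ?P = "power_series P" and ?P1 = "power_series (diffs P)" and ?P2 = "power_series (diffs (diffs P))"
  let ?M = "power_series M" and ?M1 = "power_series (diffs M)" and ?M2 = "power_series (diffs (diffs M))"
  let ?W = "\<lambda>t. - \<nu> * ?P t * ?M t + t * (?P t * ?M1 t - ?M t * ?P1 t)"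
  let ?W' = "\<lambda>t. - \<nu> * (?P1 t * ?M t + ?P t * ?M1 t) + (?P t * ?M1 t - ?M t * ?P1 t)
      + t * (?P t * ?M2 t - ?M t * ?P2 t)"
  have ent: "entire P" "entire M" unfolding P_def M_def by (rule entire_bessel_coeff)+
  note d = power_series_deriv[OF ent(1)] power_series_deriv[OF ent(2)]
    power_series_deriv[OF entire_diffs[OF ent(1)]] power_series_deriv[OF entire_diffs[OF ent(2)]]
  have "(?W has_real_derivative ?W' t) (at t)" for t
    by (rule DERIV_cong, (rule derivative_intros d)+) (simp add: algebra_simps)
  moreover have "?W' t = 0" if "t > 0" for t
  proof -
    have P2: "t * ?P2 t = - (\<nu> + 1) * ?P1 t - ?P t" unfolding P_def using that by (intro bessel_ode) auto
    have M2: "t * ?M2 t = - (- \<nu> + 1) * ?M1 t - ?M t" unfolding M_def using that by (intro bessel_ode) auto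
    have "?W' t = - \<nu> * (?P1 t * ?M t + ?P t * ?M1 t) + (?P t * ?M1 t - ?M t * ?P1 t)
      + (?P t * (t * ?M2 t) - ?M t * (t * ?P2 t))" by (simp add: algebra_simps)
    also have "\<dots> = 0" unfolding P2 M2 by (simp add: algebra_simps)
    finally show ?thesis .
  qed
  ultimately have "?W t = ?W 0" using assms(1) by (rule eq_value_at_0_if_deriv_0)
  also have "\<dots> = - \<nu> * P 0 * M 0" using power_series_0[OF ent(1)] power_series_0[OF ent(2)] by simp
  finally show ?thesis by (simp add: P_def M_def bessel_coeff_def)
qed

text \<open>For \<open>H = a (f + i g)\<close>, \<open>Im (H' / H) = (f g' - f' g) / (f\<^sup>2 + g\<^sup>2)\<close>.\<close>

lemma im_log_deriv_pos:
  fixes f g :: "real \<Rightarrow> real"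
  assumes "\<xi> > 0" "(f has_real_derivative f') (at \<xi>)" "(g has_real_derivative g') (at \<xi>)"
    and w: "f \<xi> * g' - f' * g \<xi> > 0" and "a \<noteq> (0::complex)"
  shows "Im (of_real \<xi> * vector_derivative (\<lambda>x. a * Complex (f x) (g x)) (at \<xi>) / (a * Complex (f \<xi>) (g \<xi>))) > 0"
proof -
  have "((\<lambda>x. Complex (f x) (g x)) has_vector_derivative Complex f' g') (at \<xi>)"
    using assms(2,3) by (simp add: has_vector_derivative_complex_iff
        has_real_derivative_iff_has_vector_derivative)
  then have "((\<lambda>x. a * Complex (f x) (g x)) has_vector_derivative a * Complex f' g') (at \<xi>)"
    by (rule has_vector_derivative_mult_right)
  then have v: "vector_derivative (\<lambda>x. a * Complex (f x) (g x)) (at \<xi>) = a * Complex f' g'"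
    by (rule vector_derivative_at)
  have nz: "(f \<xi>)\<^sup>2 + (g \<xi>)\<^sup>2 > 0" using w by (auto simp: sum_power2_gt_zero_iff)
  have "Im (Complex f' g' / Complex (f \<xi>) (g \<xi>)) = (f \<xi> * g' - f' * g \<xi>) / ((f \<xi>)\<^sup>2 + (g \<xi>)\<^sup>2)"
    by (simp add: Im_divide mult.commute)
  also have "\<dots> > 0" using nz w by simp
  finally have "\<xi> * Im (Complex f' g' / Complex (f \<xi>) (g \<xi>)) > 0" using assms(1) by simp
  then have "Im (of_real \<xi> * (Complex f' g' / Complex (f \<xi>) (g \<xi>))) > 0"
    by (subst times_complex.sel) (simp del: Complex_eq)
  moreover have "of_real \<xi> * (a * Complex f' g') / (a * Complex (f \<xi>) (g \<xi>))
      = of_real \<xi> * (Complex f' g' / Complex (f \<xi>) (g \<xi>))"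
    using assms(5) by simp
  ultimately show ?thesis unfolding v by (simp only:)
qed

text \<open>It gives the Wronskian of \<open>J\<^sub>n\<^sub>+\<^sub>1\<^sub>/\<^sub>2\<close> and \<open>J\<^sub>-\<^sub>n\<^sub>-\<^sub>1\<^sub>/\<^sub>2\<close> the sign \<open>(-1)\<^sup>n\<^sup>+\<^sup>1\<close>, which cancels against
the sign in the definition of the spherical Neumann function.\<close>

lemma rGamma_minus_half_sign: "(-1) ^ n * rGamma (1 / 2 - real n) > 0"
proof (induction n)
  case 0
  then show ?case by (simp add: rGamma_inverse_Gamma Gamma_one_half_real)
next
  case (Suc n)
  have "rGamma (1 / 2 - real (Suc n)) = (1 / 2 - real (Suc n)) * rGamma (1 / 2 - real (Suc n) + 1)"
    by (simp only: rGamma_plus1)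
  also have "1 / 2 - real (Suc n) + 1 = 1 / 2 - real n" by simp
  also have "1 / 2 - real (Suc n) = - (real n + 1 / 2)" by simp
  finally have "rGamma (1 / 2 - real (Suc n)) = - (real n + 1 / 2) * rGamma (1 / 2 - real n)"
    by (simp only: \<open>1 / 2 - real (Suc n) = - (real n + 1 / 2)\<close>)
  then have "(-1) ^ Suc n * rGamma (1 / 2 - real (Suc n)) = (real n + 1 / 2) * ((-1) ^ n * rGamma (1 / 2 - real n))"
    by (simp only: power_Suc) (simp only: mult_ac mult_minus_left mult_minus_right mult_1_left minus_minus)
  also have "\<dots> > 0" by (rule mult_pos_pos[OF _ Suc]) simp
  finally show ?case .
qed

text \<open>The common factor \<open>sqrt (\<pi> / (2 x))\<close> only multiplies the Wronskian by its square, since the terms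
with its derivative cancel.\<close>

lemma Im_z_coeff_pos:
  assumes "\<xi> > 0"
  shows "Im (z_coeff n \<xi>) > 0"
proof -
  define \<nu> where "\<nu> = real n + 1 / 2"
  define t where "t = (\<xi> / 2)\<^sup>2"
  define s :: real where "s = (-1) ^ (n + 1)"
  define P P1 M M1 where "P = power_series (bessel_coeff \<nu>) t"
    and "P1 = power_series (diffs (bessel_coeff \<nu>)) t"
    and "M = power_series (bessel_coeff (- \<nu>)) t"
    and "M1 = power_series (diffs (bessel_coeff (- \<nu>))) t"
  note PM = P_def P1_def M_def M1_def
  have t: "t > 0" using assms by (simp add: t_def)
  define a f g where "a x = complex_of_real (sqrt (pi / (2 * x)))" and "f x = sqrt (pi / (2 * x)) * bessel_J \<nu> x"
    and "g x = sqrt (pi / (2 * x)) * (s * bessel_J (- \<nu>) x)" for x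
  define c c' where "c = sqrt (pi / (2 * \<xi>))" and "c' = - c / (2 * \<xi>)"
  have c: "c > 0" using assms by (simp add: c_def)
  have dc: "((\<lambda>x. sqrt (pi / (2 * x))) has_real_derivative c') (at \<xi>)"
    unfolding c'_def c_def using assms
    by (auto intro!: derivative_eq_intros simp: field_simps real_sqrt_divide real_sqrt_mult)
  define z where "z = \<xi> / 2"
  have z: "z powr \<nu> * z powr (- \<nu>) = 1" "z > 0" using assms by (auto simp: z_def powr_minus)
  define j y j' y' where "j = bessel_J \<nu> \<xi>" and "y = s * bessel_J (- \<nu>) \<xi>"
    and "j' = z powr \<nu> * (\<nu> * P + 2 * t * P1) / \<xi>"
    and "y' = s * (z powr (- \<nu>) * (- \<nu> * M + 2 * t * M1) / \<xi>)"
  have dj: "(bessel_J \<nu> has_real_derivative j') (at \<xi>)"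
    and dy: "((\<lambda>x. s * bessel_J (- \<nu>) x) has_real_derivative y') (at \<xi>)"
    unfolding j'_def y'_def PM t_def z_def
    by (intro bessel_J_deriv DERIV_cmult assms)+
  have jy: "j = z powr \<nu> * P" "y = s * (z powr (- \<nu>) * M)"
    using assms by (simp_all add: j_def y_def PM t_def z_def bessel_J_power_series)
  have "j * y' - j' * y = (z powr \<nu> * z powr (- \<nu>)) * s *
      (P * (- \<nu> * M + 2 * t * M1) - (\<nu> * P + 2 * t * P1) * M) / \<xi>"
    unfolding jy j'_def y'_def using assms by (simp add: field_simps)
  also have "\<dots> = 2 * s / \<xi> * (- \<nu> * P * M + t * (P * M1 - M * P1))"
    unfolding z by (simp add: field_simps)
  also have "\<dots> = 2 * s / \<xi> * (- \<nu> * rGamma (\<nu> + 1) * rGamma (1 - \<nu>))"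
    unfolding PM using bessel_wronskian_noninteger[OF t, of \<nu>] by simp
  also have "\<dots> = 2 * \<nu> / \<xi> * rGamma (\<nu> + 1) * ((-1) ^ n * rGamma (1 / 2 - real n))"
    by (simp add: s_def \<nu>_def field_simps)
  also have "\<dots> > 0"
    using assms by (intro mult_pos_pos divide_pos_pos rGamma_minus_half_sign)
      (auto simp: \<nu>_def rGamma_inverse_Gamma Gamma_real_pos)
  finally have w: "j * y' - j' * y > 0" .
  have "sph_hankel1 n = (\<lambda>x. 1 * Complex (f x) (g x))"
    unfolding sph_hankel1_def f_def g_def s_def \<nu>_def
    by (simp add: fun_eq_iff complex_eq_iff)
  moreover have "(f has_real_derivative c' * j + j' * c) (at \<xi>)"
    using DERIV_mult[OF dc dj] unfolding f_def c_def j_def by (simp add: mult.commute)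
  moreover have "(g has_real_derivative c' * y + y' * c) (at \<xi>)"
    using DERIV_mult[OF dc dy] unfolding g_def c_def y_def by (simp add: mult.commute)
  moreover have "f \<xi> * (c' * y + y' * c) - (c' * j + j' * c) * g \<xi> > 0"
  proof -
    have "f \<xi> * (c' * y + y' * c) - (c' * j + j' * c) * g \<xi> = c\<^sup>2 * (j * y' - j' * y)"
      unfolding f_def g_def c_def[symmetric] j_def[symmetric] y_def[symmetric]
      by (simp add: algebra_simps power2_eq_square)
    then show ?thesis using w c by simp
  qed
  ultimately show ?thesis
    unfolding z_coeff_def using im_log_deriv_pos[OF assms, where a = 1] by simp
qed

text \<open>Coefficients of the entire function \<open>Q\<close> for which
\<open>Y\<^sub>n(x) = 2 / \<pi> ln (x / 2) J\<^sub>n(x) - (x / 2)\<^sup>-\<^sup>n Q((x / 2)\<^sup>2) / \<pi>\<close>: the finite sum and the digamma series of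
the classical expansion are one power series after the factor \<open>(x / 2)\<^sup>-\<^sup>n\<close> is taken out.\<close>

definition neumann_coeff :: "nat \<Rightarrow> nat \<Rightarrow> real" where
  "neumann_coeff n k = (if k < n then fact (n - k - 1) / fact k
     else (-1) ^ (k - n) * (Digamma (real (k - n) + 1) + Digamma (real k + 1))
            / (fact (k - n) * fact k))"

lemma bessel_coeff_nat: "bessel_coeff (real n) k = (-1) ^ k / (fact k * fact (n + k))"
  using Gamma_fact[of "n + k", where 'a = real]
  by (simp add: bessel_coeff_def rGamma_inverse_Gamma add_ac divide_inverse)

text \<open>The recursion is homogeneous below the index \<open>n\<close>, where its factor \<open>k + 1 - n\<close> vanishes; from there on
\<open>\<psi>(z + 1) = \<psi>(z) + 1 / z\<close> produces the inhomogeneity that the logarithm calls for.\<close>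

lemma neumann_coeff_rec:
  "(real k + 1) * (real k + (1 - real n)) * neumann_coeff n (Suc k) + neumann_coeff n k =
   (if Suc k < n then 0 else
     (-1) ^ (Suc k - n) * (2 * real (Suc k - n) + real n) / (fact (Suc k - n) * fact (Suc k)))"
proof -
  have "Suc k < n \<or> Suc k = n \<or> n \<le> k" by arith
  then show ?thesis
  proof (elim disjE)
    assume "Suc k < n"
    from le_Suc_ex[OF Suc_leI[OF this]] obtain m where m: "n = Suc (Suc k) + m" ..
    have "(real k + 1) * (real k + (1 - real n)) * (fact m / fact (Suc k)) = - (fact (Suc m) / fact k)"
      by (simp add: m divide_simps) (simp add: algebra_simps)
    then show ?thesis by (simp add: neumann_coeff_def m)
  next
    assume "Suc k = n"
    then show ?thesis by (auto simp: neumann_coeff_def divide_simps)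
  next
    assume "n \<le> k"
    from le_Suc_ex[OF this] obtain j where 3: "k = n + j" ..
    have d1: "Digamma (real j + 1 + 1) = Digamma (real j + 1) + 1 / (real j + 1)"
      by (rule Digamma_plus1) auto
    have d2: "Digamma (real k + 1 + 1) = Digamma (real k + 1) + 1 / (real k + 1)"
      by (rule Digamma_plus1) auto
    have a: "Suc k - n = Suc j" "k - n = j" "real k + (1 - real n) = real j + 1" using 3 by auto
    have r: "(x * y * (- s * (p + 1 / y + (q + 1 / x)) / ((y * u) * (x * v))) + s * (p + q) / (u * v))
        = - s * (x + y) / ((y * u) * (x * v))"
      if "x > 0" "y > 0" "u > 0" "v > 0" for x y s p q u v :: real
      using that by (simp add: divide_simps) (simp add: algebra_simps)
    have "(real k + 1) * (real j + 1) * (- ((-1)^j) * (Digamma (real j + 1) + 1 / (real j + 1)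
          + (Digamma (real k + 1) + 1 / (real k + 1)))
         / (((real j + 1) * fact j) * ((real k + 1) * fact k)))
         + (-1)^j * (Digamma (real j + 1) + Digamma (real k + 1)) / (fact j * fact k)
      = - ((-1)^j) * ((real k + 1) + (real j + 1)) / (((real j + 1) * fact j) * ((real k + 1) * fact k))"
      by (rule r) auto
    moreover have "2 * real (Suc j) + real n = (real k + 1) + (real j + 1)" using 3 by simp
    moreover have "neumann_coeff n (Suc k) = - ((-1)^j) * (Digamma (real j + 1) + 1 / (real j + 1)
          + (Digamma (real k + 1) + 1 / (real k + 1)))
         / (((real j + 1) * fact j) * ((real k + 1) * fact k))"
      unfolding neumann_coeff_def a d1[symmetric] d2[symmetric] using 3 by (simp add: add_ac)
    moreover have "neumann_coeff n k = (-1)^j * (Digamma (real j + 1) + Digamma (real k + 1)) / (fact j * fact k)"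
      unfolding neumann_coeff_def a using 3 by simp
    moreover have "\<not> Suc k < n" using 3 by simp
    ultimately show ?thesis unfolding a by (simp add: add_ac)
  qed
qed

lemma abs_Digamma_le: "\<bar>Digamma (real m + 1)\<bar> \<le> \<bar>Digamma (1::real)\<bar> + real m"
proof (induction m)
  case (Suc m)
  have "Digamma (real (Suc m) + 1) = Digamma (real m + 1) + 1 / (real m + 1)"
    using Digamma_plus1[of "real m + 1"] by (simp add: add_ac)
  moreover have "1 / (real m + 1) \<le> 1" "0 \<le> 1 / (real m + 1)" by simp_all
  ultimately show ?case using Suc unfolding of_nat_Suc by linarith
qed simp

lemma entire_neumann_coeff: "entire (neumann_coeff n)"
proof
  fix t :: real
  define C where "C = 2 * \<bar>Digamma (1::real)\<bar> + 2"
  have "summable (\<lambda>k. C * (inverse (fact k) * (2 * \<bar>t\<bar>) ^ k))"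
    by (intro summable_mult summable_exp)
  moreover have "norm (neumann_coeff n k * t ^ k) \<le> C * (inverse (fact k) * (2 * \<bar>t\<bar>) ^ k)"
    if "k \<ge> n" for k
  proof -
    have "\<bar>Digamma (real (k - n) + 1) + Digamma (real k + 1)\<bar>
        \<le> 2 * \<bar>Digamma (1::real)\<bar> + real (k - n) + real k"
      using abs_Digamma_le[of "k - n"] abs_Digamma_le[of k] by linarith
    also have "\<dots> \<le> 2 * \<bar>Digamma (1::real)\<bar> * (1 + real k) + 2 * (1 + real k)"
    proof -
      have "0 \<le> real k * (2 * \<bar>Digamma (1::real)\<bar>)" by simp
      moreover have "real (k - n) \<le> real k" by simp
      ultimately show ?thesis unfolding distrib_left by (simp only: mult_ac)
    qed
    also have "\<dots> = C * (1 + real k)" by (simp add: C_def algebra_simps)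
    also have "\<dots> \<le> C * 2 ^ k"
    proof (intro mult_left_mono)
      have "Suc k \<le> 2 ^ k" using less_exp[of k] by (simp only: Suc_le_eq)
      then show "1 + real k \<le> 2 ^ k"
        using of_nat_le_iff[of "Suc k" "2 ^ k", where 'a = real] by simp
    qed (simp add: C_def)
    finally have D: "\<bar>Digamma (real (k - n) + 1) + Digamma (real k + 1)\<bar> \<le> C * 2 ^ k" .
    have "\<bar>neumann_coeff n k\<bar> = \<bar>Digamma (real (k - n) + 1) + Digamma (real k + 1)\<bar> / (fact (k - n) * fact k)"
      using that by (simp add: neumann_coeff_def abs_mult abs_divide power_abs)
    also have "\<dots> \<le> C * 2 ^ k / (1 * fact k)"
      using D by (intro frac_le mult_right_mono) (auto simp: fact_ge_1)
    finally have "\<bar>neumann_coeff n k\<bar> * \<bar>t\<bar> ^ k \<le> C * 2 ^ k / (1 * fact k) * \<bar>t\<bar> ^ k"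
      by (intro mult_right_mono) auto
    then show ?thesis by (simp add: abs_mult power_abs power_mult_distrib field_simps)
  qed
  ultimately show "summable (\<lambda>k. neumann_coeff n k * t ^ k)"
    by (rule summable_comparison_test')
qed

lemma bessel_Y_power_series:
  assumes "x > 0"
  shows "bessel_Y n x = 2 / pi * (ln (x / 2) * bessel_J (real n) x)
     - (x / 2) powr (- real n) * power_series (neumann_coeff n) ((x / 2)\<^sup>2) / pi"
proof -
  define z where "z = x / 2"
  have z: "z > 0" using assms by (simp add: z_def)
  let ?c = "\<lambda>k. neumann_coeff n k * (z\<^sup>2) ^ k"
  have zp: "z powr (2 * real k - real n) = z powr (- real n) * (z\<^sup>2) ^ k" for k
    using z powr_realpow[of z "2 * k"] powr_add[of z "- real n" "2 * real k"] by (simp add: power_mult)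
  have "(\<Sum>k<n. fact (n - k - 1) / fact k * z powr (2 * real k - real n))
      = z powr (- real n) * (\<Sum>k<n. ?c k)"
    by (auto simp: sum_distrib_left zp neumann_coeff_def intro!: sum.cong)
  moreover have "(\<Sum>k. (-1) ^ k * (Digamma (real k + 1) + Digamma (real n + real k + 1))
              / (fact k * fact (n + k)) * z ^ (2 * k + n)) = z powr (- real n) * (\<Sum>k. ?c (k + n))"
  proof -
    have "z ^ (2 * k + n) = z powr (- real n) * (z\<^sup>2) ^ (k + n)" for k
      using zp[of "k + n"] z powr_realpow[of z "2 * k + n"] by (simp add: algebra_simps)
    then have "(\<Sum>k. (-1) ^ k * (Digamma (real k + 1) + Digamma (real n + real k + 1))
              / (fact k * fact (n + k)) * z ^ (2 * k + n)) = (\<Sum>k. z powr (- real n) * ?c (k + n))"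
      by (intro suminf_cong) (simp add: neumann_coeff_def add_ac)
    also have "\<dots> = z powr (- real n) * (\<Sum>k. ?c (k + n))"
      using entire_neumann_coeff summable_iff_shift[of ?c n] by (intro suminf_mult) blast
    finally show ?thesis .
  qed
  moreover have "suminf ?c = (\<Sum>k. ?c (k + n)) + (\<Sum>k<n. ?c k)"
    using entire_neumann_coeff by (intro suminf_split_initial_segment) auto
  ultimately show ?thesis
    unfolding bessel_Y_def z_def by (simp add: algebra_simps add_divide_distrib)
qed

lemma ode_rearrange:
  "t * (t * a + \<alpha> * b + c) = r \<Longrightarrow> t * (t * a) = - \<alpha> * (t * b) - t * c + (r::real)"
  by (auto simp: algebra_simps)

text \<open>The last summand is \<open>x d/dx J\<^sub>n\<close> up to a power of \<open>t\<close>: this is what the derivatives of the logarithm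
leave over when the Bessel operator is applied to \<open>ln (x / 2) J\<^sub>n\<close>, and \<open>Q\<close> has to cancel it.\<close>

lemma neumann_ode:
  fixes t :: real and n :: nat
  assumes "t \<noteq> 0"
  defines "P \<equiv> bessel_coeff (real n)" and "Q \<equiv> neumann_coeff n"
  shows "t * (t * power_series (diffs (diffs Q)) t) = - (1 - real n) * (t * power_series (diffs Q) t)
    - t * power_series Q t + t ^ n * (2 * t * power_series (diffs P) t + real n * power_series P t)"
proof -
  define e where "e k = (if k < n then 0 else
     (-1) ^ (k - n) * (2 * real (k - n) + real n) / (fact (k - n) * fact k))" for k
  have "(\<lambda>k. e k * t ^ k) sums (t * (t * power_series (diffs (diffs Q)) t
      + (1 - real n) * power_series (diffs Q) t + power_series Q t))"
    unfolding Q_def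
  proof (rule power_series_ode[OF entire_neumann_coeff])
    show "e (Suc k) = (real k + 1) * (real k + (1 - real n)) * neumann_coeff n (Suc k) + neumann_coeff n k" for k
      unfolding neumann_coeff_rec by (simp add: e_def)
  qed (auto simp: e_def)
  moreover have "(\<lambda>k. e k * t ^ k) sums
      (t ^ n * (2 * t * power_series (diffs P) t + real n * power_series P t))"
  proof -
    have ent: "entire P" "entire (diffs P)" unfolding P_def using entire_bessel_coeff entire_diffs by blast+
    have "(\<lambda>k. t * (diffs P k * t ^ k)) sums (t * power_series (diffs P) t)"
      using ent by (intro sums_mult summable_sums) auto
    then have "(\<lambda>k. real k * (P k * t ^ k)) sums (t * power_series (diffs P) t)"
      using sums_Suc[of "\<lambda>k. real k * (P k * t ^ k)"] by (simp add: diffs_def mult_ac)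
    then have "(\<lambda>k. t ^ n * (2 * (real k * (P k * t ^ k)) + real n * (P k * t ^ k))) sums
        (t ^ n * (2 * (t * power_series (diffs P) t) + real n * power_series P t))"
      using ent by (intro sums_mult sums_add summable_sums) auto
    moreover have "t ^ n * (2 * (real k * (P k * t ^ k)) + real n * (P k * t ^ k)) = e (k + n) * t ^ (k + n)" for k
      by (simp add: e_def P_def bessel_coeff_nat power_add add_ac) (simp add: algebra_simps add_divide_distrib)
    ultimately have "(\<lambda>k. e (k + n) * t ^ (k + n)) sums
        (t ^ n * (2 * t * power_series (diffs P) t + real n * power_series P t))"
      by (simp add: mult_ac)
    then show ?thesis by (subst (asm) sums_iff_shift) (simp add: e_def)
  qed
  ultimately have ode: "t * (t * power_series (diffs (diffs Q)) t + (1 - real n) * power_series (diffs Q) t + power_series Q t)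
     = t ^ n * (2 * t * power_series (diffs P) t + real n * power_series P t)"
    by (rule sums_unique2)
  show ?thesis by (rule ode_rearrange[OF ode])
qed

text \<open>The left-hand side is \<open>t\<close> times the Wronskian of \<open>t\<^bsup>n/2\<^esup> P\<close> and \<open>ln t t\<^bsup>n/2\<^esup> P - t\<^bsup>-n/2\<^esup> Q\<close>; the logarithm and
the fractional powers cancel, and the constant is read off at \<open>t = 0\<close>.\<close>

lemma bessel_wronskian_integer:
  fixes t :: real and n :: nat
  assumes "t > 0"
  defines "P \<equiv> bessel_coeff (real n)" and "Q \<equiv> neumann_coeff n"
  shows "t ^ n * (power_series P t)\<^sup>2 + real n * (power_series P t * power_series Q t)
     - t * (power_series P t * power_series (diffs Q) t - power_series Q t * power_series (diffs P) t) = 1"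
proof -
  let ?P = "power_series P" and ?P1 = "power_series (diffs P)" and ?P2 = "power_series (diffs (diffs P))"
  let ?Q = "power_series Q" and ?Q1 = "power_series (diffs Q)" and ?Q2 = "power_series (diffs (diffs Q))"
  let ?W = "\<lambda>t. t ^ n * (?P t)\<^sup>2 + real n * (?P t * ?Q t) - t * (?P t * ?Q1 t - ?Q t * ?P1 t)"
  let ?W' = "\<lambda>t. real n * t ^ (n - 1) * (?P t)\<^sup>2 + t ^ n * (2 * ?P t * ?P1 t)
      + real n * (?P1 t * ?Q t + ?P t * ?Q1 t) - (?P t * ?Q1 t - ?Q t * ?P1 t)
      - t * (?P t * ?Q2 t - ?Q t * ?P2 t)"
  have ent: "entire P" "entire Q" unfolding P_def Q_def by (rule entire_bessel_coeff entire_neumann_coeff)+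
  note d = power_series_deriv[OF ent(1)] power_series_deriv[OF ent(2)]
    power_series_deriv[OF entire_diffs[OF ent(1)]] power_series_deriv[OF entire_diffs[OF ent(2)]]
  have "(?W has_real_derivative ?W' t) (at t)" for t
    by (rule DERIV_cong[OF DERIV_diff[OF DERIV_add[OF
          DERIV_mult[OF DERIV_pow DERIV_power[OF d(1), of 2]] DERIV_cmult[OF DERIV_mult[OF d(1) d(2)]]]
        DERIV_mult[OF DERIV_ident DERIV_diff[OF DERIV_mult[OF d(1) d(4)] DERIV_mult[OF d(2) d(3)]]]]])
      (simp add: algebra_simps)
  moreover have "?W' t = 0" if "t > 0" for t
  proof -
    have P2: "t * ?P2 t = - (real n + 1) * ?P1 t - ?P t" unfolding P_def using that by (intro bessel_ode) auto
    have Q2: "t * (t * ?Q2 t) = - (1 - real n) * (t * ?Q1 t) - t * ?Q t + t ^ n * (2 * t * ?P1 t + real n * ?P t)"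
      unfolding P_def Q_def using that by (intro neumann_ode) auto
    have n: "t * (real n * t ^ (n - 1)) = real n * t ^ n" by (cases n) auto
    have "t * ?W' t = (t * (real n * t ^ (n - 1))) * (?P t)\<^sup>2 + t * t ^ n * (2 * ?P t * ?P1 t)
      + t * real n * (?P1 t * ?Q t + ?P t * ?Q1 t) - t * (?P t * ?Q1 t - ?Q t * ?P1 t)
      - (?P t * (t * (t * ?Q2 t)) - t * ?Q t * (t * ?P2 t))" by (simp add: algebra_simps)
    also have "\<dots> = 0" unfolding P2 Q2 n by (simp add: algebra_simps power2_eq_square)
    finally show ?thesis using that by simp
  qed
  ultimately have "?W t = ?W 0" using assms(1) by (rule eq_value_at_0_if_deriv_0)
  also have "\<dots> = 0 ^ n * (P 0)\<^sup>2 + real n * (P 0 * Q 0)"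
    using power_series_0[OF ent(1)] power_series_0[OF ent(2)] by simp
  also have "\<dots> = 1"
  proof (cases n)
    case (Suc m)
    have "P 0 = 1 / fact n" "Q 0 = fact m"
      unfolding P_def Q_def bessel_coeff_nat using Suc by (simp_all add: neumann_coeff_def)
    moreover have "fact n = real n * (fact m :: real)" "real n > 0" using Suc by simp_all
    ultimately show ?thesis using Suc by simp
  qed (use bessel_coeff_nat[of n 0] in \<open>simp add: P_def\<close>)
  finally show ?thesis .
qed

lemma Im_Z_coeff_pos:
  assumes "\<xi> > 0"
  shows "Im (Z_coeff n \<xi>) > 0"
proof -
  define m where "m = nat \<bar>n\<bar>"
  define t where "t = (\<xi> / 2)\<^sup>2"
  define P P1 Q Q1 where "P = power_series (bessel_coeff (real m)) t"
    and "P1 = power_series (diffs (bessel_coeff (real m))) t"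
    and "Q = power_series (neumann_coeff m) t"
    and "Q1 = power_series (diffs (neumann_coeff m)) t"
  note PQ = P_def P1_def Q_def Q1_def
  have t: "t > 0" using assms by (simp add: t_def)
  define z where "z = \<xi> / 2"
  have z: "z powr (real m) * z powr (- real m) = 1" "z > 0" "(z powr (real m))\<^sup>2 = t ^ m"
    using assms by (auto simp: z_def powr_minus t_def powr_realpow power_mult[symmetric] mult.commute)
  define j j' y y' where "j = bessel_J (real m) \<xi>"
    and "j' = z powr (real m) * (real m * P + 2 * t * P1) / \<xi>"
    and "y = bessel_Y m \<xi>"
    and "y' = 2 / pi * (1 / \<xi> * j + j' * ln z)
        - z powr (- real m) * (- real m * Q + 2 * t * Q1) / \<xi> / pi"
  have dj: "(bessel_J (real m) has_real_derivative j') (at \<xi>)"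
    unfolding j'_def PQ t_def z_def by (rule bessel_J_deriv[OF assms])
  have dl: "((\<lambda>x. ln (x / 2)) has_real_derivative 1 / \<xi>) (at \<xi>)"
    using assms by (auto intro!: derivative_eq_intros)
  have "((\<lambda>x. 2 / pi * (ln (x / 2) * bessel_J (real m) x)
     - (x / 2) powr (- real m) * power_series (neumann_coeff m) ((x / 2)\<^sup>2) / pi) has_real_derivative
       2 / pi * (1 / \<xi> * j + j' * ln z)
        - z powr (- real m) * (- real m * Q + 2 * t * Q1) / \<xi> / pi) (at \<xi>)"
    using DERIV_diff[OF DERIV_cmult[OF DERIV_mult[OF dl dj], of "2 / pi"]
        DERIV_cdivide[OF powr_times_power_series_deriv[OF assms entire_neumann_coeff, of "- real m" m], of pi]]
    unfolding t_def[symmetric] unfolding z_def[symmetric] j_def[symmetric] PQ[symmetric] .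
  then have dy: "(bessel_Y m has_real_derivative y') (at \<xi>)"
    unfolding y'_def
    by (rule has_field_derivative_transform_within_open[where S = "{0<..}"])
       (use assms bessel_Y_power_series in auto)
  have jj: "j = z powr (real m) * P"
    using assms by (simp add: j_def PQ t_def z_def bessel_J_power_series)
  have yy: "y = 2 / pi * (ln z * j) - z powr (- real m) * Q / pi"
    unfolding y_def j_def PQ t_def z_def by (rule bessel_Y_power_series[OF assms])
  have "j * y' - j' * y = 2 / pi * j\<^sup>2 / \<xi>
      - (j * (z powr (- real m) * (- real m * Q + 2 * t * Q1) / \<xi>) - j' * (z powr (- real m) * Q)) / pi"
    unfolding y'_def yy using assms by (simp add: field_simps power2_eq_square)
  also have "\<dots> = 2 / pi * (z powr (real m))\<^sup>2 * P\<^sup>2 / \<xi>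
      - (z powr (real m) * z powr (- real m)) * (P * (- real m * Q + 2 * t * Q1) - (real m * P + 2 * t * P1) * Q) / (\<xi> * pi)"
    unfolding jj j'_def using assms by (simp add: field_simps power2_eq_square)
  also have "\<dots> = 2 / (pi * \<xi>) * (t ^ m * P\<^sup>2 + real m * (P * Q) - t * (P * Q1 - Q * P1))"
    unfolding z using assms by (simp add: field_simps)
  also have "\<dots> = 2 / (pi * \<xi>)"
    unfolding PQ using bessel_wronskian_integer[OF t, of m] by simp
  also have "\<dots> > 0" using assms by simp
  finally have w: "j * y' - j' * y > 0" .
  define a :: complex where "a = (if n < 0 then (-1) ^ nat \<bar>n\<bar> else 1)"
  have "hankel1 n = (\<lambda>x. a * Complex (bessel_J (real m) x) (bessel_Y m x))"
    by (auto simp: fun_eq_iff hankel1_def a_def m_def)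
  moreover have "a \<noteq> 0" by (simp add: a_def)
  ultimately show ?thesis
    unfolding Z_coeff_def using im_log_deriv_pos[OF assms dj dy _ \<open>a \<noteq> 0\<close>] w
    by (simp add: j_def y_def)
qed

section \<open>Smooth functions with compact support\<close>

text \<open>The derivatives of \<open>exp (- 1 / t)\<close> are polynomials in \<open>1 / t\<close> times the function, so this family is
closed under differentiation, also at \<open>t = 0\<close>.\<close>

definition flat_exp :: "real poly \<Rightarrow> real \<Rightarrow> real" where
  "flat_exp p t = (if t > 0 then poly p (1 / t) * exp (- (1 / t)) else 0)"

lemma poly_times_exp_minus_tendsto_0:
  fixes p :: "real poly"
  shows "((\<lambda>u. poly p u * exp (- u)) \<longlongrightarrow> 0) at_top"
proof -
  have "((\<lambda>u. \<Sum>i\<le>degree p. coeff p i * (u ^ i / exp u)) \<longlongrightarrow> (\<Sum>i\<le>degree p. coeff p i * 0)) at_top"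
    by (intro tendsto_sum tendsto_mult_left tendsto_power_div_exp_0)
  moreover have "poly p u * exp (- u) = (\<Sum>i\<le>degree p. coeff p i * (u ^ i / exp u))" for u
    by (simp add: poly_altdef sum_distrib_right exp_minus divide_inverse mult.assoc)
  ultimately show ?thesis by simp
qed

lemma flat_exp_deriv:
  "(flat_exp p has_real_derivative flat_exp ([:0, 0, 1:] * (p - pderiv p)) t) (at t)"
proof -
  consider "t > 0" | "t < 0" | "t = 0" by linarith
  then show ?thesis
  proof cases
    case 1
    have "((\<lambda>t. poly p (1 / t) * exp (- (1 / t))) has_real_derivative
        flat_exp ([:0, 0, 1:] * (p - pderiv p)) t) (at t)"
      using 1 unfolding flat_exp_def
      by (auto intro!: derivative_eq_intros DERIV_chain2[OF poly_DERIV]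
          simp: field_simps power2_eq_square)
    then show ?thesis
      by (rule has_field_derivative_transform_within_open[where S = "{0<..}"])
         (use 1 in \<open>auto simp: flat_exp_def\<close>)
  next
    case 2
    have "((\<lambda>t. 0) has_real_derivative flat_exp ([:0, 0, 1:] * (p - pderiv p)) t) (at t)"
      using 2 by (simp add: flat_exp_def)
    then show ?thesis
      by (rule has_field_derivative_transform_within_open[where S = "{..<0}"])
         (use 2 in \<open>auto simp: flat_exp_def\<close>)
  next
    case 3
    have "((\<lambda>h. poly ([:0, 1:] * p) (inverse h) * exp (- inverse h)) \<longlongrightarrow> 0) (at_right 0)"
      by (rule filterlim_compose[OF poly_times_exp_minus_tendsto_0 filterlim_inverse_at_top_right])
    then have "((\<lambda>h. flat_exp p h / h) \<longlongrightarrow> 0) (at_right 0)"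
      by (rule Lim_transform_eventually)
         (auto simp: eventually_at_right_less flat_exp_def field_simps
           intro!: eventually_mono[OF eventually_at_right_less[of 0]])
    moreover have "((\<lambda>h. flat_exp p h / h) \<longlongrightarrow> 0) (at_left 0)"
      by (rule Lim_transform_eventually[of "\<lambda>h. 0"])
         (auto simp: flat_exp_def eventually_at_left_field intro!: exI[of _ "-1"])
    ultimately have "((\<lambda>h. flat_exp p h / h) \<longlongrightarrow> 0) (at 0)"
      by (simp add: filterlim_split_at)
    then show ?thesis using 3 by (simp add: DERIV_def flat_exp_def)
  qed
qed

lemma C_k_Suc_imp: "C_k (Suc k) f \<Longrightarrow> C_k k f"
proof (induction k arbitrary: f)
  case 0
  then show ?case
    by (auto simp: continuous_on_eq_continuous_at differentiable_imp_continuous_within)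
qed auto

lemma C_k_continuous: "C_k k f \<Longrightarrow> continuous_on UNIV f"
  by (induction k) (use C_k_Suc_imp in auto)

lemma partial_deriv_eqI: "(f has_derivative f') (at x) \<Longrightarrow> partial_deriv i f x = f' (axis i 1)"
  by (simp add: partial_deriv_def frechet_derivative_at[symmetric])

lemma has_derivative_partial:
  "f differentiable (at x) \<Longrightarrow> (f has_derivative frechet_derivative f (at x)) (at x)"
  by (simp add: frechet_derivative_works)

lemma C_k_add: "C_k k f \<Longrightarrow> C_k k g \<Longrightarrow> C_k k (\<lambda>x. f x + g x)"
proof (induction k arbitrary: f g)
  case (Suc k)
  have "partial_deriv i (\<lambda>x. f x + g x) = (\<lambda>x. partial_deriv i f x + partial_deriv i g x)" for i
  proof
    fix x
    show "partial_deriv i (\<lambda>x. f x + g x) x = partial_deriv i f x + partial_deriv i g x"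
      using Suc.prems unfolding partial_deriv_def[of i f] partial_deriv_def[of i g]
      by (subst partial_deriv_eqI[OF has_derivative_add[OF has_derivative_partial has_derivative_partial]]) auto
  qed
  then show ?case using Suc by auto
qed (auto intro: continuous_on_add)

lemma partial_deriv_mult:
  fixes f g :: "real^'n \<Rightarrow> 'b::real_normed_algebra"
  assumes "f differentiable (at x)" "g differentiable (at x)"
  shows "partial_deriv i (\<lambda>x. f x * g x) x = f x * partial_deriv i g x + partial_deriv i f x * g x"
  using assms unfolding partial_deriv_def[of i f] partial_deriv_def[of i g]
  by (subst partial_deriv_eqI[OF has_derivative_mult[OF has_derivative_partial has_derivative_partial]]) auto

lemma C_k_mult:
  fixes f g :: "real^'n \<Rightarrow> 'b::real_normed_algebra"
  shows "C_k k f \<Longrightarrow> C_k k g \<Longrightarrow> C_k k (\<lambda>x. f x * g x)"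
proof (induction k arbitrary: f g)
  case (Suc k)
  have "partial_deriv i (\<lambda>x. f x * g x) = (\<lambda>x. f x * partial_deriv i g x + partial_deriv i f x * g x)" for i
    using Suc.prems by (auto simp: partial_deriv_mult fun_eq_iff)
  then show ?case
    using Suc C_k_Suc_imp[OF Suc.prems(1)] C_k_Suc_imp[OF Suc.prems(2)]
    by (auto intro!: C_k_add differentiable_mult)
qed (auto intro: continuous_on_mult)

lemma C_k_const: "C_k k (\<lambda>x::real^'n. c)"
proof (induction k arbitrary: c)
  case (Suc k)
  have "partial_deriv i (\<lambda>x::real^'n. c) = (\<lambda>x. 0)" for i
    by (auto simp: fun_eq_iff partial_deriv_eqI[OF has_derivative_const])
  then show ?case using Suc by auto
qed auto

lemma C_k_prod:
  fixes f :: "'i \<Rightarrow> real^'n \<Rightarrow> real"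
  shows "(\<And>i. C_k k (f i)) \<Longrightarrow> C_k k (\<lambda>x. \<Prod>i\<in>S. f i x)"
  by (induction S rule: infinite_finite_induct) (auto intro!: C_k_mult C_k_const)

lemma C_k_flat_exp: "C_k k (\<lambda>x::real^'n. c * flat_exp p (a * x $ j + b))"
proof (induction k arbitrary: c p)
  case 0
  have "continuous_on UNIV (flat_exp p)"
    by (intro continuous_at_imp_continuous_on ballI DERIV_isCont[OF flat_exp_deriv])
  then show ?case
    by (auto intro!: continuous_intros continuous_on_compose2[of UNIV "flat_exp p"])
next
  case (Suc k)
  define q where "q = [:0, 0, 1:] * (p - pderiv p)"
  have d: "((\<lambda>x. c * flat_exp p (a * x $ j + b)) has_derivative
      (\<lambda>v. c * (flat_exp q (a * x $ j + b) * (a * v $ j)))) (at x)" for x :: "real^'n"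
  proof -
    have "((\<lambda>x. a * x $ j + b) has_derivative (\<lambda>v. a * v $ j)) (at x)"
      by (auto intro!: derivative_eq_intros bounded_linear_imp_has_derivative bounded_linear_vec_nth)
    from has_derivative_compose[OF this, of "flat_exp p"] flat_exp_deriv[of p "a * x $ j + b"]
    have "((\<lambda>x. flat_exp p (a * x $ j + b)) has_derivative
        (\<lambda>v. flat_exp q (a * x $ j + b) * (a * v $ j))) (at x)"
      unfolding q_def has_field_derivative_def by blast
    then show ?thesis by (rule has_derivative_mult_right)
  qed
  have "partial_deriv i (\<lambda>x::real^'n. c * flat_exp p (a * x $ j + b)) =
     (\<lambda>x. (if i = j then c * a else 0) * flat_exp q (a * x $ j + b))" for i
    unfolding fun_eq_iff by (subst partial_deriv_eqI[OF d]) (auto simp: axis_def)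
  then show ?case using Suc differentiableI[OF d] by (simp only: C_k.simps) blast
qed

text \<open>As \<open>m\<close> grows, each factor \<open>exp (- 1 / (m d))\<close> tends to \<open>1\<close> for every positive distance \<open>d\<close> to a face, so
these test functions tend to the indicator function of the box.\<close>

definition box_bump :: "real^'n \<Rightarrow> real^'n \<Rightarrow> real \<Rightarrow> real^'n \<Rightarrow> real" where
  "box_bump a b m x = (\<Prod>i\<in>UNIV. flat_exp 1 (m * (x $ i - a $ i)) * flat_exp 1 (m * (b $ i - x $ i)))"

lemma C_k_box_bump:
  fixes a b :: "real^'n"
  shows "C_k k (box_bump a b m)"
proof -
  have "C_k k (\<lambda>x::real^'n. flat_exp 1 (m * (x $ i - a $ i)) * flat_exp 1 (m * (b $ i - x $ i)))" for i
    using C_k_mult[OF C_k_flat_exp[of k 1 1 m i "- m * a $ i"] C_k_flat_exp[of k 1 1 "- m" i "m * b $ i"]]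
    by (simp add: algebra_simps)
  then show ?thesis unfolding box_bump_def by (rule C_k_prod)
qed

lemma flat_exp_1_bounds: "0 \<le> flat_exp 1 t" "flat_exp 1 t \<le> 1"
  by (auto simp: flat_exp_def)

lemma box_bump_bounds: "0 \<le> box_bump a b m x" "box_bump a b m x \<le> 1"
  unfolding box_bump_def
  by (auto intro!: prod_nonneg prod_le_1 mult_nonneg_nonneg mult_le_one flat_exp_1_bounds)

lemma box_bump_outside: "m \<ge> 0 \<Longrightarrow> x \<notin> box a b \<Longrightarrow> box_bump a b m x = 0"
  unfolding box_bump_def mem_box_cart
  by (rule prod_zero) (auto simp: flat_exp_def not_less zero_less_mult_iff, metis linorder_not_less)

lemma box_bump_tendsto_indicator:
  fixes a b x :: "real^'n"
  shows "(\<lambda>m. box_bump a b (real m) x) \<longlonglongrightarrow> indicator (box a b) x"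
proof (cases "x \<in> box a b")
  case True
  have lim: "(\<lambda>m. flat_exp 1 (real m * d)) \<longlonglongrightarrow> 1" if "d > 0" for d
  proof -
    have "(\<lambda>m. exp (- (1 / (real m * d)))) \<longlonglongrightarrow> exp (- 0)"
    proof (intro tendsto_intros)
      have "(\<lambda>m. inverse (real m) * (1 / d)) \<longlonglongrightarrow> 0 * (1 / d)"
        by (intro tendsto_intros lim_inverse_n)
      then show "(\<lambda>m. 1 / (real m * d)) \<longlonglongrightarrow> 0" by (simp add: divide_inverse)
    qed
    then have "(\<lambda>m. exp (- (1 / (real m * d)))) \<longlonglongrightarrow> 1" by simp
    then show ?thesis
      by (rule Lim_transform_eventually)
         (use that in \<open>auto simp: flat_exp_def intro!: eventually_mono[OF eventually_gt_at_top[of 0]]\<close>)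
  qed
  have "(\<lambda>m. box_bump a b (real m) x) \<longlonglongrightarrow> (\<Prod>i\<in>(UNIV::'n set). 1 * 1)"
    unfolding box_bump_def
    by (intro tendsto_prod tendsto_mult lim) (use True in \<open>auto simp: mem_box_cart\<close>)
  then show ?thesis using True by simp
qed (simp add: box_bump_outside)

section \<open>The fundamental lemma of the calculus of variations\<close>

lemma box_bump_test_function: "cbox a b \<subseteq> U \<Longrightarrow> m \<ge> 0 \<Longrightarrow> box_bump a b m \<in> test_functions U"
  unfolding test_functions_def
  using box_subset_cbox[of a b] by (auto intro!: C_k_box_bump exI[of _ "cbox a b"] box_bump_outside)

text \<open>Testing with bumps that converge to indicator functions shows that the integral over every box in
\<open>U\<close> vanishes; by Lebesgue's differentiation theorem \<open>h\<close> is almost everywhere the limit of its averages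
over shrinking boxes.\<close>

lemma fundamental_lemma_calculus_of_variations:
  fixes h :: "real^'n \<Rightarrow> complex"
  assumes U: "open U" and h: "integrable (lebesgue_on U) h"
    and zero: "\<And>\<phi>. \<phi> \<in> test_functions U \<Longrightarrow> (LINT x|lebesgue_on U. h x * of_real (\<phi> x)) = 0"
  shows "AE x in lebesgue_on U. h x = 0"
proof -
  define H where "H x = indicator U x *\<^sub>R h x" for x
  have Us: "U \<in> sets lebesgue" using U by (simp add: borel_open)
  have Hint: "integrable lebesgue H" unfolding H_def
    using h Us by (simp add: integrable_restrict_space)
  have box0: "integral (cbox a b) H = 0" if ab: "cbox a b \<subseteq> U" for a b
  proof -
    have "(\<lambda>m. LINT x|lebesgue_on U. h x * of_real (box_bump a b (real m) x)) \<longlonglongrightarrow>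
        (LINT x|lebesgue_on U. h x * of_real (indicator (box a b) x))"
    proof (rule integral_dominated_convergence[where w = "\<lambda>x. norm (h x)"])
      have "(\<lambda>x. indicator (box a b) x :: real) \<in> borel_measurable (lebesgue_on U)"
        by (intro measurable_restrict_space1 borel_measurable_indicator) auto
      then show "(\<lambda>x. h x * of_real (indicator (box a b) x)) \<in> borel_measurable (lebesgue_on U)"
        using h by (intro borel_measurable_times borel_measurable_of_real) auto
      show "(\<lambda>x. h x * of_real (box_bump a b (real m) x)) \<in> borel_measurable (lebesgue_on U)" for m
      proof -
        have "box_bump a b (real m) \<in> borel_measurable (lebesgue_on U)"
          using C_k_continuous[OF C_k_box_bump[of 0 a b "real m"]]
          by (meson Us continuous_imp_measurable_on_sets_lebesgue continuous_on_subset subset_UNIV)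
        then show ?thesis using h by (intro borel_measurable_times borel_measurable_of_real) auto
      qed
      show "integrable (lebesgue_on U) (\<lambda>x. norm (h x))" using h by simp
      show "AE x in lebesgue_on U. (\<lambda>m. h x * of_real (box_bump a b (real m) x))
          \<longlonglongrightarrow> h x * of_real (indicator (box a b) x)"
        by (intro AE_I2 tendsto_mult tendsto_const tendsto_of_real box_bump_tendsto_indicator)
      show "AE x in lebesgue_on U. norm (h x * of_real (box_bump a b (real m) x)) \<le> norm (h x)" for m
        by (intro AE_I2) (auto simp: norm_mult box_bump_bounds intro!: mult_left_le)
    qed
    moreover have "(LINT x|lebesgue_on U. h x * of_real (box_bump a b (real m) x)) = 0" for m
      using ab by (intro zero box_bump_test_function) auto
    ultimately have "(LINT x|lebesgue_on U. h x * of_real (indicator (box a b) x)) = 0"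
      by (simp add: LIMSEQ_const_iff)
    then have "(LINT x|lebesgue. indicator U x *\<^sub>R (h x * of_real (indicator (box a b) x))) = 0"
      using Us by (simp add: integral_restrict_space)
    moreover have "indicator U x *\<^sub>R (h x * of_real (indicator (box a b) x)) = indicator (box a b) x *\<^sub>R H x" for x
      by (auto simp: H_def split: split_indicator)
    ultimately have "(LINT x:box a b|lebesgue. H x) = 0"
      by (simp add: set_lebesgue_integral_def)
    moreover have "set_integrable lebesgue (box a b) H"
      using Hint unfolding set_integrable_def by (intro integrable_mult_indicator) auto
    ultimately have "integral (box a b) H = 0"
      using set_lebesgue_integral_eq_integral(2) by metis
    then show ?thesis by (simp add: integral_open_interval)
  qed
  have "H integrable_on cbox a b" for a b
  proof -
    have "set_integrable lebesgue (cbox a b) H"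
      using Hint unfolding set_integrable_def by (intro integrable_mult_indicator) auto
    then show ?thesis by (rule set_lebesgue_integral_eq_integral)
  qed
  then obtain N where N: "negligible N" and lim: "\<And>x e. \<lbrakk>x \<notin> N; 0 < e\<rbrakk> \<Longrightarrow>
      \<exists>d>0. \<forall>h. 0 < h \<and> h < d \<longrightarrow> norm (integral (cbox x (x + h *\<^sub>R One)) H /\<^sub>R h ^ DIM(real^'n) - H x) < e"
    using integrable_ccontinuous_explicit by blast
  have "H x = 0" if x: "x \<in> U" "x \<notin> N" for x
  proof (rule ccontr)
    assume "H x \<noteq> 0"
    then obtain d where d: "d > 0"
      "\<And>t. 0 < t \<Longrightarrow> t < d \<Longrightarrow> norm (integral (cbox x (x + t *\<^sub>R One)) H /\<^sub>R t ^ DIM(real^'n) - H x) < norm (H x)"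
      using lim[OF x(2), of "norm (H x)"] by auto
    obtain r where r: "r > 0" "cball x r \<subseteq> U" using U x(1) open_contains_cball by blast
    define M where "M = norm (One :: real^'n)"
    define t where "t = min (d / 2) (r / (M + 1))"
    have M: "M \<ge> 0" by (simp add: M_def)
    then have t: "0 < t" "t < d"
      using d r by (auto simp: t_def min_def divide_simps)
    have "t * (M + 1) \<le> r / (M + 1) * (M + 1)" using M by (intro mult_right_mono) (auto simp: t_def)
    with M t have t: "0 < t" "t < d" "t * (M + 1) \<le> r" by auto
    have "cbox x (x + t *\<^sub>R One) \<subseteq> cball x r"
    proof
      fix y assume y: "y \<in> cbox x (x + t *\<^sub>R One)"
      have One: "(One::real^'n) $ i = 1" for i
        by (simp add: cart_eq_inner_axis inner_sum_left inner_Basis axis_in_Basis_iff)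
      have yx: "x $ i \<le> y $ i" "y $ i \<le> x $ i + t" for i
        using y by (auto simp: mem_box_cart One simp del: sum_component)
      have "norm (y - x) \<le> norm (t *\<^sub>R One :: real^'n)"
      proof (rule norm_le_componentwise_cart)
        show "norm ((y - x) $ i) \<le> norm ((t *\<^sub>R One :: real^'n) $ i)" for i
          using yx[of i] t(1) One[of i] by (simp del: sum_component)
      qed
      also have "\<dots> = t * M" using t by (simp add: M_def)
      also have "\<dots> \<le> r" using t M by (auto simp: algebra_simps)
      finally show "y \<in> cball x r" by (simp add: dist_norm norm_minus_commute)
    qed
    then have "integral (cbox x (x + t *\<^sub>R One)) H = 0" using r by (intro box0) auto
    with d(2)[OF t(1,2)] show False by simp
  qed
  then have "AE x in lebesgue. x \<in> U \<longrightarrow> h x = 0"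
    using N by (intro AE_I'[of N]) (auto simp: H_def negligible_iff_null_sets)
  then show ?thesis using Us by (simp add: AE_restrict_space_iff)
qed

section \<open>Square integrable functions\<close>

lemma borel_measurable_cnj [measurable (raw)]:
  "f \<in> borel_measurable M \<Longrightarrow> (\<lambda>x. cnj (f x)) \<in> borel_measurable M"
  by (rule borel_measurable_continuous_on[OF continuous_on_cnj[OF continuous_on_id]])

lemma L2D: "f \<in> L2 M \<Longrightarrow> f \<in> borel_measurable M" "f \<in> L2 M \<Longrightarrow> integrable M (\<lambda>x. (cmod (f x))\<^sup>2)"
  by (auto simp: L2_def)

text \<open>A triangle inequality for squares with the constant \<open>2\<close>; it passes to integrals termwise and is
sharp enough for all limits taken below.\<close>

lemma cmod_add_square_le: "(cmod (a + b))\<^sup>2 \<le> 2 * (cmod a)\<^sup>2 + 2 * (cmod b)\<^sup>2"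
proof -
  have "(cmod (a + b))\<^sup>2 \<le> (cmod a + cmod b)\<^sup>2"
    by (intro power_mono norm_triangle_ineq) auto
  also have "\<dots> \<le> 2 * (cmod a)\<^sup>2 + 2 * (cmod b)\<^sup>2"
    using zero_le_power2[of "cmod a - cmod b"] by (simp add: power2_sum power2_diff)
  finally show ?thesis .
qed

lemma L2_add:
  assumes "f \<in> L2 M" "g \<in> L2 M"
  shows "(\<lambda>x. f x + g x) \<in> L2 M"
proof -
  have "integrable M (\<lambda>x. (cmod (f x + g x))\<^sup>2)"
  proof (rule Bochner_Integration.integrable_bound)
    show "integrable M (\<lambda>x. 2 * (cmod (f x))\<^sup>2 + 2 * (cmod (g x))\<^sup>2)"
      using assms by (auto simp: L2_def)
    show "(\<lambda>x. (cmod (f x + g x))\<^sup>2) \<in> borel_measurable M"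
      using assms by (auto simp: L2_def)
  qed (auto intro!: AE_I2 order_trans[OF cmod_add_square_le])
  then show ?thesis using assms by (auto simp: L2_def)
qed

lemma L2_cmult: "f \<in> L2 M \<Longrightarrow> (\<lambda>x. a * f x) \<in> L2 M"
  by (auto simp: L2_def norm_mult power_mult_distrib)

lemma L2_zero: "(\<lambda>x. 0) \<in> L2 M"
  by (auto simp: L2_def)

lemma L2_diff: "f \<in> L2 M \<Longrightarrow> g \<in> L2 M \<Longrightarrow> (\<lambda>x. f x - g x) \<in> L2 M"
  using L2_add[of f M "\<lambda>x. - 1 * g x"] L2_cmult[of g M "- 1"] by simp

lemma L2_mult_integrable:
  assumes "f \<in> L2 M" "g \<in> L2 M"
  shows "integrable M (\<lambda>x. f x * g x)"
proof (rule Bochner_Integration.integrable_bound)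
  show "integrable M (\<lambda>x. (cmod (f x))\<^sup>2 + (cmod (g x))\<^sup>2)"
    using assms by (auto simp: L2_def)
  show "(\<lambda>x. f x * g x) \<in> borel_measurable M"
    using assms by (auto simp: L2_def)
  have "cmod a * cmod b \<le> (cmod a)\<^sup>2 + (cmod b)\<^sup>2" for a b
    using zero_le_power2[of "cmod a - cmod b"] zero_le_power2[of "cmod a"] zero_le_power2[of "cmod b"]
    unfolding power2_diff by linarith
  then show "AE x in M. norm (f x * g x) \<le> norm ((cmod (f x))\<^sup>2 + (cmod (g x))\<^sup>2)"
    by (intro AE_I2) (auto simp: norm_mult)
qed

lemma L2_cnj: "f \<in> L2 M \<Longrightarrow> (\<lambda>x. cnj (f x)) \<in> L2 M"
  by (auto simp: L2_def)

lemma ip_integrable: "f \<in> L2 M \<Longrightarrow> g \<in> L2 M \<Longrightarrow> integrable M (\<lambda>x. f x * cnj (g x))"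
  using L2_mult_integrable L2_cnj by blast

lemma ip_add_left:
  "f \<in> L2 M \<Longrightarrow> g \<in> L2 M \<Longrightarrow> v \<in> L2 M \<Longrightarrow> ip M (\<lambda>x. f x + g x) v = ip M f v + ip M g v"
  unfolding ip_def distrib_right by (intro Bochner_Integration.integral_add ip_integrable)

lemma ip_cmult_left: "ip M (\<lambda>x. a * f x) v = a * ip M f v"
  unfolding ip_def by (simp add: mult.assoc)

lemma ip_commute: "ip M f g = cnj (ip M g f)"
  unfolding ip_def using Bochner_Integration.integral_cnj[of M "\<lambda>x. g x * cnj (f x)"] by (simp add: mult.commute)

lemma ip_cmult_right: "ip M f (\<lambda>x. a * g x) = cnj a * ip M f g"
  using ip_cmult_left[of M a g f] ip_commute[of M f "\<lambda>x. a * g x"] ip_commute[of M f g] by simp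

lemma ip_cong:
  assumes "f \<in> L2 M" "f' \<in> L2 M" "g \<in> L2 M" "g' \<in> L2 M"
    and "AE x in M. f x = f' x" "AE x in M. g x = g' x"
  shows "ip M f g = ip M f' g'"
  unfolding ip_def
proof (rule integral_cong_AE)
  show "AE x in M. f x * cnj (g x) = f' x * cnj (g' x)" using assms(5,6) by eventually_elim auto
qed (use assms in \<open>auto simp: L2_def\<close>)

lemma L2nrm_nonneg: "0 \<le> L2nrm M f"
  by (simp add: L2nrm_def)

lemma L2nrm_square: "(L2nrm M f)\<^sup>2 = (LINT x|M. (cmod (f x))\<^sup>2)"
  by (simp add: L2nrm_def)

lemma ip_self: "ip M f f = of_real ((L2nrm M f)\<^sup>2)"
  unfolding L2nrm_square ip_def complex_norm_square[symmetric] by (rule integral_complex_of_real)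

lemma L2nrm_cmult: "L2nrm M (\<lambda>x. a * f x) = cmod a * L2nrm M f"
  by (simp add: L2nrm_def norm_mult power_mult_distrib real_sqrt_mult)

lemma L2nrm_cong:
  assumes "f \<in> L2 M" "f' \<in> L2 M" "AE x in M. f x = f' x"
  shows "L2nrm M f = L2nrm M f'"
  unfolding L2nrm_def
proof (intro arg_cong[of _ _ sqrt] integral_cong_AE)
  show "AE x in M. (cmod (f x))\<^sup>2 = (cmod (f' x))\<^sup>2" using assms(3) by eventually_elim auto
qed (use assms in \<open>auto simp: L2_def\<close>)

lemma L2nrm_eq_0_iff:
  assumes "f \<in> L2 M"
  shows "L2nrm M f = 0 \<longleftrightarrow> (AE x in M. f x = 0)"
  using integral_nonneg_eq_0_iff_AE[of M "\<lambda>x. (cmod (f x))\<^sup>2"] assms by (auto simp: L2nrm_def L2_def)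

lemma L2nrm_add_square_le:
  assumes "f \<in> L2 M" "g \<in> L2 M"
  shows "(L2nrm M (\<lambda>x. f x + g x))\<^sup>2 \<le> 2 * (L2nrm M f)\<^sup>2 + 2 * (L2nrm M g)\<^sup>2"
proof -
  have "(LINT x|M. (cmod (f x + g x))\<^sup>2) \<le> (LINT x|M. 2 * (cmod (f x))\<^sup>2 + 2 * (cmod (g x))\<^sup>2)"
    using assms L2_add[OF assms] by (intro integral_mono cmod_add_square_le) (auto simp: L2_def)
  then show ?thesis using assms unfolding L2nrm_square by (simp add: L2_def)
qed

lemma L2_bounded:
  assumes "finite_measure M" "f \<in> borel_measurable M" "AE x in M. cmod (f x) \<le> B"
  shows "f \<in> L2 M"
proof -
  interpret finite_measure M by fact
  have "integrable M (\<lambda>x. (cmod (f x))\<^sup>2)"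
  proof (rule integrable_const_bound[of _ "B\<^sup>2"])
    show "AE x in M. norm ((cmod (f x))\<^sup>2) \<le> B\<^sup>2"
      using assms(3) by eventually_elim (auto intro: power_mono)
  qed (use assms in auto)
  then show ?thesis using assms by (auto simp: L2_def)
qed

section \<open>Weak derivatives\<close>

lemma test_functionD:
  assumes "\<phi> \<in> test_functions U"
  shows "C_k k \<phi>" "continuous_on UNIV \<phi>" "continuous_on UNIV (partial_deriv i \<phi>)" "\<phi> differentiable (at x)"
proof -
  have *: "C_k k \<phi>" for k using assms by (simp add: test_functions_def)
  show "C_k k \<phi>" by (rule *)
  show "continuous_on UNIV \<phi>" using *[of 0] by simp
  show "continuous_on UNIV (partial_deriv i \<phi>)" "\<phi> differentiable (at x)" using *[of 1] by simp_all
qed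

text \<open>The integral of a difference quotient vanishes by translation invariance, and the difference
quotients converge boundedly to the derivative.\<close>

lemma integral_partial_deriv_compact_support:
  fixes f :: "real^'n \<Rightarrow> complex"
  assumes f: "C_k 1 f" and K: "compact K" "\<And>x. x \<notin> K \<Longrightarrow> f x = 0"
  shows "(LINT x|lborel. partial_deriv i f x) = 0"
proof -
  define D where "D = partial_deriv i f"
  define e :: "real^'n" where "e = axis i 1"
  have fd: "f differentiable (at x)" for x using f by simp
  have fc: "continuous_on UNIV f" using C_k_continuous[OF f] .
  have Dc: "continuous_on UNIV D" using f by (simp add: D_def)
  have D0: "D x = 0" if "x \<notin> K" for x
  proof -
    have "open (- K)" using K(1) by (simp add: compact_imp_closed open_Compl)
    then have "(f has_derivative (\<lambda>x. 0)) (at x)"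
      by (rule has_derivative_transform_within_open[OF has_derivative_const[of 0]]) (use that K in auto)
    then show ?thesis by (simp add: D_def partial_deriv_eqI)
  qed
  obtain M where M: "\<And>x. cmod (D x) \<le> M"
  proof -
    have "bounded (D ` K)"
      using Dc K(1) by (meson compact_continuous_image compact_imp_bounded continuous_on_subset subset_UNIV)
    then obtain B where B: "\<And>x. x \<in> K \<Longrightarrow> cmod (D x) \<le> B" by (auto simp: bounded_iff)
    have "cmod (D x) \<le> max B 0" for x by (cases "x \<in> K") (use B D0 in \<open>auto simp: le_max_iff_disj\<close>)
    then show ?thesis by (rule that)
  qed
  then have M0: "M \<ge> 0" using norm_ge_zero order_trans by blast
  obtain r where r: "K \<subseteq> cball 0 r"
    using K(1) compact_imp_bounded bounded_subset_ballD[of K 0] ball_subset_cball by blast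
  have dir: "((\<lambda>t. f (x + t *\<^sub>R e)) has_vector_derivative D (x + t *\<^sub>R e)) (at t)" for x t
  proof -
    have "((\<lambda>t. x + t *\<^sub>R e) has_derivative (\<lambda>s. s *\<^sub>R e)) (at t)"
      by (auto intro!: derivative_eq_intros)
    from has_derivative_compose[OF this has_derivative_partial[OF fd]]
    show ?thesis
      unfolding has_vector_derivative_def D_def partial_deriv_def e_def
      using linear_scale[OF has_derivative_linear[OF has_derivative_partial[OF fd]]] by simp
  qed
  define h where "h n = inverse (real (Suc n))" for n
  have h: "0 < h n" "h n \<le> 1" for n by (auto simp: h_def field_simps)
  define q where "q n x = (f (x + h n *\<^sub>R e) - f x) /\<^sub>R h n" for n x
  have fint: "integrable lborel f"
  proof -
    have "integrable lborel (\<lambda>x. indicator K x *\<^sub>R f x)"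
      using K(1) fc by (intro borel_integrable_compact) (auto intro: continuous_on_subset)
    moreover have "(\<lambda>x. indicator K x *\<^sub>R f x) = f" using K(2) by (auto simp: fun_eq_iff split: split_indicator)
    ultimately show ?thesis by simp
  qed
  have shift: "has_bochner_integral lborel (\<lambda>x. f (x + v)) (LINT x|lborel. f x)" for v
  proof -
    have "has_bochner_integral (distr lborel borel ((+) v)) f (LINT x|lborel. f x)"
      unfolding lborel_distr_plus using fint by (rule has_bochner_integral_integrable)
    then have "has_bochner_integral lborel (\<lambda>x. f (v + x)) (LINT x|lborel. f x)"
      using fint by (simp add: has_bochner_integral_iff integrable_distr_eq integral_distr)
    then show ?thesis by (simp only: add.commute)
  qed
  have q0: "(LINT x|lborel. q n x) = 0" for n
  proof -
    have "has_bochner_integral lborel (\<lambda>x. f (x + h n *\<^sub>R e) - f x) ((LINT x|lborel. f x) - (LINT x|lborel. f x))"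
      using shift[of 0] by (intro has_bochner_integral_diff shift) simp
    then show ?thesis unfolding q_def by (simp add: has_bochner_integral_iff)
  qed
  have qlim: "(\<lambda>n. q n x) \<longlonglongrightarrow> D x" for x
  proof -
    have "((\<lambda>t. norm (f (x + (0 + t) *\<^sub>R e) - f (x + 0 *\<^sub>R e) - t *\<^sub>R D (x + 0 *\<^sub>R e)) / norm t) \<longlongrightarrow> 0) (at 0)"
      using dir[of x 0] unfolding has_vector_derivative_def has_derivative_at by simp
    moreover have "filterlim h (at 0) sequentially"
      using LIMSEQ_inverse_real_of_nat h(1) unfolding filterlim_at h_def
      by (auto intro!: always_eventually simp: less_imp_neq[symmetric])
    ultimately have "(\<lambda>n. norm (f (x + h n *\<^sub>R e) - f x - h n *\<^sub>R D x) / norm (h n)) \<longlonglongrightarrow> 0"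
      using filterlim_compose by fastforce
    moreover have "norm (f (x + h n *\<^sub>R e) - f x - h n *\<^sub>R D x) / norm (h n) = norm (q n x - D x)" for n
    proof -
      have "q n x - D x = (f (x + h n *\<^sub>R e) - f x - h n *\<^sub>R D x) /\<^sub>R h n"
        using h(1)[of n] by (simp add: q_def scaleR_diff_right)
      then show ?thesis using h(1)[of n] by (simp add: divide_inverse mult.commute)
    qed
    ultimately show ?thesis by (simp add: tendsto_norm_zero_iff LIM_zero_cancel)
  qed
  have qb: "norm (q n x) \<le> M * indicator (cball 0 (r + 1)) x" for n x
  proof (cases "x \<in> cball 0 (r + 1)")
    case True
    have "\<exists>t\<in>{0<..<h n}. norm (f (x + h n *\<^sub>R e) - f (x + 0 *\<^sub>R e)) \<le> norm ((h n - 0) *\<^sub>R D (x + t *\<^sub>R e))"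
    proof (rule mvt_general[OF h(1)])
      show "continuous_on {0..h n} (\<lambda>t. f (x + t *\<^sub>R e))"
        by (intro continuous_on_compose2[OF fc] continuous_intros) auto
      show "((\<lambda>t. f (x + t *\<^sub>R e)) has_derivative (\<lambda>s. s *\<^sub>R D (x + t *\<^sub>R e))) (at t)" for t
        using dir[of x t] by (simp add: has_vector_derivative_def)
    qed
    then obtain t where "norm (f (x + h n *\<^sub>R e) - f x) \<le> h n * norm (D (x + t *\<^sub>R e))"
      using h(1)[of n] by auto
    also have "\<dots> \<le> h n * M" using h(1)[of n] M by (intro mult_left_mono) auto
    finally have "norm (f (x + h n *\<^sub>R e) - f x) / h n \<le> M" using h(1)[of n] by (simp add: field_simps)
    then show ?thesis using True h(1)[of n] by (simp add: q_def divide_inverse mult.commute)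
  next
    case False
    have n1: "norm (h n *\<^sub>R e) \<le> 1" using h[of n] by (simp add: e_def norm_axis_1)
    have "x \<notin> K" "x + h n *\<^sub>R e \<notin> K"
      using False r n1 norm_triangle_ineq4[of "x + h n *\<^sub>R e" "h n *\<^sub>R e"] by auto
    then show ?thesis using K(2) False by (simp add: q_def)
  qed
  have "(\<lambda>n. LINT x|lborel. q n x) \<longlonglongrightarrow> (LINT x|lborel. D x)"
  proof (rule integral_dominated_convergence[where w = "\<lambda>x. M * indicator (cball 0 (r + 1)) x"])
    show "D \<in> borel_measurable lborel"
      using Dc by (simp add: borel_measurable_continuous_onI)
    have "(\<lambda>x. f (x + h n *\<^sub>R e) - f x) \<in> borel_measurable borel" for n
      by (intro borel_measurable_continuous_onI continuous_intros fc continuous_on_compose2[OF fc]) auto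
    then show "q n \<in> borel_measurable lborel" for n
      unfolding q_def by measurable
    show "integrable lborel (\<lambda>x. M * indicator (cball 0 (r + 1)) x :: real)"
      by (intro integrable_mult_right integrable_real_indicator) (use emeasure_bounded_finite[OF bounded_cball] in simp_all)
  qed (use qlim qb in auto)
  then show ?thesis by (simp add: q0 LIMSEQ_const_iff D_def)
qed

lemma integral_lebesgue_on_eq_lborel:
  fixes f :: "real^'n \<Rightarrow> 'b::{banach, second_countable_topology}"
  assumes "U \<in> sets borel" "f \<in> borel_measurable borel"
  shows "(LINT x|lebesgue_on U. f x) = (LINT x|lborel. indicator U x *\<^sub>R f x)"
proof -
  have "(LINT x|lebesgue_on U. f x) = (LINT x|lebesgue. indicator U x *\<^sub>R f x)"
    using assms by (intro integral_restrict_space) auto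
  also have "\<dots> = (LINT x|lborel. indicator U x *\<^sub>R f x)"
    using assms by (intro integral_completion) auto
  finally show ?thesis .
qed

lemma H1nrm_nonneg: "0 \<le> H1nrm U u"
  by (simp add: H1nrm_def sum_nonneg)

lemma H1nrm_square: "(H1nrm U u)\<^sup>2 = (\<Sum>i\<in>UNIV. (L2nrm (lebesgue_on U) (wd U i u))\<^sup>2) + (L2nrm (lebesgue_on U) u)\<^sup>2"
  by (simp add: H1nrm_def sum_nonneg)

context
  fixes U :: "(real^'n) set"
  assumes U: "open U" "bounded U"
begin

lemma finite_measure_domain: "finite_measure (lebesgue_on U)"
  using U by (intro finite_measure_lebesgue_on bounded_set_imp_lmeasurable) auto

lemma continuous_imp_L2:
  assumes "continuous_on UNIV f"
  shows "f \<in> L2 (lebesgue_on U)"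
proof -
  have "compact (f ` closure U)"
    using U assms by (intro compact_continuous_image) (auto intro: continuous_on_subset)
  from compact_imp_bounded[OF this] obtain B where "\<forall>y\<in>f ` closure U. cmod y \<le> B"
    unfolding bounded_iff ..
  then have B: "cmod (f x) \<le> B" if "x \<in> closure U" for x using that by simp
  show ?thesis
  proof (rule L2_bounded[OF finite_measure_domain])
    show "f \<in> borel_measurable (lebesgue_on U)"
      using U assms by (intro continuous_imp_measurable_on_sets_lebesgue) (auto intro: continuous_on_subset)
    show "AE x in lebesgue_on U. cmod (f x) \<le> B"
      using B closure_subset by (intro AE_I2) auto
  qed
qed

lemma L2_domain_integrable: "f \<in> L2 (lebesgue_on U) \<Longrightarrow> integrable (lebesgue_on U) f"
  using L2_mult_integrable[of f _ "\<lambda>x. 1"] continuous_imp_L2[of "\<lambda>x. 1"] by simp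

lemma test_function_L2:
  assumes "\<phi> \<in> test_functions U"
  shows "(\<lambda>x. of_real (\<phi> x)) \<in> L2 (lebesgue_on U)"
    and "(\<lambda>x. of_real (partial_deriv i \<phi> x)) \<in> L2 (lebesgue_on U)"
  by (intro continuous_imp_L2 continuous_on_of_real test_functionD[OF assms])+

text \<open>Because of this, \<open>wd\<close> computes the weak derivative up to null sets and inherits its linearity.\<close>

lemma weak_partial_unique:
  assumes g: "weak_partial U i u g" and h: "weak_partial U i v h"
    and uv: "AE x in lebesgue_on U. u x = v x"
  shows "AE x in lebesgue_on U. g x = h x"
proof -
  have L2: "u \<in> L2 (lebesgue_on U)" "v \<in> L2 (lebesgue_on U)" "g \<in> L2 (lebesgue_on U)" "h \<in> L2 (lebesgue_on U)"
    using g h by (auto simp: weak_partial_def)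
  have "AE x in lebesgue_on U. g x - h x = 0"
  proof (rule fundamental_lemma_calculus_of_variations[OF U(1)])
    show "integrable (lebesgue_on U) (\<lambda>x. g x - h x)"
      by (intro L2_domain_integrable L2_diff L2)
    fix \<phi> assume \<phi>: "\<phi> \<in> test_functions U"
    note \<phi>L2 = test_function_L2[OF \<phi>]
    have "(LINT x|lebesgue_on U. u x * of_real (partial_deriv i \<phi> x))
        = (LINT x|lebesgue_on U. v x * of_real (partial_deriv i \<phi> x))"
    proof (rule integral_cong_AE)
      show "AE x in lebesgue_on U. u x * of_real (partial_deriv i \<phi> x) = v x * of_real (partial_deriv i \<phi> x)"
        using uv by eventually_elim simp
    qed (use L2_mult_integrable[OF L2(1) \<phi>L2(2)[of i]] L2_mult_integrable[OF L2(2) \<phi>L2(2)[of i]] in auto)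
    then have "(LINT x|lebesgue_on U. g x * of_real (\<phi> x)) = (LINT x|lebesgue_on U. h x * of_real (\<phi> x))"
      using g h \<phi> by (auto simp: weak_partial_def)
    then show "(LINT x|lebesgue_on U. (g x - h x) * of_real (\<phi> x)) = 0"
      unfolding left_diff_distrib
      by (subst Bochner_Integration.integral_diff[OF L2_mult_integrable[OF L2(3) \<phi>L2(1)] L2_mult_integrable[OF L2(4) \<phi>L2(1)]]) simp
  qed
  then show ?thesis by eventually_elim simp
qed

lemma weak_partial_add:
  assumes g: "weak_partial U i u g" and h: "weak_partial U i v h"
  shows "weak_partial U i (\<lambda>x. u x + v x) (\<lambda>x. g x + h x)"
proof -
  have L2: "u \<in> L2 (lebesgue_on U)" "v \<in> L2 (lebesgue_on U)" "g \<in> L2 (lebesgue_on U)" "h \<in> L2 (lebesgue_on U)"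
    using g h by (auto simp: weak_partial_def)
  have "(LINT x|lebesgue_on U. (u x + v x) * of_real (partial_deriv i \<phi> x))
      = - (LINT x|lebesgue_on U. (g x + h x) * of_real (\<phi> x))" if \<phi>: "\<phi> \<in> test_functions U" for \<phi>
  proof -
    note \<phi>L2 = test_function_L2(1)[OF \<phi>] test_function_L2(2)[OF \<phi>, of i]
    show ?thesis
      unfolding distrib_right
        Bochner_Integration.integral_add[OF L2_mult_integrable[OF L2(1) \<phi>L2(2)] L2_mult_integrable[OF L2(2) \<phi>L2(2)]]
        Bochner_Integration.integral_add[OF L2_mult_integrable[OF L2(3) \<phi>L2(1)] L2_mult_integrable[OF L2(4) \<phi>L2(1)]]
      using g h \<phi> by (simp add: weak_partial_def)
  qed
  then show ?thesis using L2 by (simp add: weak_partial_def L2_add)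
qed

lemma weak_partial_cmult:
  assumes "weak_partial U i u g"
  shows "weak_partial U i (\<lambda>x. a * u x) (\<lambda>x. a * g x)"
  using assms by (simp add: weak_partial_def L2_cmult mult.assoc)

lemma wd_weak_partial: "u \<in> H1 U \<Longrightarrow> weak_partial U i u (wd U i u)"
  unfolding wd_def H1_def by (rule someI_ex[of "weak_partial U i u"]) auto

lemma wd_unique:
  assumes "weak_partial U i u g"
  shows "AE x in lebesgue_on U. wd U i u x = g x"
proof -
  have "weak_partial U i u (wd U i u)" unfolding wd_def using assms by (rule someI[of "weak_partial U i u"])
  then show ?thesis using weak_partial_unique[OF _ assms] by simp
qed

lemma H1_L2: "u \<in> H1 U \<Longrightarrow> u \<in> L2 (lebesgue_on U)"
  by (simp add: H1_def)

lemma wd_L2: "u \<in> H1 U \<Longrightarrow> wd U i u \<in> L2 (lebesgue_on U)"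
  using wd_weak_partial by (auto simp: weak_partial_def)

lemma H1_add: "u \<in> H1 U \<Longrightarrow> v \<in> H1 U \<Longrightarrow> (\<lambda>x. u x + v x) \<in> H1 U"
  using weak_partial_add[OF wd_weak_partial wd_weak_partial] unfolding H1_def
  by (auto intro!: L2_add)

lemma H1_cmult: "u \<in> H1 U \<Longrightarrow> (\<lambda>x. a * u x) \<in> H1 U"
  using weak_partial_cmult[OF wd_weak_partial] unfolding H1_def
  by (auto intro!: L2_cmult)

lemma H1_diff: "u \<in> H1 U \<Longrightarrow> v \<in> H1 U \<Longrightarrow> (\<lambda>x. u x - v x) \<in> H1 U"
  using H1_add[of u "\<lambda>x. - 1 * v x"] H1_cmult[of v "- 1"] by simp

lemma wd_add:
  assumes "u \<in> H1 U" "v \<in> H1 U"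
  shows "AE x in lebesgue_on U. wd U i (\<lambda>x. u x + v x) x = wd U i u x + wd U i v x"
  by (rule wd_unique[OF weak_partial_add[OF wd_weak_partial[OF assms(1)] wd_weak_partial[OF assms(2)]]])

lemma wd_cmult:
  assumes "u \<in> H1 U"
  shows "AE x in lebesgue_on U. wd U i (\<lambda>x. a * u x) x = a * wd U i u x"
  by (rule wd_unique[OF weak_partial_cmult[OF wd_weak_partial[OF assms]]])

lemma wd_cong:
  assumes "u \<in> H1 U" "v \<in> H1 U" "ae_eq U u v"
  shows "AE x in lebesgue_on U. wd U i u x = wd U i v x"
  using weak_partial_unique[OF wd_weak_partial[OF assms(1)] wd_weak_partial[OF assms(2)]] assms(3)
  by (simp add: ae_eq_def)

lemma H1nrm_cong:
  assumes "u \<in> H1 U" "v \<in> H1 U" "ae_eq U u v"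
  shows "H1nrm U u = H1nrm U v"
proof -
  have "L2nrm (lebesgue_on U) (wd U i u) = L2nrm (lebesgue_on U) (wd U i v)" for i
    by (intro L2nrm_cong wd_cong wd_L2 assms)
  moreover have "L2nrm (lebesgue_on U) u = L2nrm (lebesgue_on U) v"
    using assms by (intro L2nrm_cong H1_L2) (auto simp: ae_eq_def)
  ultimately show ?thesis by (simp add: H1nrm_def)
qed

lemma H1nrm_cmult:
  assumes "u \<in> H1 U"
  shows "H1nrm U (\<lambda>x. a * u x) = cmod a * H1nrm U u"
proof -
  have "L2nrm (lebesgue_on U) (wd U i (\<lambda>x. a * u x)) = cmod a * L2nrm (lebesgue_on U) (wd U i u)" for i
    using L2nrm_cong[OF wd_L2[OF H1_cmult[OF assms]] L2_cmult[OF wd_L2[OF assms]] wd_cmult[OF assms]]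
    by (simp add: L2nrm_cmult)
  then have "(H1nrm U (\<lambda>x. a * u x))\<^sup>2 = (cmod a * H1nrm U u)\<^sup>2"
    unfolding power_mult_distrib H1nrm_square
    by (simp add: L2nrm_cmult power_mult_distrib distrib_left sum_distrib_left)
  then show ?thesis by (simp add: H1nrm_nonneg)
qed

lemma H1nrm_add_square_le:
  assumes "u \<in> H1 U" "v \<in> H1 U"
  shows "(H1nrm U (\<lambda>x. u x + v x))\<^sup>2 \<le> 2 * (H1nrm U u)\<^sup>2 + 2 * (H1nrm U v)\<^sup>2"
proof -
  have "(L2nrm (lebesgue_on U) (wd U i (\<lambda>x. u x + v x)))\<^sup>2
      \<le> 2 * (L2nrm (lebesgue_on U) (wd U i u))\<^sup>2 + 2 * (L2nrm (lebesgue_on U) (wd U i v))\<^sup>2" for i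
    unfolding L2nrm_cong[OF wd_L2[OF H1_add[OF assms]] L2_add[OF wd_L2[OF assms(1)] wd_L2[OF assms(2)]] wd_add[OF assms]]
    by (rule L2nrm_add_square_le[OF wd_L2[OF assms(1)] wd_L2[OF assms(2)]])
  then have "(\<Sum>i\<in>UNIV. (L2nrm (lebesgue_on U) (wd U i (\<lambda>x. u x + v x)))\<^sup>2)
      \<le> (\<Sum>i\<in>UNIV. 2 * (L2nrm (lebesgue_on U) (wd U i u))\<^sup>2 + 2 * (L2nrm (lebesgue_on U) (wd U i v))\<^sup>2)"
    by (intro sum_mono)
  then show ?thesis
    using L2nrm_add_square_le[OF H1_L2[OF assms(1)] H1_L2[OF assms(2)]]
    unfolding H1nrm_square by (simp add: sum.distrib sum_distrib_left)
qed

text \<open>Integration by parts: the product with a test function has compact support in \<open>U\<close>, so the integral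
of its derivative vanishes.\<close>

lemma C1_weak_partial:
  assumes f: "C_k 1 f"
  shows "weak_partial U i f (partial_deriv i f)"
  unfolding weak_partial_def
proof (intro conjI ballI)
  have fc: "continuous_on UNIV f" using C_k_continuous[OF f] .
  have Dc: "continuous_on UNIV (partial_deriv i f)" using f by simp
  show L2: "f \<in> L2 (lebesgue_on U)" "partial_deriv i f \<in> L2 (lebesgue_on U)"
    by (intro continuous_imp_L2 fc Dc)+
  fix \<phi> assume \<phi>: "\<phi> \<in> test_functions U"
  then obtain K where K: "compact K" "K \<subseteq> U" "\<And>x. x \<notin> K \<Longrightarrow> \<phi> x = 0"
    by (auto simp: test_functions_def)
  define \<psi> where "\<psi> x = complex_of_real (\<phi> x)" for x
  have d\<phi>: "(\<psi> has_derivative (\<lambda>v. of_real (frechet_derivative \<phi> (at x) v))) (at x)" for x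
    unfolding \<psi>_def
    by (rule has_derivative_of_real[OF has_derivative_partial[OF test_functionD(4)[OF \<phi>]]])
  have p\<psi>: "partial_deriv j \<psi> = (\<lambda>x. of_real (partial_deriv j \<phi> x))" for j
    by (rule ext) (simp add: partial_deriv_eqI[OF d\<phi>] partial_deriv_def[of j \<phi>])
  have \<psi>: "C_k 1 \<psi>"
    using test_functionD(3)[OF \<phi>] differentiableI[OF d\<phi>] by (simp add: p\<psi> continuous_on_of_real)
  have prod: "partial_deriv i (\<lambda>x. f x * \<psi> x) x = f x * of_real (partial_deriv i \<phi> x) + partial_deriv i f x * of_real (\<phi> x)" for x
    using f \<psi> by (subst partial_deriv_mult) (auto simp: p\<psi> \<psi>_def)
  have zero: "partial_deriv i (\<lambda>x. f x * \<psi> x) x = 0" if "x \<notin> K" for x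
  proof -
    have "open (- K)" using K(1) by (simp add: compact_imp_closed open_Compl)
    then have "((\<lambda>x. f x * \<psi> x) has_derivative (\<lambda>x. 0)) (at x)"
      by (rule has_derivative_transform_within_open[OF has_derivative_const[of 0]]) (use that K in \<open>auto simp: \<psi>_def\<close>)
    then show ?thesis by (simp add: partial_deriv_eqI)
  qed
  have C1: "C_k 1 (\<lambda>x. f x * \<psi> x)" by (rule C_k_mult[OF f \<psi>])
  have "(LINT x|lebesgue_on U. partial_deriv i (\<lambda>x. f x * \<psi> x) x)
      = (LINT x|lborel. indicator U x *\<^sub>R partial_deriv i (\<lambda>x. f x * \<psi> x) x)"
    using U C1 by (intro integral_lebesgue_on_eq_lborel borel_measurable_continuous_onI) auto
  also have "\<dots> = (LINT x|lborel. partial_deriv i (\<lambda>x. f x * \<psi> x) x)"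
  proof (rule arg_cong[of _ _ "integral\<^sup>L lborel"], rule ext)
    show "indicator U x *\<^sub>R partial_deriv i (\<lambda>x. f x * \<psi> x) x = partial_deriv i (\<lambda>x. f x * \<psi> x) x" for x
      using zero[of x] K(2) by (cases "x \<in> U") auto
  qed
  also have "\<dots> = 0"
    by (rule integral_partial_deriv_compact_support[OF C1 K(1)]) (simp add: K(3) \<psi>_def)
  finally have "(LINT x|lebesgue_on U. f x * of_real (partial_deriv i \<phi> x) + partial_deriv i f x * of_real (\<phi> x)) = 0"
    unfolding prod .
  moreover have "(LINT x|lebesgue_on U. f x * of_real (partial_deriv i \<phi> x) + partial_deriv i f x * of_real (\<phi> x))
    = (LINT x|lebesgue_on U. f x * of_real (partial_deriv i \<phi> x)) + (LINT x|lebesgue_on U. partial_deriv i f x * of_real (\<phi> x))"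
    by (intro Bochner_Integration.integral_add L2_mult_integrable L2 test_function_L2[OF \<phi>])
  ultimately show "(LINT x|lebesgue_on U. f x * of_real (partial_deriv i \<phi> x)) =
      - (LINT x|lebesgue_on U. partial_deriv i f x * of_real (\<phi> x))"
    by (simp add: add_eq_0_iff2)
qed

lemma C1_H1: "C_k 1 f \<Longrightarrow> f \<in> H1 U"
  using C1_weak_partial by (auto simp: H1_def weak_partial_def)

end

section \<open>The surface measure\<close>

lemma scale_measure_eq_density: "scale_measure (ennreal c) M = density M (\<lambda>_. ennreal c)"
  by (rule measure_eqI) (auto simp: emeasure_density_const)

lemma sets_sphere_measure [measurable_cong, simp]: "sets (sphere_measure R) = sets borel"
  by (simp add: sphere_measure_def)

lemma space_sphere_measure [simp]: "space (sphere_measure R) = UNIV"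
  by (simp add: sphere_measure_def space_scale_measure)

lemma radial_projection_measurable [measurable]:
  "(\<lambda>x::real^'n. (R / norm x) *\<^sub>R x) \<in> measurable (restrict_space lborel (ball 0 1)) borel"
  by (intro measurable_restrict_space1) measurable

lemma nn_integral_sphere_measure:
  fixes f :: "real^'n \<Rightarrow> ennreal"
  assumes [measurable]: "f \<in> borel_measurable borel"
  shows "(\<integral>\<^sup>+x. f x \<partial>sphere_measure R) = ennreal (real CARD('n) * R ^ (CARD('n) - 1))
      * (\<integral>\<^sup>+x. f ((R / norm x) *\<^sub>R x) * indicator (ball 0 1) x \<partial>lborel)"
  unfolding sphere_measure_def
  by (simp add: nn_integral_scale_measure nn_integral_distr nn_integral_restrict_space)

lemma AE_sphere_norm:
  assumes "R > 0"
  shows "AE x in (sphere_measure R :: (real^'n) measure). norm x = R"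
proof -
  have "AE x in lborel. x \<noteq> (0::real^'n)" by (rule AE_lborel_singleton)
  then have "AE x::real^'n in restrict_space lborel (ball 0 1). norm ((R / norm x) *\<^sub>R x) = R"
    using assms by (auto simp: AE_restrict_space_iff elim!: eventually_mono)
  then have "AE x in distr (restrict_space lborel (ball 0 1)) borel (\<lambda>x::real^'n. (R / norm x) *\<^sub>R x). norm x = R"
    by (subst AE_distr_iff) auto
  then show ?thesis
    unfolding sphere_measure_def scale_measure_eq_density by (subst AE_density) auto
qed

text \<open>Immediate from the cone definition, as \<open>(R / |x|) x\<close> is \<open>R\<close> times the projection to the unit sphere.\<close>

lemma sphere_measure_scale:
  assumes "R > 0"
  shows "(sphere_measure R :: (real^'n) measure) =
    density (distr (sphere_measure 1) borel (\<lambda>x. R *\<^sub>R x)) (\<lambda>_. ennreal (R ^ (CARD('n) - 1)))"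
    (is "?S = ?D")
proof (rule measure_eqI)
  fix A :: "(real^'n) set" assume "A \<in> sets ?S"
  then have [measurable]: "A \<in> sets borel" by simp
  have [measurable]: "(\<lambda>x. R *\<^sub>R x) -` A \<in> sets borel"
    using measurable_sets[of "\<lambda>x. R *\<^sub>R x" borel borel A] by simp
  have "emeasure ?S A = (\<integral>\<^sup>+x. indicator A x \<partial>?S)" by simp
  also have "\<dots> = ennreal (R ^ (CARD('n) - 1)) * (\<integral>\<^sup>+x. indicator ((\<lambda>x. R *\<^sub>R x) -` A) x \<partial>sphere_measure 1)"
  proof -
    have "indicator A ((R / norm x) *\<^sub>R x) = (indicator ((\<lambda>x. R *\<^sub>R x) -` A) ((1 / norm x) *\<^sub>R x) :: ennreal)" for x :: "real^'n"
      by (simp add: indicator_def)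
    then show ?thesis
      using assms by (simp add: nn_integral_sphere_measure ennreal_mult mult_ac del: nn_integral_indicator)
  qed
  also have "\<dots> = emeasure ?D A"
    by (simp add: emeasure_density_const emeasure_distr)
  finally show "emeasure ?S A = emeasure ?D A" .
qed simp

lemma finite_measure_sphere: "finite_measure (sphere_measure R :: (real^'n) measure)"
proof
  have "emeasure (sphere_measure R :: (real^'n) measure) UNIV = (\<integral>\<^sup>+x. 1 \<partial>(sphere_measure R :: (real^'n) measure))" by simp
  also have "\<dots> = ennreal (real CARD('n) * R ^ (CARD('n) - 1)) * emeasure lborel (ball (0::real^'n) 1)"
    by (subst nn_integral_sphere_measure) auto
  also have "\<dots> < \<infinity>"
    using emeasure_bounded_finite[OF bounded_ball, of "0::real^'n" 1]
    by (auto simp: ennreal_mult_less_top)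
  finally show "emeasure (sphere_measure R :: (real^'n) measure) (space (sphere_measure R)) \<noteq> \<infinity>" by simp
qed

lemma continuous_imp_L2_sphere:
  fixes f :: "real^'n \<Rightarrow> complex"
  assumes "R > 0" "continuous_on UNIV f"
  shows "f \<in> L2 (sphere_measure R)"
proof -
  have "compact (f ` sphere 0 R)"
    using assms by (intro compact_continuous_image) (auto intro: continuous_on_subset)
  from compact_imp_bounded[OF this] obtain B where B: "\<forall>y\<in>f ` sphere 0 R. cmod y \<le> B"
    unfolding bounded_iff ..
  show ?thesis
  proof (rule L2_bounded[OF finite_measure_sphere])
    show "f \<in> borel_measurable (sphere_measure R)"
      using borel_measurable_continuous_onI[OF assms(2)] by (simp cong: measurable_cong_sets)
    show "AE x in sphere_measure R. cmod (f x) \<le> B"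
      using AE_sphere_norm[OF assms(1)] by eventually_elim (use B in auto)
  qed
qed

section \<open>The trace inequality\<close>

lemma ball_in_borel [measurable]: "ball c r \<in> sets borel"
  by (rule borel_open[OF open_ball])

lemma nn_integral_lborel_scale:
  fixes f :: "real^'n \<Rightarrow> ennreal"
  assumes [measurable]: "f \<in> borel_measurable borel" and c: "c > 0"
  shows "ennreal (c ^ CARD('n)) * (\<integral>\<^sup>+x. f (c *\<^sub>R x) \<partial>lborel) = (\<integral>\<^sup>+x. f x \<partial>lborel)"
  using c
  by (subst (2) lborel_affine[of c 0])
     (auto simp: nn_integral_density nn_integral_distr nn_integral_cmult)

lemma frechet_derivative_partial_sum:
  fixes f :: "real^'n \<Rightarrow> complex"
  assumes "f differentiable (at x)"
  shows "frechet_derivative f (at x) v = (\<Sum>i\<in>UNIV. v $ i *\<^sub>R partial_deriv i f x)"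
proof -
  interpret linear "frechet_derivative f (at x)"
    using assms by (rule linear_frechet_derivative)
  have "v = (\<Sum>i\<in>UNIV. v $ i *\<^sub>R axis i 1)"
    using basis_expansion[of v] by (simp add: scalar_mult_eq_scaleR)
  then have "frechet_derivative f (at x) v = frechet_derivative f (at x) (\<Sum>i\<in>UNIV. v $ i *\<^sub>R axis i 1)" by simp
  then show ?thesis by (simp add: sum scale partial_deriv_def)
qed

text \<open>The Cauchy--Schwarz inequality, applied to the coordinates.\<close>

lemma directional_derivative_square_le:
  fixes f :: "real^'n \<Rightarrow> complex"
  assumes "f differentiable (at x)"
  shows "(cmod (frechet_derivative f (at x) v))\<^sup>2 \<le> (norm v)\<^sup>2 * (\<Sum>i\<in>UNIV. (cmod (partial_deriv i f x))\<^sup>2)"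
proof -
  have "cmod (frechet_derivative f (at x) v) \<le> (\<Sum>i\<in>UNIV. \<bar>v $ i\<bar> * \<bar>cmod (partial_deriv i f x)\<bar>)"
    unfolding frechet_derivative_partial_sum[OF assms] by (rule order_trans[OF norm_sum]) simp
  also have "\<dots> \<le> L2_set (\<lambda>i. v $ i) UNIV * L2_set (\<lambda>i. cmod (partial_deriv i f x)) UNIV"
    by (rule L2_set_mult_ineq)
  finally have "(cmod (frechet_derivative f (at x) v))\<^sup>2
      \<le> (L2_set (\<lambda>i. v $ i) UNIV * L2_set (\<lambda>i. cmod (partial_deriv i f x)) UNIV)\<^sup>2"
    by (intro power_mono) auto
  also have "\<dots> = (norm v)\<^sup>2 * (\<Sum>i\<in>UNIV. (cmod (partial_deriv i f x))\<^sup>2)"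
    by (simp add: power_mult_distrib L2_set_def norm_vec_def sum_nonneg)
  finally show ?thesis .
qed

text \<open>With \<open>p(\<tau>) = |f(R \<tau> x)|\<^sup>2\<close> one has \<open>p' \<le> |f|\<^sup>2 + |\<partial>f|\<^sup>2\<close>, where \<open>\<partial>f\<close> is the derivative in the direction
\<open>R x\<close>, so \<open>p' \<le> W\<close>. Integrating from \<open>\<tau> = 1\<close> to the sphere, that is to \<open>\<tau> = 1 / |x| \<le> 2\<close>,
gives the bound.\<close>

lemma radial_growth_bound:
  fixes f :: "real^'n \<Rightarrow> complex"
  assumes f: "C_k 1 f" and R: "R > 0" and x: "1/2 \<le> norm x" "norm x < 1"
  defines "W \<equiv> \<lambda>z. (cmod (f z))\<^sup>2 + R\<^sup>2 * (\<Sum>i\<in>UNIV. (cmod (partial_deriv i f z))\<^sup>2)"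
  shows "ennreal ((cmod (f ((R / norm x) *\<^sub>R x)))\<^sup>2) \<le> ennreal ((cmod (f (R *\<^sub>R x)))\<^sup>2)
    + (\<integral>\<^sup>+\<tau>. ennreal (W (R *\<^sub>R (\<tau> *\<^sub>R x))) * indicator (ball 0 1) (\<tau> *\<^sub>R x) * indicator {1..2} \<tau> \<partial>lborel)"
proof -
  define T where "T = 1 / norm x"
  have nx: "norm x > 0" using x by linarith
  then have T: "1 \<le> T" "T \<le> 2" using x by (auto simp: T_def field_simps)
  have fd: "f differentiable (at z)" for z using f by simp
  have cont: "continuous_on UNIV f" using C_k_continuous[OF f] .
  have contp: "continuous_on UNIV (partial_deriv i f)" for i using f by simp
  let ?I = "LINT \<tau>|lborel. W (R *\<^sub>R (\<tau> *\<^sub>R x)) * indicator {1..T} \<tau>"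
  define c c' where "c \<tau> = f (R *\<^sub>R (\<tau> *\<^sub>R x))"
    and "c' \<tau> = frechet_derivative f (at (R *\<^sub>R (\<tau> *\<^sub>R x))) (R *\<^sub>R x)" for \<tau>
  have "(c has_vector_derivative c' \<tau>) (at \<tau>)" for \<tau>
  proof -
    have "((\<lambda>\<tau>. R *\<^sub>R (\<tau> *\<^sub>R x)) has_derivative (\<lambda>s. s *\<^sub>R (R *\<^sub>R x))) (at \<tau>)"
      by (auto intro!: derivative_eq_intros)
    from has_derivative_compose[OF this has_derivative_partial[OF fd]]
    show ?thesis
      unfolding has_vector_derivative_def c_def c'_def
      using linear_scale[OF has_derivative_linear[OF has_derivative_partial[OF fd]]] by simp
  qed
  from bounded_bilinear.has_vector_derivative[OF bounded_bilinear_inner this this]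
  have deriv: "((\<lambda>\<tau>. (cmod (c \<tau>))\<^sup>2) has_real_derivative 2 * (c \<tau> \<bullet> c' \<tau>)) (at \<tau>)" for \<tau>
    by (simp add: has_real_derivative_iff_has_vector_derivative power2_norm_eq_inner inner_commute)
  have c'_cont: "continuous_on UNIV c'"
    unfolding c'_def frechet_derivative_partial_sum[OF fd]
    by (intro continuous_intros continuous_on_compose2[OF contp]) auto
  have c_cont: "continuous_on UNIV c"
    unfolding c_def by (intro continuous_intros continuous_on_compose2[OF cont]) auto
  have W_cont: "continuous_on UNIV (\<lambda>\<tau>. W (R *\<^sub>R (\<tau> *\<^sub>R x)))"
    unfolding W_def by (intro continuous_intros continuous_on_compose2[OF contp] continuous_on_compose2[OF cont]) auto
  have W0: "W z \<ge> 0" for z by (simp add: W_def sum_nonneg)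
  have int1: "integrable lborel (\<lambda>\<tau>. 2 * (c \<tau> \<bullet> c' \<tau>) * indicator {1..T} \<tau>)"
    using c_cont c'_cont by (intro borel_integrable_atLeastAtMost)
      (auto intro!: continuous_intros simp: continuous_on_eq_continuous_at)
  have int2: "integrable lborel (\<lambda>\<tau>. W (R *\<^sub>R (\<tau> *\<^sub>R x)) * indicator {1..T} \<tau>)"
    using W_cont by (intro borel_integrable_atLeastAtMost) (auto simp: continuous_on_eq_continuous_at)
  have "(cmod (c T))\<^sup>2 - (cmod (c 1))\<^sup>2 = (LINT \<tau>|lborel. 2 * (c \<tau> \<bullet> c' \<tau>) * indicator {1..T} \<tau>)"
    using c_cont c'_cont T(1) deriv
    by (intro integral_FTC_Icc_real[symmetric])
       (auto intro!: continuous_intros simp: continuous_on_eq_continuous_at)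
  also have "\<dots> \<le> ?I"
  proof (rule integral_mono[OF int1 int2])
    fix \<tau>
    have "2 * (c \<tau> \<bullet> c' \<tau>) \<le> 2 * (cmod (c \<tau>) * cmod (c' \<tau>))"
      using norm_cauchy_schwarz[of "c \<tau>" "c' \<tau>"] by simp
    also have "\<dots> \<le> (cmod (c \<tau>))\<^sup>2 + (cmod (c' \<tau>))\<^sup>2"
      using zero_le_power2[of "cmod (c \<tau>) - cmod (c' \<tau>)"] by (simp add: power2_diff)
    also have "(cmod (c' \<tau>))\<^sup>2 \<le> (norm (R *\<^sub>R x))\<^sup>2 * (\<Sum>i\<in>UNIV. (cmod (partial_deriv i f (R *\<^sub>R (\<tau> *\<^sub>R x))))\<^sup>2)"
      unfolding c'_def by (rule directional_derivative_square_le[OF fd])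
    also have "\<dots> \<le> R\<^sup>2 * (\<Sum>i\<in>UNIV. (cmod (partial_deriv i f (R *\<^sub>R (\<tau> *\<^sub>R x))))\<^sup>2)"
    proof (intro mult_right_mono power_mono)
      show "norm (R *\<^sub>R x) \<le> R" using R x by simp
    qed (auto simp: sum_nonneg)
    finally have "2 * (c \<tau> \<bullet> c' \<tau>) \<le> W (R *\<^sub>R (\<tau> *\<^sub>R x))" by (simp add: W_def c_def)
    then show "2 * (c \<tau> \<bullet> c' \<tau>) * indicator {1..T} \<tau> \<le> W (R *\<^sub>R (\<tau> *\<^sub>R x)) * indicator {1..T} \<tau>"
      by (intro mult_right_mono) auto
  qed
  finally have "(cmod (c T))\<^sup>2 \<le> (cmod (c 1))\<^sup>2 + ?I" by simp
  then have A: "ennreal ((cmod (c T))\<^sup>2) \<le> ennreal ((cmod (c 1))\<^sup>2 + ?I)"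
    by (rule ennreal_leI)
  have B: "ennreal ((cmod (c 1))\<^sup>2 + ?I)
      = ennreal ((cmod (c 1))\<^sup>2) + ennreal ?I"
    by (intro ennreal_plus integral_nonneg) (auto simp: W0)
  have C: "ennreal ?I
      = (\<integral>\<^sup>+\<tau>. ennreal (W (R *\<^sub>R (\<tau> *\<^sub>R x)) * indicator {1..T} \<tau>) \<partial>lborel)"
    by (intro nn_integral_eq_integral[symmetric] int2) (auto simp: W0)
  have D: "(\<integral>\<^sup>+\<tau>. ennreal (W (R *\<^sub>R (\<tau> *\<^sub>R x)) * indicator {1..T} \<tau>) \<partial>lborel)
      \<le> (\<integral>\<^sup>+\<tau>. ennreal (W (R *\<^sub>R (\<tau> *\<^sub>R x))) * indicator (ball 0 1) (\<tau> *\<^sub>R x) * indicator {1..2} \<tau> \<partial>lborel)"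
  proof (rule nn_integral_mono_AE)
    show "AE \<tau> in lborel. ennreal (W (R *\<^sub>R (\<tau> *\<^sub>R x)) * indicator {1..T} \<tau>)
        \<le> ennreal (W (R *\<^sub>R (\<tau> *\<^sub>R x))) * indicator (ball 0 1) (\<tau> *\<^sub>R x) * indicator {1..2} \<tau>"
      \<comment> \<open>at \<open>\<tau> = T\<close> the ray leaves the open ball, but a single point is a null set\<close>
      using AE_lborel_singleton[of T]
    proof eventually_elim
      fix \<tau> assume "\<tau> \<noteq> T"
      show "ennreal (W (R *\<^sub>R (\<tau> *\<^sub>R x)) * indicator {1..T} \<tau>)
        \<le> ennreal (W (R *\<^sub>R (\<tau> *\<^sub>R x))) * indicator (ball 0 1) (\<tau> *\<^sub>R x) * indicator {1..2} \<tau>"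
      proof (cases "\<tau> \<in> {1..T}")
        case True
        then have "\<tau> < 1 / norm x" using \<open>\<tau> \<noteq> T\<close> by (simp add: T_def)
        then have "\<tau> * norm x < 1" using nx by (simp only: pos_less_divide_eq)
        then have "norm (\<tau> *\<^sub>R x) < 1" using True by simp
        then show ?thesis using True T by simp
      qed simp
    qed
  qed
  have "c T = f ((R / norm x) *\<^sub>R x)" "c 1 = f (R *\<^sub>R x)" by (simp_all add: c_def T_def)
  then show ?thesis using order_trans[OF A[unfolded B C] add_left_mono[OF D]] by (simp only:)
qed

text \<open>By homogeneity the half ball carries the fraction \<open>2\<^sup>-\<^sup>d \<le> 1/2\<close> of the integral over the ball, so the
annulus carries at least half. This confines the radial estimate to points away from the origin.\<close>

lemma nn_integral_half_ball_homogeneous: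
  fixes F :: "real^'n \<Rightarrow> ennreal"
  assumes [measurable]: "F \<in> borel_measurable borel"
    and hom: "\<And>c x. c > 0 \<Longrightarrow> F (c *\<^sub>R x) = F x"
    and fin: "(\<integral>\<^sup>+x. F x * indicator (ball 0 1) x \<partial>lborel) < \<infinity>"
  shows "(\<integral>\<^sup>+x. F x * indicator (ball 0 1) x \<partial>lborel)
    \<le> 2 * (\<integral>\<^sup>+x. F x * indicator (ball 0 1 - ball 0 (1/2)) x \<partial>lborel)"
proof -
  let ?I = "\<integral>\<^sup>+x. F x * indicator (ball 0 1) x \<partial>lborel"
  let ?H = "\<integral>\<^sup>+x. F x * indicator (ball 0 (1/2)) x \<partial>lborel"
  let ?A = "\<integral>\<^sup>+x. F x * indicator (ball 0 1 - ball 0 (1/2)) x \<partial>lborel"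
  have "?H = ennreal ((1/2) ^ CARD('n)) * (\<integral>\<^sup>+x. F ((1/2) *\<^sub>R x) * indicator (ball 0 (1/2)) ((1/2) *\<^sub>R x) \<partial>lborel)"
    by (rule nn_integral_lborel_scale[symmetric]) auto
  also have "(\<lambda>x. F ((1/2) *\<^sub>R x) * indicator (ball 0 (1/2)) ((1/2) *\<^sub>R x)) = (\<lambda>x. F x * indicator (ball 0 1) x)"
    using hom[of "1/2"] by (auto simp: fun_eq_iff split: split_indicator)
  finally have H: "?H = ennreal ((1/2) ^ CARD('n)) * ?I" .
  have "ennreal ((1/2) ^ CARD('n)) * ?I \<le> ennreal (1/2) * ?I"
    using power_decreasing[of 1 "CARD('n)" "1/2::real"]
    by (intro mult_right_mono ennreal_leI) (auto simp: Suc_le_eq)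
  then have H': "?H \<le> ennreal (1/2) * ?I" using H by simp
  have "?I = (\<integral>\<^sup>+x. F x * indicator (ball 0 (1/2)) x + F x * indicator (ball 0 1 - ball 0 (1/2)) x \<partial>lborel)"
    by (intro nn_integral_cong) (auto split: split_indicator)
  also have "\<dots> = ?H + ?A" by (rule nn_integral_add) measurable
  finally have I: "?I = ?H + ?A" .
  obtain i where i: "?I = ennreal i" "i \<ge> 0" using fin by (cases ?I) auto
  have "?A \<le> ?I" unfolding I by simp
  then have "?A < \<infinity>" using fin by (rule le_less_trans)
  then obtain a where a: "?A = ennreal a" "a \<ge> 0" by (cases ?A) auto
  have "ennreal i \<le> ennreal (1/2) * ennreal i + ennreal a"
    using I H' unfolding i a by (metis add_right_mono)
  then have "i \<le> 1/2 * i + a"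
  proof -
    assume "ennreal i \<le> ennreal (1/2) * ennreal i + ennreal a"
    moreover have "ennreal (1/2) * ennreal i + ennreal a = ennreal (1/2 * i + a)"
      using i(2) a(2) ennreal_mult[of "1/2" i] ennreal_plus[of "1/2 * i" a] by simp
    moreover have "0 \<le> 1/2 * i + a" using i(2) a(2) by simp
    ultimately show ?thesis by (simp only: ennreal_le_iff)
  qed
  then have "ennreal i \<le> ennreal (2 * a)" by (intro ennreal_leI) simp
  then show ?thesis using i a by (simp add: ennreal_mult)
qed

text \<open>By Tonelli's theorem the dilations can be integrated over \<open>x\<close> first, and each of them contracts the
integral by \<open>\<tau>\<^sup>-\<^sup>d \<le> 1\<close>.\<close>

lemma nn_integral_dilations_le:
  fixes G :: "real^'n \<Rightarrow> ennreal"
  assumes [measurable]: "G \<in> borel_measurable borel"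
  shows "(\<integral>\<^sup>+x. (\<integral>\<^sup>+\<tau>. G (\<tau> *\<^sub>R x) * indicator {1..2} \<tau> \<partial>lborel) \<partial>lborel) \<le> (\<integral>\<^sup>+x. G x \<partial>lborel)"
proof -
  let ?J = "\<integral>\<^sup>+x. G x \<partial>lborel"
  have "(\<integral>\<^sup>+x. (\<integral>\<^sup>+\<tau>. G (\<tau> *\<^sub>R x) * indicator {1..2} \<tau> \<partial>lborel) \<partial>lborel)
      = (\<integral>\<^sup>+\<tau>. (\<integral>\<^sup>+x. G (\<tau> *\<^sub>R x) * indicator {1..2} \<tau> \<partial>lborel) \<partial>lborel)"
    by (rule lborel_pair.Fubini') measurable
  also have "\<dots> \<le> (\<integral>\<^sup>+\<tau>. ?J * indicator {1..2} \<tau> \<partial>(lborel :: real measure))"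
  proof (rule nn_integral_mono)
    fix \<tau> :: real
    show "(\<integral>\<^sup>+x. G (\<tau> *\<^sub>R x) * indicator {1..2} \<tau> \<partial>lborel) \<le> ?J * indicator {1..2} \<tau>"
    proof (cases "\<tau> \<in> {1..2}")
      case True
      have "(\<integral>\<^sup>+x. G (\<tau> *\<^sub>R x) \<partial>lborel) = 1 * (\<integral>\<^sup>+x. G (\<tau> *\<^sub>R x) \<partial>lborel)" by simp
      also have "\<dots> \<le> ennreal (\<tau> ^ CARD('n)) * (\<integral>\<^sup>+x. G (\<tau> *\<^sub>R x) \<partial>lborel)"
        using True by (intro mult_right_mono) (auto simp flip: ennreal_1 intro!: ennreal_leI one_le_power)
      also have "\<dots> = ?J" using True by (intro nn_integral_lborel_scale) auto
      finally show ?thesis using True by simp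
    qed simp
  qed
  also have "\<dots> = ?J * emeasure lborel {1..2::real}"
    by (simp add: nn_integral_cmult)
  also have "\<dots> = ?J" by simp
  finally show ?thesis .
qed

lemma nn_integral_ball_C1:
  fixes f :: "real^'n \<Rightarrow> complex"
  assumes "continuous_on UNIV f" "R > 0"
  shows "(\<integral>\<^sup>+x. ennreal ((cmod (f x))\<^sup>2) * indicator (ball 0 R) x \<partial>lborel) = ennreal ((L2nrm (lebesgue_on (ball 0 R)) f)\<^sup>2)"
proof -
  have [measurable]: "f \<in> borel_measurable borel" using assms(1) by (rule borel_measurable_continuous_onI)
  have "f \<in> L2 (lebesgue_on (ball 0 R))" using assms(1) by (intro continuous_imp_L2) auto
  then have "integrable (lebesgue_on (ball 0 R)) (\<lambda>x. (cmod (f x))\<^sup>2)" by (rule L2D)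
  then have "ennreal (LINT x|lebesgue_on (ball 0 R). (cmod (f x))\<^sup>2) = (\<integral>\<^sup>+x. ennreal ((cmod (f x))\<^sup>2) \<partial>lebesgue_on (ball 0 R))"
    by (intro nn_integral_eq_integral[symmetric]) auto
  also have "\<dots> = (\<integral>\<^sup>+x. ennreal ((cmod (f x))\<^sup>2) * indicator (ball 0 R) x \<partial>lebesgue)"
    by (simp add: nn_integral_restrict_space)
  also have "\<dots> = (\<integral>\<^sup>+x. ennreal ((cmod (f x))\<^sup>2) * indicator (ball 0 R) x \<partial>lborel)"
    by (rule nn_integral_completion)
  finally show ?thesis by (simp add: L2nrm_square)
qed

text \<open>The surface integral is an integral over the unit ball of a function that is constant along rays.
It is reduced to the annulus \<open>1/2 \<le> |x| < 1\<close>, bounded pointwise there by the radial growth bound, and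
the integral over the rays and the annulus is a volume integral by Tonelli's theorem.\<close>

lemma trace_inequality_C1:
  fixes f :: "real^'n \<Rightarrow> complex"
  assumes f: "C_k 1 f" and R: "R > 0"
  shows "(L2nrm (sphere_measure R) f)\<^sup>2 \<le> 4 * real CARD('n) * (1 + R\<^sup>2) / R * (H1nrm (ball 0 R) f)\<^sup>2"
proof -
  define d where "d = CARD('n)"
  have d: "d > 0" by (simp add: d_def)
  have U: "open (ball (0::real^'n) R)" "bounded (ball (0::real^'n) R)" by auto
  have cont: "continuous_on UNIV f" using C_k_continuous[OF f] .
  have contp: "continuous_on UNIV (partial_deriv i f)" for i using f by simp
  have [measurable]: "f \<in> borel_measurable borel" "partial_deriv i f \<in> borel_measurable borel" for i
    using cont contp by (auto intro: borel_measurable_continuous_onI)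
  define W where "W z = (cmod (f z))\<^sup>2 + R\<^sup>2 * (\<Sum>i\<in>UNIV. (cmod (partial_deriv i f z))\<^sup>2)" for z
  have [measurable]: "W \<in> borel_measurable borel" unfolding W_def by measurable
  have W0: "W z \<ge> 0" for z by (simp add: W_def sum_nonneg)
  let ?J = "\<integral>\<^sup>+x. ennreal (W (R *\<^sub>R x)) * indicator (ball 0 1) x \<partial>lborel"
  let ?X = "\<lambda>x. \<integral>\<^sup>+\<tau>. ennreal (W (R *\<^sub>R (\<tau> *\<^sub>R x))) * indicator (ball 0 1) (\<tau> *\<^sub>R x) * indicator {1..2} \<tau> \<partial>lborel"
  define F where "F x = ennreal ((cmod (f ((R / norm x) *\<^sub>R x)))\<^sup>2)" for x
  have [measurable]: "F \<in> borel_measurable borel" unfolding F_def by measurable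
  define I where "I = (\<integral>\<^sup>+x. F x * indicator (ball 0 1) x \<partial>lborel)"
  define H where "H = (H1nrm (ball 0 R) f)\<^sup>2"
  define V where "V = (\<integral>\<^sup>+x. ennreal (W x) * indicator (ball 0 R) x \<partial>lborel)"
  have Lf: "f \<in> L2 (sphere_measure R)" by (rule continuous_imp_L2_sphere[OF R cont])
  have L: "ennreal ((L2nrm (sphere_measure R) f)\<^sup>2) = ennreal (d * R ^ (d - 1)) * I"
  proof -
    have "ennreal ((L2nrm (sphere_measure R) f)\<^sup>2) = (\<integral>\<^sup>+x. ennreal ((cmod (f x))\<^sup>2) \<partial>sphere_measure R)"
      unfolding L2nrm_square using L2D(2)[OF Lf] by (intro nn_integral_eq_integral[symmetric]) auto
    then show ?thesis unfolding I_def F_def d_def by (simp add: nn_integral_sphere_measure)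
  qed
  have "ennreal (d * R ^ (d - 1)) * I < \<infinity>" unfolding L[symmetric] by simp
  then have Ifin: "I < \<infinity>"
  proof -
    have "0 < real d * R ^ (d - 1)" using d R by simp
    then have "ennreal (real d * R ^ (d - 1)) \<noteq> 0" by (simp only: ennreal_eq_0_iff not_le not_False_eq_True)
    moreover assume "ennreal (d * R ^ (d - 1)) * I < \<infinity>"
    ultimately show ?thesis unfolding infinity_ennreal_def ennreal_mult_less_top by auto
  qed
  have RdV: "ennreal (R ^ d) * ?J = V"
  proof -
    have "(\<lambda>x. ennreal (W (R *\<^sub>R x)) * indicator (ball 0 1) x) = (\<lambda>x. ennreal (W (R *\<^sub>R x)) * indicator (ball 0 R) (R *\<^sub>R x))"
      using R by (auto simp: fun_eq_iff split: split_indicator)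
    then show ?thesis unfolding V_def d_def using R
      by (simp only:) (rule nn_integral_lborel_scale, measurable)
  qed
  have "I \<le> 2 * (\<integral>\<^sup>+x. F x * indicator (ball 0 1 - ball 0 (1/2)) x \<partial>lborel)"
    unfolding I_def
  proof (rule nn_integral_half_ball_homogeneous)
    show "F (c *\<^sub>R x) = F x" if "c > 0" for c x using that by (simp add: F_def)
  qed (use Ifin in \<open>auto simp: I_def\<close>)
  also have "(\<integral>\<^sup>+x. F x * indicator (ball 0 1 - ball 0 (1/2)) x \<partial>lborel)
      \<le> (\<integral>\<^sup>+x. ennreal (W (R *\<^sub>R x)) * indicator (ball 0 1) x
        + ?X x \<partial>lborel)"
  proof (rule nn_integral_mono)
    fix x :: "real^'n"
    show "F x * indicator (ball 0 1 - ball 0 (1/2)) x \<le> ennreal (W (R *\<^sub>R x)) * indicator (ball 0 1) x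
        + ?X x"
    proof (cases "x \<in> ball 0 1 - ball 0 (1/2)")
      case True
      then have x: "1/2 \<le> norm x" "norm x < 1" by auto
      have "F x \<le> ennreal ((cmod (f (R *\<^sub>R x)))\<^sup>2) + ?X x"
        unfolding F_def W_def by (rule radial_growth_bound[OF f R x])
      also have "\<dots> \<le> ennreal (W (R *\<^sub>R x)) + ?X x"
        by (intro add_right_mono ennreal_leI) (simp add: W_def sum_nonneg)
      finally have "F x \<le> ennreal (W (R *\<^sub>R x)) + ?X x" .
      moreover have "indicator (ball 0 1 - ball 0 (1/2)) x = (1::ennreal)" "indicator (ball 0 1) x = (1::ennreal)"
        using True by (simp_all add: indicator_def)
      ultimately show ?thesis by (simp only: mult_1_right)
    qed simp
  qed
  also have "\<dots> = ?J
        + (\<integral>\<^sup>+x. ?X x \<partial>lborel)"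
    by (rule nn_integral_add) measurable
  also have "\<dots> \<le> ?J
      + ?J"
    by (intro add_left_mono nn_integral_dilations_le[of "\<lambda>x. ennreal (W (R *\<^sub>R x)) * indicator (ball 0 1) x"]) measurable
  finally have "I \<le> 4 * ?J"
    by (simp add: mult_2[symmetric] mult.assoc[symmetric] mult_left_mono)
  then have "ennreal R * (ennreal (d * R ^ (d - 1)) * I)
     \<le> ennreal R * (ennreal (d * R ^ (d - 1)) * (4 * ?J))"
    by (intro mult_left_mono) auto
  also have "\<dots> = ennreal (4 * d) * (ennreal (R ^ d) * ?J)"
  proof -
    have "ennreal (R ^ d) = ennreal R * ennreal (R ^ (d - 1))"
      using d R by (cases d) (auto simp: ennreal_mult)
    then show ?thesis using R by (simp add: ennreal_mult mult_ac)
  qed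
  also have "\<dots> = ennreal (4 * d) * V" unfolding RdV ..
  also have "V \<le> ennreal ((1 + R\<^sup>2) * H)"
  proof -
    define p where "p i = (L2nrm (lebesgue_on (ball 0 R)) (partial_deriv i f))\<^sup>2" for i
    define q where "q = (L2nrm (lebesgue_on (ball 0 R)) f)\<^sup>2"
    have "L2nrm (lebesgue_on (ball 0 R)) (wd (ball 0 R) i f) = L2nrm (lebesgue_on (ball 0 R)) (partial_deriv i f)" for i
      by (intro L2nrm_cong wd_unique wd_L2 C1_H1 C1_weak_partial continuous_imp_L2 U f contp)
    then have Hpq: "H = (\<Sum>i\<in>UNIV. p i) + q"
      unfolding H_def H1nrm_square p_def q_def by simp
    have "V = (\<integral>\<^sup>+x. ennreal ((cmod (f x))\<^sup>2) * indicator (ball 0 R) x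
        + ennreal (R\<^sup>2) * (\<Sum>i\<in>UNIV. ennreal ((cmod (partial_deriv i f x))\<^sup>2) * indicator (ball 0 R) x) \<partial>lborel)"
      unfolding V_def W_def
      by (intro nn_integral_cong) (auto simp: ennreal_plus ennreal_mult sum_ennreal sum_nonneg split: split_indicator)
    also have "\<dots> = ennreal q + ennreal (R\<^sup>2) * (\<Sum>i\<in>UNIV. ennreal (p i))"
    proof -
      let ?g = "\<lambda>i x. ennreal ((cmod (partial_deriv i f x))\<^sup>2) * indicator (ball 0 R) x"
      have "(\<integral>\<^sup>+x. ennreal ((cmod (f x))\<^sup>2) * indicator (ball 0 R) x + ennreal (R\<^sup>2) * (\<Sum>i\<in>UNIV. ?g i x) \<partial>lborel)
          = (\<integral>\<^sup>+x. ennreal ((cmod (f x))\<^sup>2) * indicator (ball 0 R) x \<partial>lborel)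
            + (\<integral>\<^sup>+x. ennreal (R\<^sup>2) * (\<Sum>i\<in>UNIV. ?g i x) \<partial>lborel)"
        by (rule nn_integral_add) measurable
      also have "(\<integral>\<^sup>+x. ennreal (R\<^sup>2) * (\<Sum>i\<in>UNIV. ?g i x) \<partial>lborel) = ennreal (R\<^sup>2) * (\<integral>\<^sup>+x. (\<Sum>i\<in>UNIV. ?g i x) \<partial>lborel)"
        by (rule nn_integral_cmult) measurable
      also have "(\<integral>\<^sup>+x. (\<Sum>i\<in>UNIV. ?g i x) \<partial>lborel) = (\<Sum>i\<in>UNIV. (\<integral>\<^sup>+x. ?g i x \<partial>lborel))"
        by (rule nn_integral_sum) measurable
      finally show ?thesis
        unfolding nn_integral_ball_C1[OF cont R] nn_integral_ball_C1[OF contp R] p_def q_def .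
    qed
    also have "\<dots> = ennreal (q + R\<^sup>2 * (\<Sum>i\<in>UNIV. p i))"
      by (simp add: sum_ennreal sum_nonneg ennreal_plus ennreal_mult p_def q_def)
    also have "\<dots> \<le> ennreal ((1 + R\<^sup>2) * H)"
    proof (rule ennreal_leI)
      have "0 \<le> (\<Sum>i\<in>UNIV. p i)" "0 \<le> R\<^sup>2 * q" by (simp_all add: p_def q_def sum_nonneg)
      then show "q + R\<^sup>2 * (\<Sum>i\<in>UNIV. p i) \<le> (1 + R\<^sup>2) * H" unfolding Hpq by (simp add: algebra_simps)
    qed
    finally show ?thesis .
  qed
  finally have "ennreal R * ennreal ((L2nrm (sphere_measure R) f)\<^sup>2) \<le> ennreal (4 * d) * ennreal ((1 + R\<^sup>2) * H)"
    unfolding L[symmetric] by (simp add: mult_left_mono)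
  then have "R * (L2nrm (sphere_measure R) f)\<^sup>2 \<le> 4 * d * ((1 + R\<^sup>2) * H)"
    using R by (simp add: ennreal_mult[symmetric] H_def)
  then show ?thesis using R by (simp add: H_def d_def field_simps)
qed

section \<open>Uniqueness of traces\<close>

lemma tendsto_0_if_square_tendsto_0:
  fixes X :: "nat \<Rightarrow> real"
  assumes "(\<lambda>k. (X k)\<^sup>2) \<longlonglongrightarrow> 0"
  shows "X \<longlonglongrightarrow> 0"
  using tendsto_real_sqrt[OF assms] by (simp add: tendsto_rabs_zero_iff)

lemma square_dominated_tendsto_0:
  fixes X Y Z :: "nat \<Rightarrow> real"
  assumes "\<And>k. (X k)\<^sup>2 \<le> 2 * (Y k)\<^sup>2 + 2 * (Z k)\<^sup>2" "Y \<longlonglongrightarrow> 0" "Z \<longlonglongrightarrow> 0"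
  shows "X \<longlonglongrightarrow> 0"
proof -
  have "(\<lambda>k. 2 * (Y k)\<^sup>2 + 2 * (Z k)\<^sup>2) \<longlonglongrightarrow> 2 * 0\<^sup>2 + 2 * 0\<^sup>2"
    by (intro tendsto_intros assms)
  then have "(\<lambda>k. (X k)\<^sup>2) \<longlonglongrightarrow> 0"
    by (intro tendsto_sandwich[of "\<lambda>k. 0" "\<lambda>k. (X k)\<^sup>2" _ "\<lambda>k. 2 * (Y k)\<^sup>2 + 2 * (Z k)\<^sup>2"])
       (use assms(1) in auto)
  then show ?thesis by (rule tendsto_0_if_square_tendsto_0)
qed

context
  fixes R :: real
  assumes R: "R > 0"
begin

lemma ball_domain: "open (ball (0::real^'n) R)" "bounded (ball (0::real^'n) R)"
  by auto

lemma is_trace_C1: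
  assumes "C_k 1 f"
  shows "is_trace R f f"
proof -
  have "H1nrm (ball 0 R) (\<lambda>x. f x - f x) = 0"
    using H1nrm_cmult[OF ball_domain C1_H1[OF ball_domain C_k_const[of 1 0]], of 0] by simp
  moreover have "L2nrm (sphere_measure R) (\<lambda>x. f x - f x) = 0"
    by (simp add: L2nrm_def)
  ultimately show ?thesis
    unfolding is_trace_def using assms continuous_imp_L2_sphere[OF R C_k_continuous[OF assms]]
    by (auto intro!: exI[of _ "\<lambda>k. f"])
qed

lemma is_trace_add:
  assumes u: "u \<in> H1 (ball 0 R)" "is_trace R u g" and v: "v \<in> H1 (ball 0 R)" "is_trace R v h"
  shows "is_trace R (\<lambda>x. u x + v x) (\<lambda>x. g x + h x)"
proof -
  obtain \<phi> where \<phi>: "\<And>k::nat. C_k 1 (\<phi> k)" "(\<lambda>k. H1nrm (ball 0 R) (\<lambda>x. \<phi> k x - u x)) \<longlonglongrightarrow> 0"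
    "(\<lambda>k. L2nrm (sphere_measure R) (\<lambda>x. \<phi> k x - g x)) \<longlonglongrightarrow> 0" and g: "g \<in> L2 (sphere_measure R)"
    using u(2) unfolding is_trace_def by blast
  obtain \<psi> where \<psi>: "\<And>k::nat. C_k 1 (\<psi> k)" "(\<lambda>k. H1nrm (ball 0 R) (\<lambda>x. \<psi> k x - v x)) \<longlonglongrightarrow> 0"
    "(\<lambda>k. L2nrm (sphere_measure R) (\<lambda>x. \<psi> k x - h x)) \<longlonglongrightarrow> 0" and h: "h \<in> L2 (sphere_measure R)"
    using v(2) unfolding is_trace_def by blast
  note C = C1_H1[OF ball_domain \<phi>(1)] C1_H1[OF ball_domain \<psi>(1)]
  note S = continuous_imp_L2_sphere[OF R C_k_continuous[OF \<phi>(1)]] continuous_imp_L2_sphere[OF R C_k_continuous[OF \<psi>(1)]]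
  show ?thesis
    unfolding is_trace_def
  proof (intro conjI exI[of _ "\<lambda>k x. \<phi> k x + \<psi> k x"] allI)
    show "(\<lambda>x. g x + h x) \<in> L2 (sphere_measure R)" by (rule L2_add[OF g h])
    show "C_k 1 (\<lambda>x. \<phi> k x + \<psi> k x)" for k by (rule C_k_add[OF \<phi>(1) \<psi>(1)])
    show "(\<lambda>k. H1nrm (ball 0 R) (\<lambda>x. \<phi> k x + \<psi> k x - (u x + v x))) \<longlonglongrightarrow> 0"
    proof (rule square_dominated_tendsto_0[OF _ \<phi>(2) \<psi>(2)])
      show "(H1nrm (ball 0 R) (\<lambda>x. \<phi> k x + \<psi> k x - (u x + v x)))\<^sup>2
          \<le> 2 * (H1nrm (ball 0 R) (\<lambda>x. \<phi> k x - u x))\<^sup>2 + 2 * (H1nrm (ball 0 R) (\<lambda>x. \<psi> k x - v x))\<^sup>2" for k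
        using H1nrm_add_square_le[OF ball_domain H1_diff[OF ball_domain C(1) u(1)] H1_diff[OF ball_domain C(2) v(1)], of k k]
        by (simp add: algebra_simps)
    qed
    show "(\<lambda>k. L2nrm (sphere_measure R) (\<lambda>x. \<phi> k x + \<psi> k x - (g x + h x))) \<longlonglongrightarrow> 0"
    proof (rule square_dominated_tendsto_0[OF _ \<phi>(3) \<psi>(3)])
      show "(L2nrm (sphere_measure R) (\<lambda>x. \<phi> k x + \<psi> k x - (g x + h x)))\<^sup>2
          \<le> 2 * (L2nrm (sphere_measure R) (\<lambda>x. \<phi> k x - g x))\<^sup>2 + 2 * (L2nrm (sphere_measure R) (\<lambda>x. \<psi> k x - h x))\<^sup>2" for k
        using L2nrm_add_square_le[OF L2_diff[OF S(1) g] L2_diff[OF S(2) h], of k k]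
        by (simp add: algebra_simps)
    qed
  qed
qed

lemma is_trace_cmult:
  assumes u: "u \<in> H1 (ball 0 R)" "is_trace R u g"
  shows "is_trace R (\<lambda>x. a * u x) (\<lambda>x. a * g x)"
proof -
  obtain \<phi> where \<phi>: "\<And>k::nat. C_k 1 (\<phi> k)" "(\<lambda>k. H1nrm (ball 0 R) (\<lambda>x. \<phi> k x - u x)) \<longlonglongrightarrow> 0"
    "(\<lambda>k. L2nrm (sphere_measure R) (\<lambda>x. \<phi> k x - g x)) \<longlonglongrightarrow> 0" and g: "g \<in> L2 (sphere_measure R)"
    using u(2) unfolding is_trace_def by blast
  have "H1nrm (ball 0 R) (\<lambda>x. a * \<phi> k x - a * u x) = cmod a * H1nrm (ball 0 R) (\<lambda>x. \<phi> k x - u x)" for k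
    using H1nrm_cmult[OF ball_domain H1_diff[OF ball_domain C1_H1[OF ball_domain \<phi>(1)] u(1)], of a k]
    by (simp add: right_diff_distrib)
  moreover have "L2nrm (sphere_measure R) (\<lambda>x. a * \<phi> k x - a * g x) = cmod a * L2nrm (sphere_measure R) (\<lambda>x. \<phi> k x - g x)" for k
    using L2nrm_cmult[of "sphere_measure R" a "\<lambda>x. \<phi> k x - g x"] by (simp add: right_diff_distrib)
  moreover have "C_k 1 (\<lambda>x. a * \<phi> k x)" for k by (rule C_k_mult[OF C_k_const \<phi>(1)])
  ultimately show ?thesis
    unfolding is_trace_def using \<phi>(2,3) g
    by (intro conjI L2_cmult exI[of _ "\<lambda>k x. a * \<phi> k x"]) (auto intro!: tendsto_mult_right_zero)
qed

lemma is_trace_cong: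
  assumes u: "u \<in> H1 (ball 0 R)" "is_trace R u g" and v: "v \<in> H1 (ball 0 R)" "ae_eq (ball 0 R) u v"
  shows "is_trace R v g"
proof -
  have "H1nrm (ball 0 R) (\<lambda>x. f x - u x) = H1nrm (ball 0 R) (\<lambda>x. f x - v x)" if "C_k 1 f" for f
  proof (intro H1nrm_cong[OF ball_domain] H1_diff[OF ball_domain] C1_H1[OF ball_domain that] u(1) v(1))
    show "ae_eq (ball 0 R) (\<lambda>x. f x - u x) (\<lambda>x. f x - v x)"
      using v(2) unfolding ae_eq_def by eventually_elim simp
  qed
  then show ?thesis using u(2) unfolding is_trace_def by (auto simp del: C_k.simps)
qed

text \<open>The approximating functions tend to zero in \<open>H1\<close>, hence by the trace inequality also on the sphere.\<close>

lemma is_trace_zero_imp: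
  assumes "is_trace R (\<lambda>x. 0) g"
  shows "AE x in sphere_measure R. g x = 0"
proof -
  obtain \<phi> where \<phi>: "\<And>k::nat. C_k 1 (\<phi> k)" "(\<lambda>k. H1nrm (ball 0 R) (\<phi> k)) \<longlonglongrightarrow> 0"
    "(\<lambda>k. L2nrm (sphere_measure R) (\<lambda>x. \<phi> k x - g x)) \<longlonglongrightarrow> 0" and g: "g \<in> L2 (sphere_measure R)"
    using assms unfolding is_trace_def by auto
  note S = continuous_imp_L2_sphere[OF R C_k_continuous[OF \<phi>(1)]]
  define C where "C = 4 * real CARD('a) * (1 + R\<^sup>2) / R"
  have "(\<lambda>k. C * (H1nrm (ball 0 R) (\<phi> k))\<^sup>2) \<longlonglongrightarrow> C * 0\<^sup>2"
    by (intro tendsto_intros \<phi>)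
  then have "(\<lambda>k. (L2nrm (sphere_measure R) (\<phi> k))\<^sup>2) \<longlonglongrightarrow> 0"
    by (intro tendsto_sandwich[of "\<lambda>k. 0" "\<lambda>k. (L2nrm (sphere_measure R) (\<phi> k))\<^sup>2" _ "\<lambda>k. C * (H1nrm (ball 0 R) (\<phi> k))\<^sup>2"])
       (use trace_inequality_C1[OF \<phi>(1) R] in \<open>auto simp: C_def\<close>)
  then have \<phi>0: "(\<lambda>k. L2nrm (sphere_measure R) (\<phi> k)) \<longlonglongrightarrow> 0" by (rule tendsto_0_if_square_tendsto_0)
  have "(L2nrm (sphere_measure R) g)\<^sup>2 \<le> 2 * (L2nrm (sphere_measure R) (\<lambda>x. \<phi> k x - g x))\<^sup>2 + 2 * (L2nrm (sphere_measure R) (\<phi> k))\<^sup>2" for k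
    using L2nrm_add_square_le[OF L2_diff[OF S g] L2_cmult[OF S], of k "-1" k]
      L2nrm_cmult[of "sphere_measure R" "-1" g] L2nrm_cmult[of "sphere_measure R" "-1" "\<phi> k"] by simp
  from square_dominated_tendsto_0[OF this \<phi>(3) \<phi>0] have "L2nrm (sphere_measure R) g = 0"
    by (simp add: LIMSEQ_const_iff)
  then show ?thesis using L2nrm_eq_0_iff[OF g] by simp
qed

lemma is_trace_unique:
  assumes u: "u \<in> H1 (ball 0 R)" "is_trace R u g" "is_trace R u h"
  shows "AE x in sphere_measure R. g x = h x"
proof -
  have "is_trace R (\<lambda>x. u x + (- 1) * u x) (\<lambda>x. g x + (- 1) * h x)"
    by (intro is_trace_add is_trace_cmult H1_cmult[OF ball_domain] u)
  then have "AE x in sphere_measure R. g x + (- 1) * h x = 0" by (intro is_trace_zero_imp) simp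
  then show ?thesis by eventually_elim simp
qed

end

section \<open>The volume part of the sesquilinear form\<close>

definition helmholtz_form :: "real \<Rightarrow> (real^'n) set \<Rightarrow> (real^'n \<Rightarrow> complex) \<Rightarrow> (real^'n \<Rightarrow> complex) \<Rightarrow> complex" where
  "helmholtz_form \<kappa> U w v = (\<Sum>i\<in>UNIV. ip (lebesgue_on U) (wd U i w) (wd U i v))
     - of_real (\<kappa>\<^sup>2) * ip (lebesgue_on U) w v"

lemma helmholtz_form_commute: "helmholtz_form \<kappa> U u w = cnj (helmholtz_form \<kappa> U w u)"
  unfolding helmholtz_form_def complex_cnj_diff complex_cnj_mult cnj_sum
  by (subst ip_commute, subst (2) ip_commute) simp

context
  fixes U :: "(real^'n) set" and \<kappa> :: real
  assumes U: "open U" "bounded U"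
begin

lemma helmholtz_form_add_left:
  assumes "u \<in> H1 U" "v \<in> H1 U" "w \<in> H1 U"
  shows "helmholtz_form \<kappa> U (\<lambda>x. u x + v x) w = helmholtz_form \<kappa> U u w + helmholtz_form \<kappa> U v w"
proof -
  note L = wd_L2[OF U]
  have "ip (lebesgue_on U) (wd U i (\<lambda>x. u x + v x)) (wd U i w)
      = ip (lebesgue_on U) (wd U i u) (wd U i w) + ip (lebesgue_on U) (wd U i v) (wd U i w)" for i
    using ip_cong[OF L[OF H1_add[OF U assms(1,2)]] L2_add[OF L[OF assms(1)] L[OF assms(2)]] L[OF assms(3)] L[OF assms(3)] wd_add[OF U assms(1,2)]]
      ip_add_left[OF L[OF assms(1)] L[OF assms(2)] L[OF assms(3)]] by simp
  moreover have "ip (lebesgue_on U) (\<lambda>x. u x + v x) w = ip (lebesgue_on U) u w + ip (lebesgue_on U) v w"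
    using assms H1_L2[OF U] by (intro ip_add_left) auto
  ultimately show ?thesis by (simp add: helmholtz_form_def sum.distrib algebra_simps)
qed

lemma helmholtz_form_cmult_left:
  assumes "u \<in> H1 U" "w \<in> H1 U"
  shows "helmholtz_form \<kappa> U (\<lambda>x. a * u x) w = a * helmholtz_form \<kappa> U u w"
proof -
  note L = wd_L2[OF U]
  have "ip (lebesgue_on U) (wd U i (\<lambda>x. a * u x)) (wd U i w) = a * ip (lebesgue_on U) (wd U i u) (wd U i w)" for i
    using ip_cong[OF L[OF H1_cmult[OF U assms(1)]] L2_cmult[OF L[OF assms(1)]] L[OF assms(2)] L[OF assms(2)] wd_cmult[OF U assms(1)]]
    by (simp add: ip_cmult_left)
  then show ?thesis by (simp add: helmholtz_form_def ip_cmult_left sum_distrib_left algebra_simps)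
qed

lemma helmholtz_form_add_right:
  assumes "u \<in> H1 U" "v \<in> H1 U" "w \<in> H1 U"
  shows "helmholtz_form \<kappa> U w (\<lambda>x. u x + v x) = helmholtz_form \<kappa> U w u + helmholtz_form \<kappa> U w v"
  by (subst (1 2 3) helmholtz_form_commute) (simp add: helmholtz_form_add_left assms)

lemma helmholtz_form_cmult_right:
  assumes "u \<in> H1 U" "w \<in> H1 U"
  shows "helmholtz_form \<kappa> U w (\<lambda>x. a * u x) = cnj a * helmholtz_form \<kappa> U w u"
  by (subst (1 2) helmholtz_form_commute) (simp add: helmholtz_form_cmult_left assms)

lemma helmholtz_form_cong:
  assumes "u \<in> H1 U" "u' \<in> H1 U" "v \<in> H1 U" "v' \<in> H1 U" "ae_eq U u u'" "ae_eq U v v'"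
  shows "helmholtz_form \<kappa> U u v = helmholtz_form \<kappa> U u' v'"
proof -
  have "ip (lebesgue_on U) (wd U i u) (wd U i v) = ip (lebesgue_on U) (wd U i u') (wd U i v')" for i
    by (intro ip_cong wd_L2[OF U] wd_cong[OF U] assms)
  moreover have "ip (lebesgue_on U) u v = ip (lebesgue_on U) u' v'"
    using assms by (intro ip_cong H1_L2[OF U]) (auto simp: ae_eq_def)
  ultimately show ?thesis by (simp add: helmholtz_form_def)
qed

lemma helmholtz_form_self:
  "helmholtz_form \<kappa> U u u = of_real ((H1nrm U u)\<^sup>2 - (1 + \<kappa>\<^sup>2) * (L2nrm (lebesgue_on U) u)\<^sup>2)"
  by (simp add: helmholtz_form_def ip_self H1nrm_square algebra_simps)

end

section \<open>The truncated DtN form in Fourier modes\<close>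

text \<open>Expresses the phase by powers of \<open>sgn z\<close>, which are visibly measurable.\<close>

lemma cis_int_times_Arg:
  "cis (of_int n * Arg z) = (if z = 0 then 1 else if n \<ge> 0 then sgn z ^ nat n else inverse (sgn z) ^ nat (- n))"
proof (cases "z = 0")
  case False
  have "cis (of_int n * Arg z) = cis (Arg z) powi n" by (simp add: cis_power_int)
  then show ?thesis using False by (simp add: cis_Arg power_int_def)
qed (simp add: Arg_zero)

lemma measurable_azimuthal_phase:
  "(\<lambda>x::real^'n. cis (of_int n * Arg (Complex (x $ i) (x $ j)))) \<in> borel_measurable borel"
proof -
  have [measurable]: "(\<lambda>x::real^'n. Complex (x $ i) (x $ j)) \<in> borel_measurable borel"
    unfolding Complex_eq by (intro borel_measurable_continuous_onI continuous_intros)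
  show ?thesis unfolding cis_int_times_Arg sgn_div_norm by measurable
qed

lemma L2_times_phase:
  assumes "f \<in> L2 M" "g \<in> borel_measurable M" "\<And>x. cmod (g x) = 1"
  shows "(\<lambda>x. f x * g x) \<in> L2 M"
  using assms by (auto simp: L2_def norm_mult intro: borel_measurable_times)

lemma circ_harmonic_L2: "circ_harmonic c n \<in> L2 (sphere_measure 1 :: (real^'n) measure)"
proof -
  have "(\<lambda>x. complex_of_real (1 / sqrt (2 * pi)) * cis (of_int n * Arg (Complex (x $ c 1) (x $ c 2))))
      \<in> L2 (sphere_measure 1 :: (real^'n) measure)"
    by (rule L2_times_phase[OF continuous_imp_L2_sphere])
       (auto intro: measurable_azimuthal_phase cong: measurable_cong_sets)
  then show ?thesis by (simp add: circ_harmonic_def[abs_def])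
qed

lemma sph_harmonic_L2: "sph_harmonic c n m \<in> L2 (sphere_measure 1 :: (real^'n) measure)"
proof -
  have "continuous_on UNIV (\<lambda>x::real^'n. complex_of_real (a * assoc_legendre n k (x $ c 3)))" for a k
    unfolding assoc_legendre_def by (intro continuous_intros)
  then have "(\<lambda>x. complex_of_real (a * assoc_legendre n k (x $ c 3)) * cis (of_int m * Arg (Complex (x $ c 1) (x $ c 2))))
      \<in> L2 (sphere_measure 1 :: (real^'n) measure)" for a k
    by (intro L2_times_phase[OF continuous_imp_L2_sphere])
       (auto intro: measurable_azimuthal_phase cong: measurable_cong_sets)
  then show ?thesis by (simp add: sph_harmonic_def[abs_def] Let_def)
qed

text \<open>Circular harmonics are indexed by pairs \<open>(0, n)\<close> and spherical harmonics by pairs \<open>(n, m)\<close>, so that both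
dimensions share one form; in both, \<open>(0, 0)\<close> is the constant mode.\<close>

lemma dtn_mode_expansion:
  fixes c :: "nat \<Rightarrow> 'n::finite"
  assumes d: "CARD('n) \<in> {2, 3}" and pos: "\<kappa> > 0" "R > 0"
  obtains K :: "(nat \<times> int) set" and \<zeta> :: "nat \<times> int \<Rightarrow> complex" and Y :: "nat \<times> int \<Rightarrow> real^'n \<Rightarrow> complex" and y :: complex
  where "finite K" "\<And>k. k \<in> K \<Longrightarrow> Im (\<zeta> k) > 0"
    "\<And>k. k \<in> K \<Longrightarrow> Y k \<in> L2 (sphere_measure 1)"
    "(0, 0) \<in> K" "Y (0, 0) = (\<lambda>x. y)" "y \<noteq> 0"
    "\<And>u x. dtn c \<kappa> R N u x = of_real (1 / R) *
       (\<Sum>k\<in>K. \<zeta> k * fourier_coeff R u (Y k) * Y k (x /\<^sub>R R))"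
proof (cases "CARD('n) = 2")
  case True
  show thesis
  proof (rule that[of "{0} \<times> {- int N..int N}" "\<lambda>(j, n). Z_coeff n (\<kappa> * R)" "\<lambda>(j, n). circ_harmonic c n" "1 / of_real (sqrt (2 * pi))"])
    show "dtn c \<kappa> R N u x = of_real (1 / R) * (\<Sum>k\<in>{0} \<times> {- int N..int N}. (case k of (j, n) \<Rightarrow> Z_coeff n (\<kappa> * R)) *
         fourier_coeff R u (case k of (j, n) \<Rightarrow> circ_harmonic c n) * (case k of (j, n) \<Rightarrow> circ_harmonic c n) (x /\<^sub>R R))" for u x
      using True unfolding dtn_def
      by simp (intro disjI2 sum.reindex_bij_witness[of _ snd "\<lambda>n. (0, n)"], auto)
    show "(case (0, 0) of (j, n) \<Rightarrow> circ_harmonic c n) = (\<lambda>x. 1 / of_real (sqrt (2 * pi)))"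
      by (simp add: circ_harmonic_def fun_eq_iff)
  qed (use pos in \<open>auto simp: circ_harmonic_L2 Im_Z_coeff_pos\<close>)
next
  case False
  then have d3: "CARD('n) = 3" using d by simp
  show thesis
  proof (rule that[of "SIGMA n:{..N}. {- int n..int n}" "\<lambda>(n, m). z_coeff n (\<kappa> * R)" "\<lambda>(n, m). sph_harmonic c n m" "of_real (sqrt (1 / (4 * pi)))"])
    show "dtn c \<kappa> R N u x = of_real (1 / R) * (\<Sum>k\<in>(SIGMA n:{..N}. {- int n..int n}). (case k of (n, m) \<Rightarrow> z_coeff n (\<kappa> * R)) *
         fourier_coeff R u (case k of (n, m) \<Rightarrow> sph_harmonic c n m) * (case k of (n, m) \<Rightarrow> sph_harmonic c n m) (x /\<^sub>R R))" for u x
      using d3 by (simp add: dtn_def sum.Sigma split_beta)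
    show "(case (0, 0) of (n, m) \<Rightarrow> sph_harmonic c n m) = (\<lambda>x. of_real (sqrt (1 / (4 * pi))))"
      by (simp add: sph_harmonic_def[abs_def] fun_eq_iff assoc_legendre_def legendre_def)
  qed (use pos in \<open>auto simp: sph_harmonic_L2 Im_z_coeff_pos\<close>)
qed

lemma integral_sphere_rescale:
  fixes F :: "real^'n \<Rightarrow> complex"
  assumes R: "R > 0" and [measurable]: "F \<in> borel_measurable borel"
  shows "(LINT x|sphere_measure R. F x) = of_real (R ^ (CARD('n) - 1)) * (LINT x|sphere_measure 1. F (R *\<^sub>R x))"
proof -
  have "(LINT x|sphere_measure R. F x) = (LINT x|distr (sphere_measure 1) borel (\<lambda>x. R *\<^sub>R x). R ^ (CARD('n) - 1) *\<^sub>R F x)"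
    unfolding sphere_measure_scale[OF R] using R by (subst integral_density) auto
  also have "\<dots> = (LINT x|sphere_measure 1. R ^ (CARD('n) - 1) *\<^sub>R F (R *\<^sub>R x))"
    by (rule integral_distr) measurable
  finally show ?thesis by (simp add: scaleR_conv_of_real)
qed

lemma integrable_sphere_rescale:
  fixes F :: "real^'n \<Rightarrow> real"
  assumes R: "R > 0" and [measurable]: "F \<in> borel_measurable borel"
  shows "integrable (sphere_measure R) F \<longleftrightarrow> integrable (sphere_measure 1) (\<lambda>x. F (R *\<^sub>R x))"
proof -
  have "integrable (sphere_measure R) F \<longleftrightarrow> integrable (distr (sphere_measure 1) borel (\<lambda>x. R *\<^sub>R x)) (\<lambda>x. R ^ (CARD('n) - 1) *\<^sub>R F x)"
    unfolding sphere_measure_scale[OF R] using R by (subst integrable_density) auto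
  also have "\<dots> \<longleftrightarrow> integrable (sphere_measure 1) (\<lambda>x. R ^ (CARD('n) - 1) *\<^sub>R F (R *\<^sub>R x))"
    by (rule integrable_distr_eq) measurable
  finally show ?thesis using R by simp
qed

lemma L2_sphere_rescale:
  fixes Y :: "real^'n \<Rightarrow> complex"
  assumes R: "R > 0" and Y: "Y \<in> L2 (sphere_measure 1)"
  shows "(\<lambda>x. Y (x /\<^sub>R R)) \<in> L2 (sphere_measure R)"
proof -
  have [measurable]: "Y \<in> borel_measurable borel" using L2D(1)[OF Y] by (simp cong: measurable_cong_sets)
  have "integrable (sphere_measure R) (\<lambda>x. (cmod (Y (x /\<^sub>R R)))\<^sup>2)"
    using L2D(2)[OF Y] R by (subst integrable_sphere_rescale) auto
  then show ?thesis by (simp add: L2_def cong: measurable_cong_sets)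
qed

text \<open>Turns Fourier coefficients into inner products on the sphere of radius \<open>R\<close>, where traces live, so
that their linearity and their invariance under null sets come from the inner product.\<close>

lemma fourier_coeff_eq_ip:
  fixes Y :: "real^'n \<Rightarrow> complex"
  assumes R: "R > 0" and Y: "Y \<in> L2 (sphere_measure 1)" and g: "g \<in> L2 (sphere_measure R)"
  shows "of_real (R ^ (CARD('n) - 1)) * fourier_coeff R g Y = ip (sphere_measure R) g (\<lambda>x. Y (x /\<^sub>R R))"
proof -
  have [measurable]: "Y \<in> borel_measurable borel" "g \<in> borel_measurable borel"
    using L2D(1)[OF Y] L2D(1)[OF g] by (simp_all cong: measurable_cong_sets)
  show ?thesis
    unfolding fourier_coeff_def ip_def using R by (subst integral_sphere_rescale) auto
qed

lemma ip_sum_left: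
  assumes "finite K" "\<And>k. k \<in> K \<Longrightarrow> f k \<in> L2 M" "g \<in> L2 M"
  shows "ip M (\<lambda>x. \<Sum>k\<in>K. f k x) g = (\<Sum>k\<in>K. ip M (f k) g)"
  unfolding ip_def sum_distrib_right using assms by (intro Bochner_Integration.integral_sum ip_integrable)

lemma dtn_form_modes:
  fixes Y :: "'k \<Rightarrow> real^'n \<Rightarrow> complex"
  assumes R: "R > 0" and K: "finite K" "\<And>k. k \<in> K \<Longrightarrow> Y k \<in> L2 (sphere_measure 1)"
    and dtn: "\<And>x. T x = of_real (1 / R) * (\<Sum>k\<in>K. \<zeta> k * fourier_coeff R g (Y k) * Y k (x /\<^sub>R R))"
    and h: "h \<in> L2 (sphere_measure R)"
  shows "ip (sphere_measure R) T h = of_real (R ^ (CARD('n) - 1) / R) *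
    (\<Sum>k\<in>K. \<zeta> k * (fourier_coeff R g (Y k) * cnj (fourier_coeff R h (Y k))))"
proof -
  have L2: "(\<lambda>x. Y k (x /\<^sub>R R)) \<in> L2 (sphere_measure R)" if "k \<in> K" for k
    by (rule L2_sphere_rescale[OF R K(2)[OF that]])
  have "ip (sphere_measure R) T h = of_real (1 / R) *
      ip (sphere_measure R) (\<lambda>x. \<Sum>k\<in>K. (\<zeta> k * fourier_coeff R g (Y k)) * Y k (x /\<^sub>R R)) h"
    unfolding dtn[abs_def] by (rule ip_cmult_left)
  also have "ip (sphere_measure R) (\<lambda>x. \<Sum>k\<in>K. (\<zeta> k * fourier_coeff R g (Y k)) * Y k (x /\<^sub>R R)) h
      = (\<Sum>k\<in>K. ip (sphere_measure R) (\<lambda>x. (\<zeta> k * fourier_coeff R g (Y k)) * Y k (x /\<^sub>R R)) h)"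
    by (intro ip_sum_left K(1) L2_cmult L2 h)
  also have "\<dots> = (\<Sum>k\<in>K. of_real (R ^ (CARD('n) - 1)) * (\<zeta> k * (fourier_coeff R g (Y k) * cnj (fourier_coeff R h (Y k)))))"
  proof (rule sum.cong)
    fix k assume k: "k \<in> K"
    have "ip (sphere_measure R) (\<lambda>x. Y k (x /\<^sub>R R)) h = cnj (ip (sphere_measure R) h (\<lambda>x. Y k (x /\<^sub>R R)))"
      by (rule ip_commute)
    also have "\<dots> = of_real (R ^ (CARD('n) - 1)) * cnj (fourier_coeff R h (Y k))"
      unfolding fourier_coeff_eq_ip[OF R K(2)[OF k] h, symmetric] by simp
    finally show "ip (sphere_measure R) (\<lambda>x. (\<zeta> k * fourier_coeff R g (Y k)) * Y k (x /\<^sub>R R)) h =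
        of_real (R ^ (CARD('n) - 1)) * (\<zeta> k * (fourier_coeff R g (Y k) * cnj (fourier_coeff R h (Y k))))"
      unfolding ip_cmult_left by (simp add: mult_ac)
  qed simp
  finally show ?thesis by (simp add: sum_distrib_left mult_ac)
qed

lemma a_form_split: "a_form c \<kappa> R N w v = helmholtz_form \<kappa> (ball 0 R) w v
    - ip (sphere_measure R) (dtn c \<kappa> R N (sphere_trace R w)) (sphere_trace R v)"
  by (simp add: a_form_def helmholtz_form_def)

lemma sphere_trace_is_trace: "is_trace R u g \<Longrightarrow> is_trace R u (sphere_trace R u)"
  unfolding sphere_trace_def by (rule someI[of "is_trace R u"])

text \<open>The only facts on the DtN operator that the rest of the proof uses: its form is diagonal in finitely
many linear modes, its symbols lie in the open upper half plane, and one of its modes detects constants.\<close>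

lemma boundary_form_modes:
  fixes c :: "nat \<Rightarrow> 'n::finite"
  assumes dim: "CARD('n) \<in> {2, 3}" and pos: "\<kappa> > 0" "R > 0"
  obtains K :: "(nat \<times> int) set" and \<zeta> \<rho> and m :: "nat \<times> int \<Rightarrow> (real^'n \<Rightarrow> complex) \<Rightarrow> complex"
  where "finite K" "\<rho> > 0" "\<And>k. k \<in> K \<Longrightarrow> Im (\<zeta> k) > 0"
    "\<And>g h. h \<in> L2 (sphere_measure R) \<Longrightarrow> ip (sphere_measure R) (dtn c \<kappa> R N g) h
        = of_real \<rho> * (\<Sum>k\<in>K. \<zeta> k * (m k g * cnj (m k h)))"
    "\<And>k g h. k \<in> K \<Longrightarrow> g \<in> L2 (sphere_measure R) \<Longrightarrow> h \<in> L2 (sphere_measure R) \<Longrightarrow> m k (\<lambda>x. g x + h x) = m k g + m k h"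
    "\<And>k a g. k \<in> K \<Longrightarrow> g \<in> L2 (sphere_measure R) \<Longrightarrow> m k (\<lambda>x. a * g x) = a * m k g"
    "\<And>k g h. k \<in> K \<Longrightarrow> g \<in> L2 (sphere_measure R) \<Longrightarrow> h \<in> L2 (sphere_measure R) \<Longrightarrow>
       (AE x in sphere_measure R. g x = h x) \<Longrightarrow> m k g = m k h"
    "\<exists>k\<in>K. m k (\<lambda>x. 1) \<noteq> 0"
proof -
  obtain K :: "(nat \<times> int) set" and \<zeta> and Y :: "nat \<times> int \<Rightarrow> real^'n \<Rightarrow> complex" and y
    where K: "finite K" "\<And>k. k \<in> K \<Longrightarrow> Im (\<zeta> k) > 0" "\<And>k. k \<in> K \<Longrightarrow> Y k \<in> L2 (sphere_measure 1)"
    and Y0: "(0, 0) \<in> K" "Y (0, 0) = (\<lambda>x. y)" "y \<noteq> 0"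
    and dtn: "\<And>u x. dtn c \<kappa> R N u x = of_real (1 / R) *
       (\<Sum>k\<in>K. \<zeta> k * fourier_coeff R u (Y k) * Y k (x /\<^sub>R R))"
    using dtn_mode_expansion[OF dim pos, of c N] by blast
  define q where "q = complex_of_real (R ^ (CARD('n) - 1))"
  have q: "q \<noteq> 0" using pos by (simp add: q_def)
  note fc = fourier_coeff_eq_ip[OF pos(2) K(3), folded q_def]
  note YR = L2_sphere_rescale[OF pos(2) K(3)]
  show thesis
  proof (rule that[of K "R ^ (CARD('n) - 1) / R" \<zeta> "\<lambda>k g. fourier_coeff R g (Y k)"])
    show "finite K" "R ^ (CARD('n) - 1) / R > 0" using K pos by auto
    show "Im (\<zeta> k) > 0" if "k \<in> K" for k using K that by auto
    show "ip (sphere_measure R) (dtn c \<kappa> R N g) h = of_real (R ^ (CARD('n) - 1) / R) *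
        (\<Sum>k\<in>K. \<zeta> k * (fourier_coeff R g (Y k) * cnj (fourier_coeff R h (Y k))))"
      if "h \<in> L2 (sphere_measure R)" for g h
      by (rule dtn_form_modes[OF pos(2) K(1,3) dtn that])
    show "fourier_coeff R (\<lambda>x. g x + h x) (Y k) = fourier_coeff R g (Y k) + fourier_coeff R h (Y k)"
      if k: "k \<in> K" and g: "g \<in> L2 (sphere_measure R)" and h: "h \<in> L2 (sphere_measure R)" for k g h
    proof -
      have "q * fourier_coeff R (\<lambda>x. g x + h x) (Y k) = q * fourier_coeff R g (Y k) + q * fourier_coeff R h (Y k)"
        unfolding fc[OF k g] fc[OF k h] fc[OF k L2_add[OF g h]] by (rule ip_add_left[OF g h YR[OF k]])
      then show ?thesis using q by (simp flip: distrib_left)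
    qed
    show "fourier_coeff R (\<lambda>x. a * g x) (Y k) = a * fourier_coeff R g (Y k)"
      if k: "k \<in> K" and g: "g \<in> L2 (sphere_measure R)" for k a g
    proof -
      have "q * fourier_coeff R (\<lambda>x. a * g x) (Y k) = a * (q * fourier_coeff R g (Y k))"
        unfolding fc[OF k g] fc[OF k L2_cmult[OF g]] by (rule ip_cmult_left)
      then show ?thesis using q by (simp add: mult_ac)
    qed
    show "fourier_coeff R g (Y k) = fourier_coeff R h (Y k)"
      if k: "k \<in> K" and g: "g \<in> L2 (sphere_measure R)" and h: "h \<in> L2 (sphere_measure R)"
        and gh: "AE x in sphere_measure R. g x = h x" for k g h
    proof -
      have "q * fourier_coeff R g (Y k) = q * fourier_coeff R h (Y k)"
        unfolding fc[OF k g] fc[OF k h] by (rule ip_cong[OF g h YR[OF k] YR[OF k] gh]) simp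
      then show ?thesis using q by simp
    qed
    have "fourier_coeff R (\<lambda>x. 1) (Y (0, 0)) = cnj y * of_real (measure (sphere_measure 1 :: (real^'n) measure) UNIV)"
      unfolding Y0 fourier_coeff_def ip_def by (simp add: scaleR_conv_of_real mult.commute)
    moreover have "measure (sphere_measure 1 :: (real^'n) measure) UNIV \<noteq> 0"
    proof -
      have "emeasure (sphere_measure 1 :: (real^'n) measure) UNIV = (\<integral>\<^sup>+x. 1 \<partial>(sphere_measure 1 :: (real^'n) measure))" by simp
      also have "\<dots> = ennreal (real CARD('n)) * emeasure lborel (ball (0::real^'n) 1)"
        by (subst nn_integral_sphere_measure) auto
      also have "\<dots> \<noteq> 0" using open_not_negligible[of "ball (0::real^'n) 1"]
        by (simp add: negligible_iff_emeasure0)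
      finally show ?thesis
        using finite_measure.emeasure_eq_measure[OF finite_measure_sphere[of 1], of "UNIV :: (real^'n) set"] by auto
    qed
    ultimately show "\<exists>k\<in>K. fourier_coeff R (\<lambda>x. 1) (Y k) \<noteq> 0" using Y0 by (intro bexI[of _ "(0, 0)"]) auto
  qed
qed

section \<open>Finite linear systems\<close>

text \<open>Gaussian elimination: a pivot in the column of the new equation eliminates one unknown and one
equation.\<close>

lemma underdetermined_system:
  fixes M :: "'i \<Rightarrow> 'j \<Rightarrow> 'a::field"
  assumes "finite J" "finite I" "card J < card I"
  shows "\<exists>x. (\<exists>i\<in>I. x i \<noteq> 0) \<and> (\<forall>j\<in>J. (\<Sum>i\<in>I. x i * M i j) = 0)"
  using assms
proof (induction J arbitrary: I M rule: finite_induct)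
  case empty
  then have "I \<noteq> {}" by auto
  then show ?case by (intro exI[of _ "\<lambda>i. 1"]) auto
next
  case (insert j J)
  show ?case
  proof (cases "\<forall>i\<in>I. M i j = 0")
    case True
    have "card J < card I" using insert by simp
    from insert.IH[OF insert.prems(1) this] obtain x where
      "\<exists>i\<in>I. x i \<noteq> 0" "\<forall>k\<in>J. (\<Sum>i\<in>I. x i * M i k) = 0" by blast
    then show ?thesis using True by (intro exI[of _ x]) auto
  next
    case False
    then obtain p where p: "p \<in> I" "M p j \<noteq> 0" by blast
    let ?I = "I - {p}"
    have "card J < card ?I" using insert p by simp
    then obtain x where x: "\<exists>i\<in>?I. x i \<noteq> 0"
      "\<And>k. k \<in> J \<Longrightarrow> (\<Sum>i\<in>?I. x i * (M i k - M i j / M p j * M p k)) = 0"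
      using insert.IH[of ?I "\<lambda>i k. M i k - M i j / M p j * M p k"] insert.prems by auto
    define y where "y = x(p := - (\<Sum>i\<in>?I. x i * M i j) / M p j)"
    have sum: "(\<Sum>i\<in>I. y i * M i k) = - (\<Sum>i\<in>?I. x i * M i j) / M p j * M p k + (\<Sum>i\<in>?I. x i * M i k)" for k
    proof -
      have "(\<Sum>i\<in>I. y i * M i k) = y p * M p k + (\<Sum>i\<in>?I. y i * M i k)"
        using p insert.prems by (simp add: sum.remove)
      also have "(\<Sum>i\<in>?I. y i * M i k) = (\<Sum>i\<in>?I. x i * M i k)"
        by (intro sum.cong) (auto simp: y_def)
      finally show ?thesis by (simp add: y_def)
    qed
    have "(\<Sum>i\<in>I. y i * M i k) = 0" if "k \<in> J" for k
    proof -
      have "(\<Sum>i\<in>?I. x i * (M i k - M i j / M p j * M p k))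
          = (\<Sum>i\<in>?I. x i * M i k) - (\<Sum>i\<in>?I. x i * M i j) / M p j * M p k"
        by (simp add: right_diff_distrib sum_subtractf sum_distrib_left sum_distrib_right sum_divide_distrib mult_ac)
      then show ?thesis using x(2)[OF that] by (simp add: sum)
    qed
    moreover have "(\<Sum>i\<in>I. y i * M i j) = 0" using p by (simp add: sum)
    moreover have "\<exists>i\<in>I. y i \<noteq> 0" using x(1) by (auto simp: y_def)
    ultimately show ?thesis by blast
  qed
qed

text \<open>Existence from uniqueness: with a basis \<open>b\<^sub>0, \<dots>, b\<^sub>m\<^sub>-\<^sub>1\<close>, the \<open>m\<close> equations
\<open>\<Sum>\<^sub>i x\<^sub>i A(b\<^sub>i, b\<^sub>j) + x\<^sub>m l(b\<^sub>j) = 0\<close> in \<open>m + 1\<close> unknowns have a nontrivial solution, in which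
\<open>x\<^sub>m \<noteq> 0\<close> because \<open>A\<close> is nondegenerate.\<close>

lemma galerkin_unique_solvable:
  fixes S :: "(real^'n \<Rightarrow> complex) set" and A :: "(real^'n \<Rightarrow> complex) \<Rightarrow> (real^'n \<Rightarrow> complex) \<Rightarrow> complex"
  assumes S: "H1_subspace U S" "has_dim U S m"
    and add_left: "\<And>u v w. u \<in> S \<Longrightarrow> v \<in> S \<Longrightarrow> w \<in> S \<Longrightarrow> A (\<lambda>x. u x + v x) w = A u w + A v w"
    and cmult_left: "\<And>a u w. u \<in> S \<Longrightarrow> w \<in> S \<Longrightarrow> A (\<lambda>x. a * u x) w = a * A u w"
    and add_right: "\<And>u v w. u \<in> S \<Longrightarrow> v \<in> S \<Longrightarrow> w \<in> S \<Longrightarrow> A w (\<lambda>x. u x + v x) = A w u + A w v"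
    and cmult_right: "\<And>a u w. u \<in> S \<Longrightarrow> w \<in> S \<Longrightarrow> A w (\<lambda>x. a * u x) = cnj a * A w u"
    and cong_right: "\<And>u v w. u \<in> S \<Longrightarrow> v \<in> S \<Longrightarrow> w \<in> S \<Longrightarrow> ae_eq U u v \<Longrightarrow> A w u = A w v"
    and l_add: "\<And>u v. u \<in> S \<Longrightarrow> v \<in> S \<Longrightarrow> l (\<lambda>x. u x + v x) = l u + l v"
    and l_cmult: "\<And>a u. u \<in> S \<Longrightarrow> l (\<lambda>x. a * u x) = cnj a * l u"
    and l_cong: "\<And>u v. u \<in> S \<Longrightarrow> v \<in> S \<Longrightarrow> ae_eq U u v \<Longrightarrow> l u = l v"
    and nondeg: "\<And>u. u \<in> S \<Longrightarrow> (\<And>v. v \<in> S \<Longrightarrow> A u v = 0) \<Longrightarrow> ae_eq U u (\<lambda>x. 0)"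
  shows "ex1_ae U (\<lambda>u. u \<in> S \<and> (\<forall>v\<in>S. A u v = l v))"
proof -
  have S0: "(\<lambda>x. 0) \<in> S" and S_add: "\<And>u v. u \<in> S \<Longrightarrow> v \<in> S \<Longrightarrow> (\<lambda>x. u x + v x) \<in> S"
    and S_cmult: "\<And>a v. v \<in> S \<Longrightarrow> (\<lambda>x. a * v x) \<in> S"
    using S(1) by (auto simp: H1_subspace_def)
  obtain b where b: "\<And>i. i < m \<Longrightarrow> b i \<in> S"
    and indep: "\<And>a. ae_eq U (\<lambda>x. \<Sum>i<m. a i * b i x) (\<lambda>x. 0) \<Longrightarrow> \<forall>i<m. a i = 0"
    and span: "\<And>v. v \<in> S \<Longrightarrow> \<exists>a. ae_eq U v (\<lambda>x. \<Sum>i<m. a i * b i x)"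
    using S(2) unfolding has_dim_def by blast
  have comb: "(\<lambda>x. \<Sum>i<k. a i * b i x) \<in> S" if "k \<le> m" for k a
    using that by (induction k) (auto intro!: S0 S_add S_cmult b)
  have A0_left: "A (\<lambda>x. 0) w = 0" if "w \<in> S" for w
    using cmult_left[OF S0 that, of 0] by simp
  have A0_right: "A w (\<lambda>x. 0) = 0" if "w \<in> S" for w
    using cmult_right[OF S0 that, of 0] by simp
  have l0: "l (\<lambda>x. 0) = 0" using l_cmult[OF S0, of 0] by simp
  have A_comb_left: "A (\<lambda>x. \<Sum>i<k. a i * b i x) w = (\<Sum>i<k. a i * A (b i) w)" if "k \<le> m" "w \<in> S" for k a w
    using that by (induction k) (auto simp: A0_left add_left[OF comb S_cmult[OF b]] cmult_left[OF b])
  have A_comb_right: "A w (\<lambda>x. \<Sum>i<k. a i * b i x) = (\<Sum>i<k. cnj (a i) * A w (b i))" if "k \<le> m" "w \<in> S" for k a w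
    using that by (induction k) (auto simp: A0_right add_right[OF comb S_cmult[OF b]] cmult_right[OF b])
  have l_comb: "l (\<lambda>x. \<Sum>i<k. a i * b i x) = (\<Sum>i<k. cnj (a i) * l (b i))" if "k \<le> m" for k a
    using that by (induction k) (auto simp: l0 l_add[OF comb S_cmult[OF b]] l_cmult[OF b])
  have basis_suffices: "A u v = r * l v" if u: "u \<in> S" and ub: "\<And>j. j < m \<Longrightarrow> A u (b j) = r * l (b j)" and v: "v \<in> S" for u v r
  proof -
    obtain a where a: "ae_eq U v (\<lambda>x. \<Sum>i<m. a i * b i x)" using span[OF v] by blast
    have "A u v = (\<Sum>i<m. cnj (a i) * A u (b i))"
      using cong_right[OF v comb u a] A_comb_right[OF _ u] by simp
    also have "\<dots> = (\<Sum>i<m. cnj (a i) * (r * l (b i)))"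
      by (intro sum.cong) (auto simp: ub)
    also have "\<dots> = r * (\<Sum>i<m. cnj (a i) * l (b i))"
      by (simp add: sum_distrib_left mult_ac)
    also have "\<dots> = r * l v" using l_cong[OF v comb a] l_comb by simp
    finally show ?thesis .
  qed
  \<comment> \<open>the last row carries the right-hand side, with the unknown \<open>x m\<close> as its coefficient\<close>
  define M where "M i j = (if i = m then l (b j) else A (b i) (b j))" for i j
  obtain x where x: "\<exists>i\<in>{..m}. x i \<noteq> 0" "\<forall>j\<in>{..<m}. (\<Sum>i\<in>{..m}. x i * M i j) = 0"
    using underdetermined_system[of "{..<m}" "{..m}" M] by auto
  have eq: "(\<Sum>i<m. x i * A (b i) (b j)) = - x m * l (b j)" if "j < m" for j
  proof -
    have "(\<Sum>i\<in>{..m}. x i * M i j) = (\<Sum>i<m. x i * M i j) + x m * M m j"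
      by (simp add: lessThan_Suc_atMost[symmetric])
    then have "(\<Sum>i<m. x i * M i j) + x m * M m j = 0" using x(2) that by simp
    moreover have "(\<Sum>i<m. x i * M i j) = (\<Sum>i<m. x i * A (b i) (b j))"
      by (intro sum.cong) (auto simp: M_def)
    ultimately show ?thesis by (simp add: M_def add_eq_0_iff2)
  qed
  define w where "w = (\<lambda>y. \<Sum>i<m. x i * b i y)"
  have w: "w \<in> S" unfolding w_def by (rule comb) simp
  have Aw: "A w v = - x m * l v" if "v \<in> S" for v
    using basis_suffices[OF w _ that, of "- x m"] A_comb_left[OF _ b, of m] eq by (simp add: w_def)
  have xm: "x m \<noteq> 0"
  proof
    assume 0: "x m = 0"
    then have "ae_eq U w (\<lambda>x. 0)" using Aw by (intro nondeg w) simp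
    then have "\<forall>i<m. x i = 0" unfolding w_def by (rule indep)
    with 0 x(1) show False by (auto simp: le_less)
  qed
  show ?thesis
    unfolding ex1_ae_def
  proof (intro conjI allI impI)
    show "\<exists>u. u \<in> S \<and> (\<forall>v\<in>S. A u v = l v)"
    proof (intro exI[of _ "\<lambda>y. (- 1 / x m) * w y"] conjI ballI S_cmult w)
      show "A (\<lambda>y. (- 1 / x m) * w y) v = l v" if "v \<in> S" for v
        unfolding cmult_left[OF w that] Aw[OF that] using xm by simp
    qed
  next
    fix u v assume u: "u \<in> S \<and> (\<forall>z\<in>S. A u z = l z)" and v: "v \<in> S \<and> (\<forall>z\<in>S. A v z = l z)"
    have "ae_eq U (\<lambda>y. u y + (- 1) * v y) (\<lambda>x. 0)"
    proof (rule nondeg)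
      show "(\<lambda>y. u y + (- 1) * v y) \<in> S" using u v by (intro S_add S_cmult) auto
      show "A (\<lambda>y. u y + (- 1) * v y) z = 0" if "z \<in> S" for z
      proof -
        have "A (\<lambda>y. u y + (- 1) * v y) z = A u z + A (\<lambda>y. (- 1) * v y) z"
          using u v that by (intro add_left S_cmult) auto
        moreover have "A (\<lambda>y. (- 1) * v y) z = (- 1) * A v z"
          using v that by (intro cmult_left) auto
        ultimately show ?thesis using u v that by simp
      qed
    qed
    then show "ae_eq U u v" unfolding ae_eq_def by eventually_elim simp
  qed
qed

section \<open>Every function of the energy space has a trace\<close>

lemma eq_0_if_le_all_multiples:
  fixes b D :: real
  assumes "0 \<le> b" "\<And>\<epsilon>. \<epsilon> > 0 \<Longrightarrow> b \<le> \<epsilon> * D"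
  shows "b = 0"
proof (rule ccontr)
  assume "b \<noteq> 0"
  then have b: "b > 0" using assms(1) by simp
  have D: "b \<le> D" using assms(2)[of 1] by simp
  have "b \<le> (b / (2 * D)) * D" using b D by (intro assms(2)) auto
  then show False using b D by simp
qed

text \<open>The imaginary part is a sum of nonnegative terms \<open>Im \<zeta>\<^sub>k |m\<^sub>k|\<^sup>2\<close>.\<close>

lemma modes_eq_0_if_Im_eq_0:
  assumes modes: "finite K" "\<rho> > 0" "\<And>k. k \<in> K \<Longrightarrow> Im (\<zeta> k) > 0"
    and 0: "Im (of_real \<rho> * (\<Sum>k\<in>K. \<zeta> k * (m k * cnj (m k)))) = 0" and k: "k \<in> K"
  shows "m k = 0"
proof -
  have *: "Im (\<zeta> j * (m j * cnj (m j))) = Im (\<zeta> j) * (cmod (m j))\<^sup>2" for j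
    by (simp add: complex_mult_cnj cmod_power2)
  have "Im (of_real r * z) = r * Im z" for r z by simp
  from 0[unfolded this Im_sum *] have "(\<Sum>j\<in>K. Im (\<zeta> j) * (cmod (m j))\<^sup>2) = 0"
    using modes(2) by (simp only: mult_eq_0_iff)  simp
  moreover have "0 \<le> Im (\<zeta> j) * (cmod (m j))\<^sup>2" if "j \<in> K" for j
    using modes(3)[OF that] by (intro mult_nonneg_nonneg) auto
  ultimately have "Im (\<zeta> k) * (cmod (m k))\<^sup>2 = 0"
    using modes(1) k by (simp add: sum_nonneg_eq_0_iff)
  then show ?thesis using modes(3)[OF k] by simp
qed

context
  fixes c :: "nat \<Rightarrow> 'n::finite" and \<kappa> R C :: real and N :: nat
  assumes dim: "CARD('n) \<in> {2, 3}" and pos: "\<kappa> > 0" "R > 0"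
    and bound: "\<And>w v. w \<in> H1 (ball 0 R) \<Longrightarrow> v \<in> H1 (ball 0 R) \<Longrightarrow>
           cmod (a_form c \<kappa> R N w v) \<le> C * H1nrm (ball 0 R) w * H1nrm (ball 0 R) v"
    and adjoint_solvable: "\<And>f. f \<in> L2 (lebesgue_on (ball 0 R)) \<Longrightarrow> \<exists>w. adjoint_solution c \<kappa> R N f w"
begin

abbreviation (input) "\<B> \<equiv> ball (0::real^'n) R"

abbreviation (input) "boundary_form w v \<equiv> ip (sphere_measure R) (dtn c \<kappa> R N (sphere_trace R w)) (sphere_trace R v)"

lemma domain: "open \<B>" "bounded \<B>" by auto

text \<open>For a function without trace, \<open>sphere_trace\<close> returns an arbitrary but fixed function, which therefore
does not scale with the argument.\<close>

lemma sphere_trace_cmult_untraceable: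
  assumes "u \<in> H1 \<B>" "\<nexists>g. is_trace R u g" "a \<noteq> 0"
  shows "sphere_trace R (\<lambda>x. a * u x) = sphere_trace R u"
proof -
  have "\<not> is_trace R (\<lambda>x. a * u x) g" for g
  proof
    assume "is_trace R (\<lambda>x. a * u x) g"
    from is_trace_cmult[OF pos(2) H1_cmult[OF domain assms(1)] this, of "1 / a"] show False
      using assms by simp
  qed
  then have "is_trace R (\<lambda>x. a * u x) = is_trace R u" using assms(2) by (auto simp: fun_eq_iff)
  then show ?thesis by (simp add: sphere_trace_def)
qed

text \<open>The boundary term does not change when \<open>u\<close> is replaced by \<open>\<epsilon> u\<close>, while continuity of the sesquilinear
form bounds it by a multiple of \<open>\<epsilon>\<close>.\<close>

lemma boundary_form_untraceable:
  assumes u: "u \<in> H1 \<B>" "\<nexists>g. is_trace R u g" and v: "v \<in> H1 \<B>"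
  shows "boundary_form u v = 0" "boundary_form v u = 0"
proof -
  let ?L = "helmholtz_form \<kappa> \<B>"
  define D where "D = C * H1nrm \<B> u * H1nrm \<B> v + cmod (?L u v) + cmod (?L v u)"
  have bounds: "cmod (boundary_form u v) \<le> \<epsilon> * D" "cmod (boundary_form v u) \<le> \<epsilon> * D" if "\<epsilon> > 0" for \<epsilon>
  proof -
    let ?u = "\<lambda>x. of_real \<epsilon> * u x"
    note uH = H1_cmult[OF domain u(1), of "of_real \<epsilon>"]
    have "boundary_form u v = ?L ?u v - a_form c \<kappa> R N ?u v" "boundary_form v u = ?L v ?u - a_form c \<kappa> R N v ?u"
      using that by (simp_all add: a_form_split sphere_trace_cmult_untraceable[OF u])
    then have "cmod (boundary_form u v) \<le> cmod (?L ?u v) + cmod (a_form c \<kappa> R N ?u v)"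
      "cmod (boundary_form v u) \<le> cmod (?L v ?u) + cmod (a_form c \<kappa> R N v ?u)"
      by (simp_all only: norm_triangle_ineq4)
    moreover have "cmod (?L ?u v) = \<epsilon> * cmod (?L u v)" "cmod (?L v ?u) = \<epsilon> * cmod (?L v u)"
      "H1nrm \<B> ?u = \<epsilon> * H1nrm \<B> u"
      using that by (simp_all add: helmholtz_form_cmult_left[OF domain u(1) v] helmholtz_form_cmult_right[OF domain u(1) v]
          H1nrm_cmult[OF domain u(1)] norm_mult)
    moreover have "0 \<le> \<epsilon> * cmod (?L u v)" "0 \<le> \<epsilon> * cmod (?L v u)" using that by simp_all
    ultimately show "cmod (boundary_form u v) \<le> \<epsilon> * D" "cmod (boundary_form v u) \<le> \<epsilon> * D"
      using bound[OF uH v] bound[OF v uH] by (simp_all add: D_def algebra_simps)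
  qed
  have "cmod (boundary_form u v) = 0" "cmod (boundary_form v u) = 0"
    by (rule eq_0_if_le_all_multiples[OF norm_ge_zero bounds(1)] eq_0_if_le_all_multiples[OF norm_ge_zero bounds(2)]; assumption)+
  then show "boundary_form u v = 0" "boundary_form v u = 0" by simp_all
qed

text \<open>Suppose that \<open>u\<close> has no trace, and write \<open>L\<close> for the form without boundary term and \<open>B\<close> for the boundary
term. Let \<open>w\<close> solve the adjoint problem for \<open>f\<close>. For \<open>v\<close> without trace, \<open>B(v, w) = 0\<close>, so
\<open>L(v, w) = (v, f)\<close>. If \<open>z\<close> has a trace, then \<open>z + u\<close> has none, and subtracting the identities for
\<open>z + u\<close> and \<open>u\<close> yields \<open>L(z, w) = (z, f)\<close> as well. Hence \<open>B(\<cdot>, w) = 0\<close> for every adjoint solution \<open>w\<close>.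

Now take \<open>f = - \<kappa>\<^sup>2\<close>. Since \<open>L(v, 1) = (v, f)\<close>, the solution is \<open>w = 1 + e\<close> with \<open>L(\<cdot>, e) = 0\<close>. Solving
the adjoint problem for \<open>e\<close> gives \<open>w'\<close> with \<open>\<parallel>e\<parallel>\<^sup>2 = L(e, w') = 0\<close>, so \<open>w = 1\<close> and \<open>B(1, 1) = 0\<close>.
But then all modes of the constant function \<open>1\<close> vanish, which is false.\<close>

lemma trace_exists:
  assumes "u \<in> H1 \<B>"
  shows "\<exists>g. is_trace R u g"
proof (rule ccontr)
  assume no_trace: "\<nexists>g. is_trace R u g"
  let ?L = "helmholtz_form \<kappa> \<B>"
  note sesq = helmholtz_form_add_left[OF domain, of _ _ _ \<kappa>] helmholtz_form_cmult_left[OF domain, of _ _ \<kappa>]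
    helmholtz_form_add_right[OF domain, of _ _ _ \<kappa>] helmholtz_form_cmult_right[OF domain, of _ _ \<kappa>]
  have free: "?L z w = ip (lebesgue_on \<B>) z f" "boundary_form z w = 0"
    if w: "adjoint_solution c \<kappa> R N f w" and f: "f \<in> L2 (lebesgue_on \<B>)" and z: "z \<in> H1 \<B>" for z w f
  proof -
    have wH: "w \<in> H1 \<B>" and eq: "\<And>v. v \<in> H1 \<B> \<Longrightarrow> ?L v w - boundary_form v w = ip (lebesgue_on \<B>) v f"
      using w by (auto simp: adjoint_solution_def a_form_split)
    have unt: "?L v w = ip (lebesgue_on \<B>) v f" if "v \<in> H1 \<B>" "\<nexists>g. is_trace R v g" for v
      using eq[OF that(1)] boundary_form_untraceable(1)[OF that wH] by simp
    show *: "?L z w = ip (lebesgue_on \<B>) z f"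
    proof (cases "\<exists>g. is_trace R z g")
      case True
      then obtain g where g: "is_trace R z g" by blast
      have "\<nexists>h. is_trace R (\<lambda>x. z x + u x) h"
      proof
        assume "\<exists>h. is_trace R (\<lambda>x. z x + u x) h"
        then obtain h where "is_trace R (\<lambda>x. z x + u x) h" by blast
        from is_trace_add[OF pos(2) H1_add[OF domain z assms] this H1_cmult[OF domain z] is_trace_cmult[OF pos(2) z g], of "-1"]
        show False using no_trace by simp
      qed
      from unt[OF H1_add[OF domain z assms] this] unt[OF assms no_trace]
      show ?thesis
        using ip_add_left[OF H1_L2[OF domain z] H1_L2[OF domain assms] f] by (simp add: sesq(1)[OF z assms wH])
    qed (use unt[OF z] in simp)
    show "boundary_form z w = 0" using eq[OF z] * by simp
  qed
  define one :: "real^'n \<Rightarrow> complex" where "one = (\<lambda>x. 1)"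
  have one: "one \<in> H1 \<B>" "is_trace R one one"
    unfolding one_def by (intro C1_H1[OF domain] is_trace_C1[OF pos(2)] C_k_const)+
  have oneL2: "one \<in> L2 (lebesgue_on \<B>)" by (rule H1_L2[OF domain one(1)])
  have wd_one: "AE x in lebesgue_on \<B>. wd \<B> i one x = 0" for i
  proof -
    have "partial_deriv i one = (\<lambda>x. 0)"
      unfolding one_def by (auto simp: fun_eq_iff partial_deriv_eqI[OF has_derivative_const])
    then show ?thesis using wd_unique[OF domain C1_weak_partial[OF domain, of one i]] C_k_const[of 1 "1::complex"]
      by (simp add: one_def del: C_k.simps)
  qed
  have L_one: "?L v one = - of_real (\<kappa>\<^sup>2) * ip (lebesgue_on \<B>) v one" if v: "v \<in> H1 \<B>" for v
  proof -
    have "ip (lebesgue_on \<B>) (wd \<B> i v) (wd \<B> i one) = ip (lebesgue_on \<B>) (wd \<B> i v) (\<lambda>x. 0)" for i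
      by (rule ip_cong[OF wd_L2[OF domain v] wd_L2[OF domain v] wd_L2[OF domain one(1)] L2_zero _ wd_one]) simp
    then show ?thesis by (simp add: helmholtz_form_def ip_def)
  qed
  define f where "f = (\<lambda>x. - of_real (\<kappa>\<^sup>2) * one x)"
  have f: "f \<in> L2 (lebesgue_on \<B>)" unfolding f_def by (rule L2_cmult[OF oneL2])
  obtain w where w: "adjoint_solution c \<kappa> R N f w" using adjoint_solvable[OF f] by blast
  then have wH: "w \<in> H1 \<B>" by (simp add: adjoint_solution_def)
  define e where "e = (\<lambda>x. w x + (- 1) * one x)"
  have e: "e \<in> H1 \<B>" unfolding e_def by (intro H1_add[OF domain] H1_cmult[OF domain] wH one)
  have L_e: "?L v e = 0" if v: "v \<in> H1 \<B>" for v
  proof -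
    have "?L v e = ?L v w + cnj (- 1) * ?L v one"
      unfolding e_def using sesq(3)[OF wH H1_cmult[OF domain one(1)] v, of "-1"] sesq(4)[OF one(1) v, of "-1"] by simp
    also have "?L v w = ip (lebesgue_on \<B>) v f" by (rule free(1)[OF w f v])
    also have "\<dots> = - of_real (\<kappa>\<^sup>2) * ip (lebesgue_on \<B>) v one"
      unfolding f_def ip_cmult_right by simp
    finally show ?thesis by (simp add: L_one[OF v])
  qed
  have e0: "ae_eq \<B> e (\<lambda>x. 0)"
  proof -
    have eL2: "e \<in> L2 (lebesgue_on \<B>)" by (rule H1_L2[OF domain e])
    obtain w' where w': "adjoint_solution c \<kappa> R N e w'" using adjoint_solvable[OF eL2] by blast
    then have "w' \<in> H1 \<B>" by (simp add: adjoint_solution_def)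
    then have "?L e w' = 0" using L_e[of w'] helmholtz_form_commute[of \<kappa> \<B> e w'] by simp
    then have "ip (lebesgue_on \<B>) e e = 0" using free(1)[OF w' eL2 e] by simp
    then show ?thesis using L2nrm_eq_0_iff[OF eL2] by (simp add: ip_self ae_eq_def)
  qed
  then have "ae_eq \<B> one w" unfolding ae_eq_def e_def by eventually_elim simp
  then have "is_trace R w one" by (rule is_trace_cong[OF pos(2) one wH])
  then have tw: "is_trace R w (sphere_trace R w)" "AE x in sphere_measure R. sphere_trace R w x = one x"
    using sphere_trace_is_trace is_trace_unique[OF pos(2) wH] by blast+
  have t1: "is_trace R one (sphere_trace R one)" "AE x in sphere_measure R. sphere_trace R one x = one x"
    using one sphere_trace_is_trace is_trace_unique[OF pos(2) one(1)] by blast+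
  have L2: "sphere_trace R w \<in> L2 (sphere_measure R)" "sphere_trace R one \<in> L2 (sphere_measure R)" "one \<in> L2 (sphere_measure R)"
    using tw(1) t1(1) one(2) by (auto simp: is_trace_def)
  obtain K :: "(nat \<times> int) set" and \<zeta> \<rho> and m :: "nat \<times> int \<Rightarrow> (real^'n \<Rightarrow> complex) \<Rightarrow> complex"
  where K: "finite K" "\<rho> > 0" "\<And>k. k \<in> K \<Longrightarrow> Im (\<zeta> k) > 0"
    and form: "\<And>g h. h \<in> L2 (sphere_measure R) \<Longrightarrow> ip (sphere_measure R) (dtn c \<kappa> R N g) h
        = of_real \<rho> * (\<Sum>k\<in>K. \<zeta> k * (m k g * cnj (m k h)))"
    and m_cong: "\<And>k g h. k \<in> K \<Longrightarrow> g \<in> L2 (sphere_measure R) \<Longrightarrow> h \<in> L2 (sphere_measure R) \<Longrightarrow>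
       (AE x in sphere_measure R. g x = h x) \<Longrightarrow> m k g = m k h"
    and m1: "\<exists>k\<in>K. m k (\<lambda>x. 1) \<noteq> 0"
    by (rule boundary_form_modes[OF dim pos, of c N]) blast
  have mk: "m k (sphere_trace R w) = m k one" "m k (sphere_trace R one) = m k one" if "k \<in> K" for k
    by (rule m_cong[OF that L2(1,3) tw(2)] m_cong[OF that L2(2,3) t1(2)])+
  have "boundary_form one w = 0" by (rule free(2)[OF w f one(1)])
  moreover have "boundary_form one w = of_real \<rho> * (\<Sum>k\<in>K. \<zeta> k * (m k one * cnj (m k one)))"
    unfolding form[OF L2(1)]
  proof (intro arg_cong2[where f = "(*)"] sum.cong refl)
    fix k assume "k \<in> K"
    then show "m k (sphere_trace R one) = m k one" "cnj (m k (sphere_trace R w)) = cnj (m k one)"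
      by (simp_all only: mk)
  qed
  ultimately have "of_real \<rho> * (\<Sum>k\<in>K. \<zeta> k * (m k one * cnj (m k one))) = 0" by (simp only:)
  then have Im0: "Im (of_real \<rho> * (\<Sum>k\<in>K. \<zeta> k * (m k one * cnj (m k one)))) = 0"
    by (simp only: zero_complex.sel)
  have "m k one = 0" if "k \<in> K" for k by (rule modes_eq_0_if_Im_eq_0[OF K Im0 that])
  then show False using m1 by (auto simp: one_def)
qed

section \<open>The discrete problem\<close>

lemma trace_L2:
  assumes "u \<in> H1 \<B>"
  shows "is_trace R u (sphere_trace R u)" "sphere_trace R u \<in> L2 (sphere_measure R)"
proof -
  obtain g where "is_trace R u g" using trace_exists[OF assms] by blast
  then show *: "is_trace R u (sphere_trace R u)" by (rule sphere_trace_is_trace)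
  then show "sphere_trace R u \<in> L2 (sphere_measure R)" unfolding is_trace_def by blast
qed

lemma trace_add:
  assumes "u \<in> H1 \<B>" "v \<in> H1 \<B>"
  shows "AE x in sphere_measure R. sphere_trace R (\<lambda>x. u x + v x) x = sphere_trace R u x + sphere_trace R v x"
  using is_trace_unique[OF pos(2) H1_add[OF domain assms] trace_L2(1)[OF H1_add[OF domain assms]]
      is_trace_add[OF pos(2) assms(1) trace_L2(1)[OF assms(1)] assms(2) trace_L2(1)[OF assms(2)]]] .

lemma trace_cmult:
  assumes "u \<in> H1 \<B>"
  shows "AE x in sphere_measure R. sphere_trace R (\<lambda>x. a * u x) x = a * sphere_trace R u x"
  using is_trace_unique[OF pos(2) H1_cmult[OF domain assms] trace_L2(1)[OF H1_cmult[OF domain assms]]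
      is_trace_cmult[OF pos(2) assms trace_L2(1)[OF assms]]] .

lemma trace_cong:
  assumes "u \<in> H1 \<B>" "v \<in> H1 \<B>" "ae_eq \<B> u v"
  shows "AE x in sphere_measure R. sphere_trace R u x = sphere_trace R v x"
  using is_trace_unique[OF pos(2) assms(2) is_trace_cong[OF pos(2) assms(1) trace_L2(1)[OF assms(1)] assms(2,3)] trace_L2(1)[OF assms(2)]] .

text \<open>Now that traces exist and are unique, the modes are linear functionals on \<open>H1\<close>.\<close>

lemma trace_modes:
  obtains K :: "(nat \<times> int) set" and \<zeta> \<rho> and m :: "nat \<times> int \<Rightarrow> (real^'n \<Rightarrow> complex) \<Rightarrow> complex"
  where "finite K" "\<rho> > 0" "\<And>k. k \<in> K \<Longrightarrow> Im (\<zeta> k) > 0"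
    "\<And>u v. v \<in> H1 \<B> \<Longrightarrow> boundary_form u v = of_real \<rho> * (\<Sum>k\<in>K. \<zeta> k * (m k u * cnj (m k v)))"
    "\<And>k u v. k \<in> K \<Longrightarrow> u \<in> H1 \<B> \<Longrightarrow> v \<in> H1 \<B> \<Longrightarrow> m k (\<lambda>x. u x + v x) = m k u + m k v"
    "\<And>k a u. k \<in> K \<Longrightarrow> u \<in> H1 \<B> \<Longrightarrow> m k (\<lambda>x. a * u x) = a * m k u"
    "\<And>k u v. k \<in> K \<Longrightarrow> u \<in> H1 \<B> \<Longrightarrow> v \<in> H1 \<B> \<Longrightarrow> ae_eq \<B> u v \<Longrightarrow> m k u = m k v"
proof -
  obtain K :: "(nat \<times> int) set" and \<zeta> \<rho> and m :: "nat \<times> int \<Rightarrow> (real^'n \<Rightarrow> complex) \<Rightarrow> complex"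
  where K: "finite K" "\<rho> > 0" "\<And>k. k \<in> K \<Longrightarrow> Im (\<zeta> k) > 0"
    and form: "\<And>g h. h \<in> L2 (sphere_measure R) \<Longrightarrow> ip (sphere_measure R) (dtn c \<kappa> R N g) h
        = of_real \<rho> * (\<Sum>k\<in>K. \<zeta> k * (m k g * cnj (m k h)))"
    and m_add: "\<And>k g h. k \<in> K \<Longrightarrow> g \<in> L2 (sphere_measure R) \<Longrightarrow> h \<in> L2 (sphere_measure R) \<Longrightarrow> m k (\<lambda>x. g x + h x) = m k g + m k h"
    and m_cmult: "\<And>k a g. k \<in> K \<Longrightarrow> g \<in> L2 (sphere_measure R) \<Longrightarrow> m k (\<lambda>x. a * g x) = a * m k g"
    and m_cong: "\<And>k g h. k \<in> K \<Longrightarrow> g \<in> L2 (sphere_measure R) \<Longrightarrow> h \<in> L2 (sphere_measure R) \<Longrightarrow>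
       (AE x in sphere_measure R. g x = h x) \<Longrightarrow> m k g = m k h"
    by (rule boundary_form_modes[OF dim pos, of c N]) blast
  show thesis
  proof (rule that[of K \<rho> \<zeta> "\<lambda>k u. m k (sphere_trace R u)"])
    show "m k (sphere_trace R (\<lambda>x. u x + v x)) = m k (sphere_trace R u) + m k (sphere_trace R v)"
      if "k \<in> K" "u \<in> H1 \<B>" "v \<in> H1 \<B>" for k u v
      using m_cong[OF that(1) trace_L2(2)[OF H1_add[OF domain that(2,3)]]
          L2_add[OF trace_L2(2)[OF that(2)] trace_L2(2)[OF that(3)]] trace_add[OF that(2,3)]]
        m_add[OF that(1) trace_L2(2)[OF that(2)] trace_L2(2)[OF that(3)]] by simp
    show "m k (sphere_trace R (\<lambda>x. a * u x)) = a * m k (sphere_trace R u)" if "k \<in> K" "u \<in> H1 \<B>" for k a u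
      using m_cong[OF that(1) trace_L2(2)[OF H1_cmult[OF domain that(2)]]
          L2_cmult[OF trace_L2(2)[OF that(2)]] trace_cmult[OF that(2)]]
        m_cmult[OF that(1) trace_L2(2)[OF that(2)]] by simp
    show "m k (sphere_trace R u) = m k (sphere_trace R v)" if "k \<in> K" "u \<in> H1 \<B>" "v \<in> H1 \<B>" "ae_eq \<B> u v" for k u v
      by (rule m_cong[OF that(1) trace_L2(2)[OF that(2)] trace_L2(2)[OF that(3)] trace_cong[OF that(2-4)]])
    show "boundary_form u v = of_real \<rho> * (\<Sum>k\<in>K. \<zeta> k * (m k (sphere_trace R u) * cnj (m k (sphere_trace R v))))"
      if "v \<in> H1 \<B>" for u v
      by (rule form[OF trace_L2(2)[OF that]])
  qed (fact K)+
qed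

lemma a_form_add_left:
  assumes "u \<in> H1 \<B>" "v \<in> H1 \<B>" "w \<in> H1 \<B>"
  shows "a_form c \<kappa> R N (\<lambda>x. u x + v x) w = a_form c \<kappa> R N u w + a_form c \<kappa> R N v w"
  using assms
  by (rule_tac trace_modes)
     (simp add: a_form_split helmholtz_form_add_left[OF domain] H1_add[OF domain] algebra_simps sum.distrib)

lemma a_form_cmult_left:
  assumes "u \<in> H1 \<B>" "w \<in> H1 \<B>"
  shows "a_form c \<kappa> R N (\<lambda>x. a * u x) w = a * a_form c \<kappa> R N u w"
  using assms
  by (rule_tac trace_modes)
     (simp add: a_form_split helmholtz_form_cmult_left[OF domain] right_diff_distrib sum_distrib_left mult_ac)

lemma a_form_add_right:
  assumes "u \<in> H1 \<B>" "v \<in> H1 \<B>" "w \<in> H1 \<B>"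
  shows "a_form c \<kappa> R N w (\<lambda>x. u x + v x) = a_form c \<kappa> R N w u + a_form c \<kappa> R N w v"
  using assms
  by (rule_tac trace_modes)
     (simp add: a_form_split helmholtz_form_add_right[OF domain] H1_add[OF domain] algebra_simps sum.distrib)

lemma a_form_cmult_right:
  assumes "u \<in> H1 \<B>" "w \<in> H1 \<B>"
  shows "a_form c \<kappa> R N w (\<lambda>x. a * u x) = cnj a * a_form c \<kappa> R N w u"
  using assms
  by (rule_tac trace_modes)
     (simp add: a_form_split helmholtz_form_cmult_right[OF domain] H1_cmult[OF domain] right_diff_distrib sum_distrib_left mult_ac)

lemma a_form_cong_right:
  assumes "u \<in> H1 \<B>" "v \<in> H1 \<B>" "w \<in> H1 \<B>" "ae_eq \<B> u v"
  shows "a_form c \<kappa> R N w u = a_form c \<kappa> R N w v"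
proof -
  have "helmholtz_form \<kappa> \<B> w u = helmholtz_form \<kappa> \<B> w v"
    using assms by (intro helmholtz_form_cong[OF domain]) (auto simp: ae_eq_def)
  then show ?thesis
    using assms by (rule_tac trace_modes) (simp add: a_form_split)
qed

text \<open>The imaginary part removes all modes, the real part then equates \<open>\<parallel>\<nabla>u\<parallel>\<^sup>2\<close> and \<open>\<kappa>\<^sup>2 \<parallel>u\<parallel>\<^sup>2\<close>.\<close>

lemma a_form_self_eq_0_imp:
  assumes u: "u \<in> H1 \<B>" and 0: "a_form c \<kappa> R N u u = 0"
  shows "(H1nrm \<B> u)\<^sup>2 = (1 + \<kappa>\<^sup>2) * (L2nrm (lebesgue_on \<B>) u)\<^sup>2"
proof (rule trace_modes)
  fix K :: "(nat \<times> int) set" and \<rho> \<zeta> and m :: "nat \<times> int \<Rightarrow> (real^'n \<Rightarrow> complex) \<Rightarrow> complex"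
  assume K: "finite K" "\<rho> > 0" "\<And>k. k \<in> K \<Longrightarrow> Im (\<zeta> k) > 0"
    and form: "\<And>u v. v \<in> H1 \<B> \<Longrightarrow> boundary_form u v = of_real \<rho> * (\<Sum>k\<in>K. \<zeta> k * (m k u * cnj (m k v)))"
  have eq: "boundary_form u u = helmholtz_form \<kappa> \<B> u u" using 0 by (simp add: a_form_split)
  then have "Im (boundary_form u u) = 0" by (simp add: helmholtz_form_self[OF domain])
  then have Im0: "Im (of_real \<rho> * (\<Sum>k\<in>K. \<zeta> k * (m k u * cnj (m k u)))) = 0"
    unfolding form[OF u] .
  have "m k u = 0" if "k \<in> K" for k by (rule modes_eq_0_if_Im_eq_0[OF K Im0 that])
  then have "boundary_form u u = 0" unfolding form[OF u] by simp
  then have "complex_of_real ((H1nrm \<B> u)\<^sup>2 - (1 + \<kappa>\<^sup>2) * (L2nrm (lebesgue_on \<B>) u)\<^sup>2) = 0"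
    using eq helmholtz_form_self[OF domain, of \<kappa> u] by simp
  then show ?thesis unfolding of_real_eq_0_iff by simp
qed

text \<open>The Aubin--Nitsche duality argument. The infimum in \<open>eta\<close> need not be attained, hence the \<open>\<epsilon>\<close>.\<close>

lemma L2nrm_le_eta:
  assumes S: "H1_subspace \<B> S" and eta: "eta c \<kappa> R N S \<le> ereal r" and C: "C \<ge> 0"
    and u: "u \<in> S" "\<And>v. v \<in> S \<Longrightarrow> a_form c \<kappa> R N u v = 0"
  shows "L2nrm (lebesgue_on \<B>) u \<le> C * r * H1nrm \<B> u"
proof (cases "ae_eq \<B> u (\<lambda>x. 0)")
  case True
  have uH: "u \<in> H1 \<B>" using S u by (auto simp: H1_subspace_def)
  have "L2nrm (lebesgue_on \<B>) u = 0"
    using True L2nrm_eq_0_iff[OF H1_L2[OF domain uH]] by (simp add: ae_eq_def)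
  moreover have "H1nrm \<B> u = 0"
    using H1nrm_cong[OF domain uH H1_cmult[OF domain uH, of 0]] True H1nrm_cmult[OF domain uH, of 0] by simp
  ultimately show ?thesis by simp
next
  case False
  let ?nu = "L2nrm (lebesgue_on \<B>) u"
  have uH: "u \<in> H1 \<B>" using S u by (auto simp: H1_subspace_def)
  have uL: "u \<in> L2 (lebesgue_on \<B>)" by (rule H1_L2[OF domain uH])
  have nu: "?nu > 0"
    using False L2nrm_eq_0_iff[OF uL] L2nrm_nonneg[of "lebesgue_on \<B>" u] by (simp add: ae_eq_def)
  define w where "w = adjoint_inverse c \<kappa> R N u"
  have "adjoint_solution c \<kappa> R N u w"
    unfolding w_def adjoint_inverse_def using adjoint_solvable[OF uL] by (rule someI_ex)
  then have wH: "w \<in> H1 \<B>" and sol: "a_form c \<kappa> R N u w = ip (lebesgue_on \<B>) u u"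
    using uH by (auto simp: adjoint_solution_def)
  have "?nu \<le> C * H1nrm \<B> u * (r + \<epsilon>)" if "\<epsilon> > 0" for \<epsilon>
  proof -
    have "(INF v\<in>S. ereal (H1nrm \<B> (\<lambda>x. w x - v x) / ?nu)) \<le> eta c \<kappa> R N S"
      unfolding eta_def w_def by (rule SUP_upper) (use uL False in auto)
    also have "\<dots> < ereal (r + \<epsilon>)" using eta that by (auto elim: le_less_trans)
    finally obtain v where v: "v \<in> S" "H1nrm \<B> (\<lambda>x. w x - v x) / ?nu < r + \<epsilon>"
      by (auto simp: INF_less_iff)
    have vH: "v \<in> H1 \<B>" using S v by (auto simp: H1_subspace_def)
    have eq: "complex_of_real (?nu\<^sup>2) = a_form c \<kappa> R N u (\<lambda>x. w x + (- 1) * v x)"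
      using sol u(2)[OF v(1)]
      by (subst a_form_add_right[OF wH H1_cmult[OF domain vH] uH], subst a_form_cmult_right[OF vH uH]) (simp add: ip_self)
    have "?nu\<^sup>2 = cmod (complex_of_real (?nu\<^sup>2))" by (simp only: norm_of_real abs_power2)
    also have "\<dots> = cmod (a_form c \<kappa> R N u (\<lambda>x. w x - v x))" unfolding eq by simp
    finally have "?nu\<^sup>2 = cmod (a_form c \<kappa> R N u (\<lambda>x. w x - v x))" .
    also have "\<dots> \<le> C * H1nrm \<B> u * H1nrm \<B> (\<lambda>x. w x - v x)"
      by (rule bound[OF uH H1_diff[OF domain wH vH]])
    also have "\<dots> \<le> C * H1nrm \<B> u * ((r + \<epsilon>) * ?nu)"
    proof (rule mult_left_mono)
      show "H1nrm \<B> (\<lambda>x. w x - v x) \<le> (r + \<epsilon>) * ?nu"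
        using v(2) nu by (simp add: pos_divide_less_eq)
      show "0 \<le> C * H1nrm \<B> u" using C by (simp add: H1nrm_nonneg)
    qed
    finally have "?nu * ?nu \<le> (C * H1nrm \<B> u * (r + \<epsilon>)) * ?nu" by (simp add: power2_eq_square mult_ac)
    then show ?thesis using nu by (simp only: mult_le_cancel_right_pos)
  qed
  moreover have "C * H1nrm \<B> u * (r + \<epsilon>) = C * H1nrm \<B> u * r + \<epsilon> * (C * H1nrm \<B> u)" for \<epsilon>
    by (simp add: algebra_simps)
  ultimately have *: "?nu \<le> C * H1nrm \<B> u * r + \<epsilon> * (C * H1nrm \<B> u)" if "\<epsilon> > 0" for \<epsilon>
    using that by metis
  \<comment> \<open>the truncation at \<open>0\<close> turns the limit \<open>\<epsilon> \<rightarrow> 0\<close> into an instance of a nonnegative quantity below all multiples\<close>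
  have "max 0 (?nu - C * H1nrm \<B> u * r) = 0"
    by (rule eq_0_if_le_all_multiples[where D = "C * H1nrm \<B> u"])
       (use * C H1nrm_nonneg[of \<B> u] in \<open>auto simp: max_def algebra_simps\<close>)
  then show ?thesis by (simp add: max_def algebra_simps split: if_splits)
qed

text \<open>Inserting the energy identity into the duality estimate gives \<open>\<parallel>u\<parallel>\<^sup>2 \<le> \<parallel>u\<parallel>\<^sup>2 / 2\<close>, because
\<open>(min 1 \<kappa>)\<^sup>2 (1 + \<kappa>\<^sup>2) \<le> 2 \<kappa>\<^sup>2\<close>.\<close>

lemma discrete_kernel_trivial:
  assumes S: "H1_subspace \<B> S" and C: "C > 0" and eta: "eta c \<kappa> R N S \<le> ereal (min 1 \<kappa> / (2 * \<kappa> * C))"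
    and u: "u \<in> S" "\<And>v. v \<in> S \<Longrightarrow> a_form c \<kappa> R N u v = 0"
  shows "ae_eq \<B> u (\<lambda>x. 0)"
proof -
  have uH: "u \<in> H1 \<B>" using S u by (auto simp: H1_subspace_def)
  define x where "x = L2nrm (lebesgue_on \<B>) u"
  have "x \<le> C * (min 1 \<kappa> / (2 * \<kappa> * C)) * H1nrm \<B> u"
    unfolding x_def using C by (intro L2nrm_le_eta[OF S eta _ u]) auto
  also have "C * (min 1 \<kappa> / (2 * \<kappa> * C)) = min 1 \<kappa> / (2 * \<kappa>)" using C by simp
  finally have "x\<^sup>2 \<le> (min 1 \<kappa> / (2 * \<kappa>) * H1nrm \<B> u)\<^sup>2"
    by (rule power_mono) (simp add: x_def L2nrm_nonneg)
  also have "\<dots> = (min 1 \<kappa>)\<^sup>2 / (4 * \<kappa>\<^sup>2) * ((1 + \<kappa>\<^sup>2) * x\<^sup>2)"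
    using a_form_self_eq_0_imp[OF uH u(2)[OF u(1)]] by (simp add: x_def power_mult_distrib power_divide)
  also have "\<dots> \<le> 1/2 * x\<^sup>2"
  proof -
    \<comment> \<open>the minimum picks \<open>\<kappa>\<^sup>2 + \<kappa>\<^sup>4\<close> for \<open>\<kappa> \<le> 1\<close> and \<open>1 + \<kappa>\<^sup>2\<close> otherwise\<close>
    have "(min 1 \<kappa>)\<^sup>2 * (1 + \<kappa>\<^sup>2) \<le> 2 * \<kappa>\<^sup>2"
    proof (cases "\<kappa> \<le> 1")
      case True
      then have "\<kappa>\<^sup>2 \<le> 1" using pos by (simp add: power_le_one)
      then have "\<kappa>\<^sup>2 * \<kappa>\<^sup>2 \<le> \<kappa>\<^sup>2 * 1" by (intro mult_left_mono) auto
      then show ?thesis using True by (simp add: min_def algebra_simps)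
    next
      case False
      then have "1 \<le> \<kappa>\<^sup>2" by (simp add: one_le_power)
      then show ?thesis using False by (simp add: min_def)
    qed
    then have "(min 1 \<kappa>)\<^sup>2 * (1 + \<kappa>\<^sup>2) / (4 * \<kappa>\<^sup>2) \<le> 2 * \<kappa>\<^sup>2 / (4 * \<kappa>\<^sup>2)"
      by (rule divide_right_mono) simp
    also have "\<dots> = 1/2" using pos by simp
    finally have "(min 1 \<kappa>)\<^sup>2 * (1 + \<kappa>\<^sup>2) / (4 * \<kappa>\<^sup>2) \<le> 1/2" .
    then have "((min 1 \<kappa>)\<^sup>2 * (1 + \<kappa>\<^sup>2) / (4 * \<kappa>\<^sup>2)) * x\<^sup>2 \<le> 1/2 * x\<^sup>2" by (rule mult_right_mono) simp
    then show ?thesis by (simp only: times_divide_eq_left mult.assoc)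
  qed
  finally have "x = 0" by simp
  then show ?thesis using L2nrm_eq_0_iff[OF H1_L2[OF domain uH]] by (simp add: x_def ae_eq_def)
qed

lemma discrete_problem_unique_solvable:
  assumes S: "H1_subspace \<B> S" "has_dim \<B> S m" and C: "C > 0"
    and eta: "eta c \<kappa> R N S \<le> ereal (min 1 \<kappa> / (2 * \<kappa> * C))"
    and l: "continuous_antilinear \<B> l"
  shows "ex1_ae \<B> (\<lambda>u. u \<in> S \<and> (\<forall>v\<in>S. a_form c \<kappa> R N u v = l v))"
proof (rule galerkin_unique_solvable[OF S])
  have SH: "v \<in> H1 \<B>" if "v \<in> S" for v using S that by (auto simp: H1_subspace_def)
  have l_add: "l (\<lambda>x. u x + v x) = l u + l v" if "u \<in> H1 \<B>" "v \<in> H1 \<B>" for u v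
    using l that by (auto simp: continuous_antilinear_def)
  have l_cmult: "l (\<lambda>x. a * u x) = cnj a * l u" if "u \<in> H1 \<B>" for a u
    using l that by (auto simp: continuous_antilinear_def)
  obtain D where D: "\<And>v. v \<in> H1 \<B> \<Longrightarrow> cmod (l v) \<le> D * H1nrm \<B> v"
    using l unfolding continuous_antilinear_def by blast
  show "l (\<lambda>x. u x + v x) = l u + l v" if "u \<in> S" "v \<in> S" for u v using l_add SH that by auto
  show "l (\<lambda>x. a * u x) = cnj a * l u" if "u \<in> S" for a u using l_cmult SH that by auto
  show "l u = l v" if "u \<in> S" "v \<in> S" "ae_eq \<B> u v" for u v
  proof -
    note H = SH[OF that(1)] SH[OF that(2)]
    let ?d = "\<lambda>x. u x + (- 1) * v x"
    have dH: "?d \<in> H1 \<B>" by (intro H1_add[OF domain] H1_cmult[OF domain] H)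
    have "ae_eq \<B> ?d (\<lambda>x. 0 * u x)" using that(3) unfolding ae_eq_def by eventually_elim simp
    then have "H1nrm \<B> ?d = 0"
      using H1nrm_cong[OF domain dH H1_cmult[OF domain H(1), of 0]] H1nrm_cmult[OF domain H(1), of 0] by simp
    then have "l ?d = 0" using D[OF dH] by simp
    then show ?thesis using l_add[OF H(1) H1_cmult[OF domain H(2)], of "-1"] l_cmult[OF H(2), of "-1"] by simp
  qed
  show "ae_eq \<B> u (\<lambda>x. 0)" if "u \<in> S" "\<And>v. v \<in> S \<Longrightarrow> a_form c \<kappa> R N u v = 0" for u
    by (rule discrete_kernel_trivial[OF S(1) C eta that])
  show "a_form c \<kappa> R N (\<lambda>x. u x + v x) w = a_form c \<kappa> R N u w + a_form c \<kappa> R N v w"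
    "a_form c \<kappa> R N w (\<lambda>x. u x + v x) = a_form c \<kappa> R N w u + a_form c \<kappa> R N w v"
    if "u \<in> S" "v \<in> S" "w \<in> S" for u v w
    using that by (intro a_form_add_left a_form_add_right SH; simp)+
  show "a_form c \<kappa> R N (\<lambda>x. a * u x) w = a * a_form c \<kappa> R N u w"
    "a_form c \<kappa> R N w (\<lambda>x. a * u x) = cnj a * a_form c \<kappa> R N w u"
    if "u \<in> S" "w \<in> S" for a u w
    using that by (intro a_form_cmult_left a_form_cmult_right SH; simp)+
  show "a_form c \<kappa> R N w u = a_form c \<kappa> R N w v"
    if "u \<in> S" "v \<in> S" "w \<in> S" "ae_eq \<B> u v" for u v w
    using that by (intro a_form_cong_right SH)
qed

end

theorem theorem4p1:
  fixes \<Omega> :: "(real^'n) set"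
    and c :: "nat \<Rightarrow> 'n"
    and R\<^sub>0 R \<kappa>\<^sub>0 \<kappa> C\<^sub>b h :: real
    and s :: "nat \<Rightarrow> real"
    and V :: "real \<Rightarrow> (real^'n \<Rightarrow> complex) set"
    and \<T> :: "real \<Rightarrow> (real^'n) set set"
    and N\<^sub>0 :: nat
  assumes "CARD('n) \<in> {2, 3}"
    and "bij_betw c {1..CARD('n)} UNIV"
    and "bounded \<Omega>" and "lipschitz_domain \<Omega>"
    and "R\<^sub>0 = (SUP x\<in>\<Omega>. norm x)" and "R\<^sub>0 > 0" and "R \<ge> R\<^sub>0"
    and "\<kappa>\<^sub>0 > 0" and "CARD('n) = 2 \<Longrightarrow> \<kappa>\<^sub>0 \<ge> 1" and "\<kappa> \<ge> \<kappa>\<^sub>0"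
    and "C\<^sub>b > 0"
    and "\<And>N w v. w \<in> H1 (ball 0 R) \<Longrightarrow> v \<in> H1 (ball 0 R) \<Longrightarrow>
           cmod (a_form c \<kappa> R N w v) \<le> C\<^sub>b * H1nrm (ball 0 R) w * H1nrm (ball 0 R) v"
    and "fe_family (ball 0 R) s V \<T>" and "h \<in> range s"
    and "\<And>N f. N \<ge> N\<^sub>0 \<Longrightarrow> f \<in> L2 (lebesgue_on (ball 0 R)) \<Longrightarrow>
           ex1_ae (ball 0 R) (adjoint_solution c \<kappa> R N f)"
    and "\<And>N. N \<ge> N\<^sub>0 \<Longrightarrow> eta c \<kappa> R N (V h) \<le> ereal (min 1 \<kappa> / (2 * \<kappa> * C\<^sub>b))"
  shows "\<forall>l. continuous_antilinear (ball 0 R) l \<longrightarrow>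
           (\<exists>Nstar>0. \<forall>N\<ge>Nstar.
              ex1_ae (ball 0 R)
                (\<lambda>u. u \<in> V h \<and> (\<forall>v\<in>V h. a_form c \<kappa> R N u v = l v)))"
proof (intro allI impI exI[of _ "Suc N\<^sub>0"] conjI)
  fix l :: "(real^'n \<Rightarrow> complex) \<Rightarrow> complex" and N
  assume l: "continuous_antilinear (ball 0 R) l" and "Suc N\<^sub>0 \<le> N"
  then have N: "N\<^sub>0 \<le> N" by simp
  have pos: "\<kappa> > 0" "R > 0" using assms(6-8,10) by linarith+
  obtain m where V: "H1_subspace (ball 0 R) (V h)" "has_dim (ball 0 R) (V h) m"
    using assms(13,14) unfolding fe_family_def by blast
  have adjoint: "\<exists>w. adjoint_solution c \<kappa> R N f w" if "f \<in> L2 (lebesgue_on (ball 0 R))" for f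
    using assms(15)[OF N that] by (simp add: ex1_ae_def)
  show "ex1_ae (ball 0 R) (\<lambda>u. u \<in> V h \<and> (\<forall>v\<in>V h. a_form c \<kappa> R N u v = l v))"
    by (rule discrete_problem_unique_solvable[OF assms(1) pos assms(12) adjoint V assms(11) assms(16)[OF N] l])
qed simp

end
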